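(* Let $k\ge 1$ be fixed, let $(T,o)$ be a semi-$k$-ary rooted tree of depth $r<\infty$, and for each $n$ let $o_n\in\binom{[n]}{k}$. Then \[\lim_{n\to\infty}\mathbb{P}\big(B_r(G_{n,k},o_n)\cong (T,o)\big)=\frac{m^*(T,o)\cdot (k!)^{|V_k(T)|}\,e^{-k|V_{k-1}(B_{r-1}(T,o))|}}{|\mathrm{Aut}(T,o)|}.\]
   Context: $\binom{S}{j}$ is the set of $j$-element subsets of $S$, $[n]=\{1,\dots,n\}$. A $k$-dimensional hypertree on $[n]$ is a $k$-dimensional simplicial complex $C$ on $[n]$ containing all subsets of size $\le k$, having exactly $\binom{n-1}{k}$ faces of size $k+1$, and with $H_{k-1}(C)$ (integer coefficients) finite; $\nu_{n,k}$ is the probability measure on the set of such hypertrees with $\nu_{n,k}(C)=|H_{k-1}(C)|^2/n^{\binom{n-2}{k}}$. $L_{n,k}$ is the bipartite graph with vertex classes $\binom{[n]}{k+1}$ and $\binom{[n]}{k}$, with $X\sim Y$ iff $Y\subset X$. With $C_{n,k}$ of law $\nu_{n,k}$, $G_{n,k}$ is the subgraph of $L_{n,k}$ induced by $\binom{[n]}{k}$ together with the $(k+1)$-element faces of $C_{n,k}$. $B_s(G,v)$ is the ball of radius $s$ around $v$ (induced subgraph on vertices at distance $\le s$), rooted at $v$; $\cong$ is rooted isomorphism. A semi-$k$-ary rooted tree is a pair $(T,o)$ where $T$ is a locally finite tree, $o\in V(T)$, and every vertex at odd distance from $o$ has exactly $k$ children (degree $k+1$). Its depth is $\sup_{v}d(o,v)$.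 $V_k(T)$ is the set of vertices at odd distance from $o$, $V_{k-1}(T)$ the set at even distance. $\mathrm{Aut}(T,o)$ is the group of root-preserving automorphisms. For depth $r<\infty$, $m^*(T,o)$ is the number of matchings of $T$ that cover every vertex of $B_{r-1}(T,o)$. *)

theory Defs
  imports
    "HOL-Analysis.Analysis"
    "HOL-Algebra.Free_Abelian_Groups"
    "HOL-Algebra.Bij"
    "HOL-Library.Ramsey"
    "HOL-Library.Extended_Nat"
begin

section \<open>Graphs\<close>

record 'v ugraph =
  verts :: "'v set"
  edges :: "'v set set"

definition simple_graph :: "'v ugraph \<Rightarrow> bool" where
  "simple_graph G \<longleftrightarrow> edges G \<subseteq> nsets (verts G) 2"

definition adj :: "'v ugraph \<Rightarrow> 'v \<Rightarrow> 'v \<Rightarrow> bool" where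
  "adj G u v \<longleftrightarrow> {u, v} \<in> edges G"

definition neighbours :: "'v ugraph \<Rightarrow> 'v \<Rightarrow> 'v set" where
  "neighbours G v = {u \<in> verts G. adj G v u}"

definition locally_finite_graph :: "'v ugraph \<Rightarrow> bool" where
  "locally_finite_graph G \<longleftrightarrow> (\<forall>v\<in>verts G. finite (neighbours G v))"

definition induced_subgraph :: "'v ugraph \<Rightarrow> 'v set \<Rightarrow> 'v ugraph" where
  "induced_subgraph G S =
     \<lparr>verts = verts G \<inter> S, edges = {e \<in> edges G. e \<subseteq> S}\<rparr>"

text \<open>A walk is given by its nonempty list of vertices; its length is the number of
  its edges, i.e. one less than the length of the list.\<close>

definition walk :: "'v ugraph \<Rightarrow> 'v list \<Rightarrow> bool" where
  "walk G xs \<longleftrightarrow> xs \<noteq> [] \<and> set xs \<subseteq> verts G \<and> successively (adj G) xs"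

definition walk_betw :: "'v ugraph \<Rightarrow> 'v \<Rightarrow> 'v list \<Rightarrow> 'v \<Rightarrow> bool" where
  "walk_betw G u xs v \<longleftrightarrow> walk G xs \<and> hd xs = u \<and> last xs = v"

definition cycle :: "'v ugraph \<Rightarrow> 'v list \<Rightarrow> bool" where
  "cycle G xs \<longleftrightarrow> walk G xs \<and> distinct xs \<and> 3 \<le> length xs \<and> adj G (last xs) (hd xs)"

definition connected_graph :: "'v ugraph \<Rightarrow> bool" where
  "connected_graph G \<longleftrightarrow>
     verts G \<noteq> {} \<and> (\<forall>u\<in>verts G. \<forall>v\<in>verts G. \<exists>xs. walk_betw G u xs v)"

definition tree :: "'v ugraph \<Rightarrow> bool" where
  "tree G \<longleftrightarrow> simple_graph G \<and> connected_graph G \<and> (\<nexists>xs. cycle G xs)"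

text \<open>Vertices joined by no walk are at distance \<open>\<infinity>\<close> (the infimum of the empty set).\<close>

definition gdist :: "'v ugraph \<Rightarrow> 'v \<Rightarrow> 'v \<Rightarrow> enat" where
  "gdist G u v = (INF xs\<in>{xs. walk_betw G u xs v}. enat (length xs - 1))"

text \<open>The radius of a ball is an integer, so that the ball of radius \<open>-1\<close> is empty.\<close>

definition gball :: "'v ugraph \<Rightarrow> int \<Rightarrow> 'v \<Rightarrow> 'v ugraph" where
  "gball G s v =
     induced_subgraph G {u \<in> verts G. \<exists>d::nat. gdist G v u = enat d \<and> int d \<le> s}"

definition rooted_iso_map :: "'v ugraph \<Rightarrow> 'v \<Rightarrow> 'w ugraph \<Rightarrow> 'w \<Rightarrow> ('v \<Rightarrow> 'w) \<Rightarrow> bool" where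
  "rooted_iso_map G u H w f \<longleftrightarrow>
     bij_betw f (verts G) (verts H) \<and> f u = w \<and>
     (\<forall>x\<in>verts G. \<forall>y\<in>verts G. adj G x y \<longleftrightarrow> adj H (f x) (f y))"

definition rooted_isomorphic :: "'v ugraph \<Rightarrow> 'v \<Rightarrow> 'w ugraph \<Rightarrow> 'w \<Rightarrow> bool" where
  "rooted_isomorphic G u H w \<longleftrightarrow> (\<exists>f. rooted_iso_map G u H w f)"

definition rooted_Aut :: "'v ugraph \<Rightarrow> 'v \<Rightarrow> ('v \<Rightarrow> 'v) monoid" where
  "rooted_Aut G u =
     (BijGroup (verts G))\<lparr>carrier := {f \<in> Bij (verts G). rooted_iso_map G u G u f}\<rparr>"

definition matching :: "'v ugraph \<Rightarrow> 'v set set \<Rightarrow> bool" where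
  "matching G M \<longleftrightarrow> M \<subseteq> edges G \<and> pairwise disjnt M"

section \<open>Semi-k-ary rooted trees\<close>

definition odd_verts :: "'v ugraph \<Rightarrow> 'v \<Rightarrow> 'v set" where
  "odd_verts T rt = {v \<in> verts T. \<exists>d::nat. odd d \<and> gdist T rt v = enat d}"

definition even_verts :: "'v ugraph \<Rightarrow> 'v \<Rightarrow> 'v set" where
  "even_verts T rt = {v \<in> verts T. \<exists>d::nat. even d \<and> gdist T rt v = enat d}"

definition children :: "'v ugraph \<Rightarrow> 'v \<Rightarrow> 'v \<Rightarrow> 'v set" where
  "children T rt v = {u \<in> neighbours T v. gdist T rt u = gdist T rt v + 1}"

definition semi_k_ary_rooted_tree :: "nat \<Rightarrow> 'v ugraph \<Rightarrow> 'v \<Rightarrow> bool" where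
  "semi_k_ary_rooted_tree k T rt \<longleftrightarrow>
     tree T \<and> locally_finite_graph T \<and> rt \<in> verts T \<and>
     (\<forall>v\<in>odd_verts T rt. finite (children T rt v) \<and> card (children T rt v) = k)"

definition depth :: "'v ugraph \<Rightarrow> 'v \<Rightarrow> enat" where
  "depth T rt = (SUP v\<in>verts T. gdist T rt v)"

text \<open>The parameter \<open>r\<close> is the depth of the tree. For \<open>r = 0\<close> no vertex has to be covered,
  and the empty matching is the only one.\<close>

definition m_star :: "'v ugraph \<Rightarrow> 'v \<Rightarrow> nat \<Rightarrow> nat" where
  "m_star T rt r = card {M. matching T M \<and> verts (gball T (int r - 1) rt) \<subseteq> \<Union>M}"

section \<open>Simplicial homology with integer coefficients\<close>

definition simplicial_complex_on :: "nat \<Rightarrow> nat set set \<Rightarrow> bool" where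
  "simplicial_complex_on n C \<longleftrightarrow>
     C \<subseteq> Pow {1..n} \<and> (\<forall>X\<in>C. \<forall>Y. Y \<subseteq> X \<longrightarrow> Y \<in> C)"

definition dimensional :: "nat \<Rightarrow> nat set set \<Rightarrow> bool" where
  "dimensional k C \<longleftrightarrow> (\<forall>X\<in>C. card X \<le> k + 1) \<and> (\<exists>X\<in>C. card X = k + 1)"

definition simplicial_chain_group :: "nat \<Rightarrow> nat set set \<Rightarrow> (nat set \<Rightarrow>\<^sub>0 int) monoid" where
  "simplicial_chain_group p C = free_Abelian_group {X \<in> C. card X = p + 1}"

text \<open>Faces are oriented by the order of \<open>nat\<close>: deleting the vertex in position \<open>i\<close>
  (counted from 0) contributes the sign \<open>(-1) ^ i\<close>. The boundary of a vertex is the empty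
  face, so in degree 0 this is the augmentation map and the resulting homology is reduced.
  It differs from the unreduced one only in degree 0; hypertrees of dimension 1 are
  spanning trees only if reduced homology is used.\<close>

definition simplicial_boundary :: "(nat set \<Rightarrow>\<^sub>0 int) \<Rightarrow> (nat set \<Rightarrow>\<^sub>0 int)" where
  "simplicial_boundary =
     frag_extend (\<lambda>X. \<Sum>x\<in>X. frag_cmul ((-1) ^ card {y \<in> X. y < x}) (frag_of (X - {x})))"

definition simplicial_cycles :: "nat \<Rightarrow> nat set set \<Rightarrow> (nat set \<Rightarrow>\<^sub>0 int) set" where
  "simplicial_cycles p C =
     {c \<in> carrier (simplicial_chain_group p C). simplicial_boundary c = 0}"

definition simplicial_boundaries :: "nat \<Rightarrow> nat set set \<Rightarrow> (nat set \<Rightarrow>\<^sub>0 int) set" where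
  "simplicial_boundaries p C =
     simplicial_boundary ` carrier (simplicial_chain_group (p + 1) C)"

definition simplicial_homology :: "nat \<Rightarrow> nat set set \<Rightarrow> (nat set \<Rightarrow>\<^sub>0 int) set monoid" where
  "simplicial_homology p C =
     (simplicial_chain_group p C)\<lparr>carrier := simplicial_cycles p C\<rparr> Mod simplicial_boundaries p C"

section \<open>Random hypertrees\<close>

text \<open>The truncated subtractions below (in \<open>n - 1\<close>, \<open>n - 2\<close>, \<open>k - 1\<close>) are harmless for
  \<open>k \<ge> 1\<close> and \<open>n > k\<close>; for \<open>n \<le> k\<close> there are no \<open>k\<close>-dimensional complexes on \<open>{1..n}\<close>.\<close>

definition hypertrees :: "nat \<Rightarrow> nat \<Rightarrow> nat set set set" where
  "hypertrees n k =
     {C. simplicial_complex_on n C \<and> dimensional k C \<and>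
         (\<forall>X. X \<subseteq> {1..n} \<and> card X \<le> k \<longrightarrow> X \<in> C) \<and>
         card {X \<in> C. card X = k + 1} = (n - 1) choose k \<and>
         finite (carrier (simplicial_homology (k - 1) C))}"

definition hypertree_measure :: "nat \<Rightarrow> nat \<Rightarrow> nat set set measure" where
  "hypertree_measure n k =
     point_measure (hypertrees n k)
       (\<lambda>C. ennreal ((real (Coset.order (simplicial_homology (k - 1) C)))\<^sup>2 /
                     real n ^ ((n - 2) choose k)))"

definition inclusion_graph :: "nat \<Rightarrow> nat \<Rightarrow> nat set ugraph" where
  "inclusion_graph n k =
     \<lparr>verts = nsets {1..n} (k + 1) \<union> nsets {1..n} k,
      edges = {{X, Y} | X Y. X \<in> nsets {1..n} (k + 1) \<and> Y \<in> nsets {1..n} k \<and> Y \<subset> X}\<rparr>"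

definition hypertree_graph :: "nat \<Rightarrow> nat \<Rightarrow> nat set set \<Rightarrow> nat set ugraph" where
  "hypertree_graph n k C =
     induced_subgraph (inclusion_graph n k) (nsets {1..n} k \<union> {X \<in> C. card X = k + 1})"

end

theory Submission
  imports Defs
begin

text \<open>The weight $|H_{k-1}(C)|^2$ is the squared determinant of the boundary matrix of $C$
  restricted to the rows avoiding the vertex 1, because the index of a full integer lattice is
  the determinant. Cauchy--Binet therefore turns sums over hypertrees into determinants; the
  identity $\partial\partial^T + \partial^T\partial = n I$ evaluates them and, after two
  applications of Sylvester's identity, moves them to the space of all $k$-sets.

  For a fixed copy of $T$ in $L_{n,k}$ with $k$-sets $B$ at distance less than $r$ and facets
  $A$, the ball is this copy iff the facets containing a member of $B$ are exactly those in
  $A$. A change of basis kills the rows and columns in $B$ of the resulting determinant, which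
  then splits into one bounded block for each vertex $v$ outside a bounded set $U$ containing the
  copy, of determinant $1 - k|B|/n + O(n^{-2})$, and one block supported on $U$. The first
  kind produces $e^{-k|B|}$; the second, multiplied by $n^{|A|}$, tends to the determinant of a
  skew-symmetric adjacency matrix of the tree, with 1 on the diagonal at the vertices that need
  not be covered; its nonvanishing terms are the matchings counted by $m^*$. Finally there are $\sim (k!\,n)^{|A|}$ copies with a labelling by $T$, and each copy
  has $|\mathrm{Aut}(T,o)|$ labellings.\<close>

section \<open>Leibniz determinants: sign rules and block factorisation\<close>

section \<open>Determinants over finite index sets\<close>

text \<open>Three obstacles shape the argument. The determinant that counts hypertrees singles out
  the vertex 1, whereas the centre of the ball is arbitrary; passing through the space of facets,
  where faces enter only through a Gram matrix, removes the distinguished vertex. Next, a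
  \<open>k\<close>-set in \<open>B\<close> lies in \<open>n - k\<close> facets, all of them
  constrained, so its diagonal entry \<open>1 - (n - k)/n\<close> nearly vanishes and the local
  determinant is no small perturbation of the identity there. Explicit null vectors, the columns of
  the Laplacian, remedy this: once they are used as basis vectors, the entries that remain between
  \<open>k\<close>-sets outside \<open>B\<close> are within \<open>O(1/n)\<close> of the identity.
  Finally, both the number of blocks and the number of copies of the tree grow with
  \<open>n\<close>. Each block is therefore expanded to an error \<open>O(n^{-2})\<close>, because
  about \<open>n\<close> of them are multiplied, and every error is bounded through the sizes of
  \<open>U\<close>, \<open>A\<close> and \<open>B\<close> alone, which makes the convergence uniform
  over all copies.\<close>

definition fdet :: "'a set \<Rightarrow> ('a \<Rightarrow> 'a \<Rightarrow> 'b::comm_ring_1) \<Rightarrow> 'b" where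
  "fdet S A = (\<Sum>p | p permutes S. of_int (sign p) * (\<Prod>i\<in>S. A i (p i)))"

lemma fdet_cong:
  assumes "S = S'" "\<And>i j. i \<in> S' \<Longrightarrow> j \<in> S' \<Longrightarrow> A i j = B i j"
  shows "fdet S A = fdet S' B"
  unfolding fdet_def assms(1)
  by (intro sum.cong arg_cong2[where f="(*)"] prod.cong refl)
    (auto simp: assms(2) permutes_in_image)

lemma fdet_empty [simp]: "fdet {} A = 1"
  by (simp add: fdet_def)

lemma fdet_singleton [simp]: "fdet {x} A = A x x"
  by (simp add: fdet_def)

lemma fdet_permute_rows:
  assumes "finite S" "q permutes S"
  shows "fdet S (\<lambda>i j. A (q i) j) = of_int (sign q) * fdet S A"
proof -
  have "fdet S (\<lambda>i j. A (q i) j) =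
      (\<Sum>p | p permutes S. of_int (sign (p \<circ> q)) * (\<Prod>i\<in>S. A (q i) ((p \<circ> q) i)))"
    unfolding fdet_def by (rule sum_permutations_compose_right[OF assms(2)])
  also have "\<dots> = (\<Sum>p | p permutes S. of_int (sign q) * (of_int (sign p) * (\<Prod>i\<in>S. A i (p i))))"
  proof (rule sum.cong[OF refl])
    fix p assume "p \<in> {p. p permutes S}"
    then have p: "p permutes S" by simp
    have "sign (p \<circ> q) = sign p * sign q"
      using p assms by (intro sign_compose) (auto intro: permutes_imp_permutation)
    moreover have "(\<Prod>i\<in>S. A i (p i)) = (\<Prod>i\<in>S. A (q i) ((p \<circ> q) i))"
      using prod.permute[OF assms(2), of "\<lambda>i. A i (p i)"] by (simp add: o_def)
    ultimately show "of_int (sign (p \<circ> q)) * (\<Prod>i\<in>S. A (q i) ((p \<circ> q) i)) =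
        of_int (sign q) * (of_int (sign p) * (\<Prod>i\<in>S. A i (p i)))"
      by (simp add: mult_ac)
  qed
  finally show ?thesis by (simp add: fdet_def sum_distrib_left)
qed

text \<open>Exchanging the two rows changes the sign but not the matrix. Cancelling the factor 2 is
  what brings in a domain of characteristic 0, the coefficient class of the results built on this
  one.\<close>

lemma fdet_equal_rows:
  fixes A :: "'a \<Rightarrow> 'a \<Rightarrow> 'b::{idom,ring_char_0}"
  assumes "finite S" "i \<in> S" "j \<in> S" "i \<noteq> j" "\<And>l. l \<in> S \<Longrightarrow> A i l = A j l"
  shows "fdet S A = 0"
proof -
  have "fdet S A = fdet S (\<lambda>a b. A (Transposition.transpose i j a) b)"
    by (rule fdet_cong) (auto simp: assms Transposition.transpose_def)
  also have "\<dots> = - fdet S A"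
    by (subst fdet_permute_rows[OF assms(1) permutes_swap_id])
      (use assms in \<open>auto simp: sign_swap_id\<close>)
  finally have "2 * fdet S A = 0" by simp
  then show ?thesis by simp
qed

lemma fdet_transpose:
  assumes "finite S"
  shows "fdet S (\<lambda>i j. A j i) = fdet S A"
proof -
  have "fdet S A = (\<Sum>p | p permutes S. of_int (sign (inv_into UNIV p)) * (\<Prod>i\<in>S. A i (inv_into UNIV p i)))"
    unfolding fdet_def by (rule sum_permutations_inverse)
  also have "\<dots> = (\<Sum>p | p permutes S. of_int (sign p) * (\<Prod>i\<in>S. A (p i) i))"
  proof (rule sum.cong[OF refl])
    fix p assume "p \<in> {p. p permutes S}"
    then have p: "p permutes S" by simp
    have "(\<Prod>i\<in>S. A i (inv_into UNIV p i)) = (\<Prod>i\<in>S. A (p i) i)"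
      using prod.permute[OF p, of "\<lambda>i. A i (inv_into UNIV p i)"] permutes_inverses[OF p]
      by (simp add: o_def)
    moreover have "sign (inv_into UNIV p) = sign p"
      using p assms by (intro sign_inverse) (auto intro: permutes_imp_permutation)
    ultimately show "of_int (sign (inv_into UNIV p)) * (\<Prod>i\<in>S. A i (inv_into UNIV p i)) =
        of_int (sign p) * (\<Prod>i\<in>S. A (p i) i)" by simp
  qed
  finally show ?thesis by (simp add: fdet_def)
qed

lemma fdet_scale_rows: "fdet S (\<lambda>i j. c i * A i j) = prod c S * fdet S A"
  by (simp add: fdet_def prod.distrib sum_distrib_left mult_ac)

lemma fdet_diagonal:
  assumes "finite S" "\<And>i j. i \<in> S \<Longrightarrow> j \<in> S \<Longrightarrow> i \<noteq> j \<Longrightarrow> A i j = 0"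
  shows "fdet S A = (\<Prod>i\<in>S. A i i)"
proof -
  have "fdet S A = (\<Sum>p\<in>{id}. of_int (sign p) * (\<Prod>i\<in>S. A i (p i)))"
    unfolding fdet_def
  proof (rule sum.mono_neutral_right)
    show "\<forall>p\<in>{p. p permutes S} - {id}. of_int (sign p) * (\<Prod>i\<in>S. A i (p i)) = 0"
    proof
      fix p assume "p \<in> {p. p permutes S} - {id}"
      then have p: "p permutes S" "p \<noteq> id" by auto
      then obtain i where "p i \<noteq> i" by (auto simp: fun_eq_iff)
      with p(1) have "i \<in> S" by (metis permutes_not_in)
      with p(1) assms(2) \<open>p i \<noteq> i\<close> have "A i (p i) = 0"
        by (metis permutes_in_image)
      with \<open>i \<in> S\<close> assms(1) have "(\<Prod>i\<in>S. A i (p i)) = 0" by (meson prod_zero)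
      then show "of_int (sign p) * (\<Prod>i\<in>S. A i (p i)) = 0" by simp
    qed
  qed (auto simp: assms finite_permutations permutes_id)
  then show ?thesis by simp
qed

lemma fdet_identity: "finite S \<Longrightarrow> fdet S (\<lambda>i j. if i = j then 1 else 0) = 1"
  by (subst fdet_diagonal) auto

text \<open>A permutation that sends some row of \<open>S\<close> into \<open>T\<close> picks a zero
  entry. The others preserve \<open>S\<close>, hence also \<open>T\<close>, and are exactly the
  products of a permutation of each part.\<close>

lemma fdet_block:
  fixes A :: "'a \<Rightarrow> 'a \<Rightarrow> 'b::comm_ring_1"
  assumes fin: "finite S" "finite T" and disj: "S \<inter> T = {}"
    and zero: "\<And>i j. i \<in> S \<Longrightarrow> j \<in> T \<Longrightarrow> A i j = 0"
  shows "fdet (S \<union> T) A = fdet S A * fdet T A"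
proof -
  let ?P = "\<lambda>S. {p. p permutes S}"
  let ?t = "\<lambda>S p. of_int (sign p) * (\<Prod>i\<in>S. A i (p i))"
  let ?Q = "{p. p permutes (S \<union> T) \<and> p ` S \<subseteq> S}"
  have "fdet (S \<union> T) A = sum (?t (S \<union> T)) ?Q"
    unfolding fdet_def
  proof (rule sum.mono_neutral_right)
    show "\<forall>p\<in>?P (S \<union> T) - ?Q. ?t (S \<union> T) p = 0"
    proof
      fix p assume "p \<in> ?P (S \<union> T) - ?Q"
      then have p: "p permutes (S \<union> T)" "\<not> p ` S \<subseteq> S" by auto
      then obtain i where i: "i \<in> S" "p i \<notin> S" by auto
      then have "p i \<in> T" using p(1) permutes_in_image by fastforce
      with i zero have "A i (p i) = 0" by simp
      with i fin have "(\<Prod>i\<in>S \<union> T. A i (p i)) = 0" by (intro prod_zero) auto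
      then show "?t (S \<union> T) p = 0" by simp
    qed
  qed (auto simp: fin finite_permutations)
  also have "\<dots> = (\<Sum>(q, r)\<in>?P S \<times> ?P T. ?t S q * ?t T r)"
  proof (rule sum.reindex_bij_witness[where j = "\<lambda>p. (restrict_id p S, restrict_id p T)"
        and i = "\<lambda>(q, r). q \<circ> r"])
    fix p assume "p \<in> ?Q"
    then have p: "p permutes (S \<union> T)" "p ` S \<subseteq> S" by auto
    have inj: "inj p" using p(1) by (rule permutes_inj)
    have S: "bij_betw p S S"
      using p(2) inj fin(1) unfolding bij_betw_def
      by (metis endo_inj_surj inj_on_subset subset_UNIV)
    have im: "p ` (S \<union> T) = S \<union> T" using p(1) by (rule permutes_image)
    have "p ` T \<subseteq> T"
    proof
      fix y assume "y \<in> p ` T"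
      then obtain x where x: "x \<in> T" "y = p x" by auto
      then have "y \<in> S \<union> T" using im by auto
      moreover have "y \<notin> S"
      proof
        assume "y \<in> S"
        then obtain x' where "x' \<in> S" "y = p x'" using S by (auto simp: bij_betw_def)
        with x inj have "x = x'" by (auto dest: injD)
        with x \<open>x' \<in> S\<close> disj show False by auto
      qed
      ultimately show "y \<in> T" by auto
    qed
    then have T: "bij_betw p T T"
      using inj fin(2) unfolding bij_betw_def
      by (metis endo_inj_surj inj_on_subset subset_UNIV)
    show "(restrict_id p S, restrict_id p T) \<in> ?P S \<times> ?P T"
      using S T by (auto intro: permutes_restrict_id)
    show comp: "(case (restrict_id p S, restrict_id p T) of (q, r) \<Rightarrow> q \<circ> r) = p"
    proof
      fix x
      show "(case (restrict_id p S, restrict_id p T) of (q, r) \<Rightarrow> q \<circ> r) x = p x"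
        using disj \<open>p ` T \<subseteq> T\<close> p(1)
        by (cases "x \<in> T"; cases "x \<in> S") (auto simp: restrict_id_def permutes_def)
    qed
    have "sign p = sign (restrict_id p S) * sign (restrict_id p T)"
    proof -
      have "permutation (restrict_id p S)" "permutation (restrict_id p T)"
        using S T fin by (meson permutes_imp_permutation permutes_restrict_id)+
      from sign_compose[OF this] comp show ?thesis by simp
    qed
    moreover have "(\<Prod>i\<in>S \<union> T. A i (p i)) =
        (\<Prod>i\<in>S. A i (restrict_id p S i)) * (\<Prod>i\<in>T. A i (restrict_id p T i))"
      using fin disj by (simp add: prod.union_disjoint)
    ultimately show "(case (restrict_id p S, restrict_id p T) of (q, r) \<Rightarrow> ?t S q * ?t T r) =
        ?t (S \<union> T) p"
      by (simp add: mult_ac)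
  next
    fix x assume "x \<in> ?P S \<times> ?P T"
    then obtain q r where x: "x = (q, r)" "q permutes S" "r permutes T" by auto
    have qr: "(q \<circ> r) i = q i" if "i \<in> S" for i
    proof -
      have "i \<notin> T" using disj that by auto
      then show ?thesis using permutes_not_in[OF x(3)] by simp
    qed
    have qr': "(q \<circ> r) i = r i" if "i \<in> T" for i
    proof -
      have "r i \<in> T" using that permutes_in_image[OF x(3)] by simp
      then have "r i \<notin> S" using disj by auto
      then show ?thesis using permutes_not_in[OF x(2)] by simp
    qed
    show "(restrict_id (case x of (q, r) \<Rightarrow> q \<circ> r) S, restrict_id (case x of (q, r) \<Rightarrow> q \<circ> r) T) = x"
    proof -
      have "restrict_id (q \<circ> r) S = q"
      proof
        fix i show "restrict_id (q \<circ> r) S i = q i"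
          using qr[of i] permutes_not_in[OF x(2), of i] by (cases "i \<in> S") auto
      qed
      moreover have "restrict_id (q \<circ> r) T = r"
      proof
        fix i show "restrict_id (q \<circ> r) T i = r i"
          using qr'[of i] permutes_not_in[OF x(3), of i] by (cases "i \<in> T") auto
      qed
      ultimately show ?thesis using x by simp
    qed
    have "(q \<circ> r) permutes (S \<union> T)"
      using x by (intro permutes_compose permutes_subset[of _ _ "S \<union> T"]) auto
    moreover have "(q \<circ> r) ` S \<subseteq> S"
      using qr x(2) permutes_in_image[OF x(2)] by fastforce
    ultimately show "(case x of (q, r) \<Rightarrow> q \<circ> r) \<in> ?Q" using x by simp
  qed
  also have "\<dots> = fdet S A * fdet T A"
    by (simp add: fdet_def sum_product sum.cartesian_product)
  finally show ?thesis .
qed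

text \<open>Iterated block splitting along the fibres of a key. \<open>K\<close> may exceed the set
  of keys that occur, since an empty fibre contributes the empty determinant 1; later all subsets of
  the complement of \<open>U\<close> serve as keys.\<close>

lemma fdet_block_keys:
  fixes A :: "'a \<Rightarrow> 'a \<Rightarrow> 'b::comm_ring_1"
  assumes fin: "finite S" "finite K" and sub: "\<kappa> ` S \<subseteq> K"
    and zero: "\<And>i j. i \<in> S \<Longrightarrow> j \<in> S \<Longrightarrow> \<kappa> i \<noteq> \<kappa> j \<Longrightarrow> A i j = 0"
  shows "fdet S A = (\<Prod>c\<in>K. fdet {i \<in> S. \<kappa> i = c} A)"
  using fin(2) fin(1) sub zero
proof (induction K arbitrary: S rule: finite_induct)
  case empty
  then show ?case by simp
next
  case (insert c K)
  let ?S1 = "{i \<in> S. \<kappa> i = c}" and ?S2 = "{i \<in> S. \<kappa> i \<noteq> c}"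
  have "fdet S A = fdet (?S1 \<union> ?S2) A"
    by (rule fdet_cong) auto
  also have "\<dots> = fdet ?S1 A * fdet ?S2 A"
    using insert.prems by (intro fdet_block) auto
  also have "fdet ?S2 A = (\<Prod>c'\<in>K. fdet {i \<in> ?S2. \<kappa> i = c'} A)"
    using insert.prems by (intro insert.IH) auto
  also have "\<dots> = (\<Prod>c'\<in>K. fdet {i \<in> S. \<kappa> i = c'} A)"
    using insert.hyps by (intro prod.cong fdet_cong) auto
  finally show ?case using insert.hyps by simp
qed

lemma fdet_reindex:
  assumes "finite S" "inj_on h S"
  shows "fdet (h ` S) A = fdet S (\<lambda>i j. A (h i) (h j))"
proof -
  let ?m = "map_permutation S h"
  have bij: "bij_betw h S (h ` S)" using assms by (simp add: bij_betw_def)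
  have m: "?m = (\<lambda>\<pi> x. if x \<in> h ` S then h (\<pi> (inv_into S h x)) else x)"
    by (auto simp: map_permutation_def restrict_id_def fun_eq_iff)
  have "fdet (h ` S) A = (\<Sum>p | p permutes S. of_int (sign (?m p)) * (\<Prod>i\<in>h ` S. A i (?m p i)))"
    unfolding fdet_def
    by (rule sum.reindex_bij_betw[symmetric]) (use bij_betw_permutations[OF bij] m in simp)
  also have "\<dots> = fdet S (\<lambda>i j. A (h i) (h j))"
    unfolding fdet_def
    by (rule sum.cong[OF refl])
      (use assms in \<open>auto simp: sign_map_permutation prod.reindex map_permutation_apply\<close>)
  finally show ?thesis .
qed

section \<open>Cauchy-Binet, products and Schur complements\<close>

lemma fdet_mult_rows_expand:
  fixes A B :: "'a \<Rightarrow> 'a \<Rightarrow> 'b::comm_ring_1"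
  assumes "finite S" "finite T"
  shows "fdet S (\<lambda>i j. \<Sum>l\<in>T. A' i l * B' l j) =
    (\<Sum>f\<in>S \<rightarrow>\<^sub>E T. (\<Prod>i\<in>S. A' i (f i)) * fdet S (\<lambda>i j. B' (f i) j))"
proof -
  have "fdet S (\<lambda>i j. \<Sum>l\<in>T. A' i l * B' l j) =
     (\<Sum>p | p permutes S. \<Sum>f\<in>S \<rightarrow>\<^sub>E T. of_int (sign p) * (\<Prod>i\<in>S. A' i (f i) * B' (f i) (p i)))"
    unfolding fdet_def using assms
    by (simp add: prod_sum_PiE sum_distrib_left)
  also have "\<dots> = (\<Sum>f\<in>S \<rightarrow>\<^sub>E T. \<Sum>p | p permutes S. of_int (sign p) * (\<Prod>i\<in>S. A' i (f i) * B' (f i) (p i)))"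
    by (rule sum.swap)
  also have "\<dots> = (\<Sum>f\<in>S \<rightarrow>\<^sub>E T. (\<Prod>i\<in>S. A' i (f i)) * fdet S (\<lambda>i j. B' (f i) j))"
    by (simp add: fdet_def sum_distrib_left prod.distrib mult_ac)
  finally show ?thesis .
qed

text \<open>Multilinearity in the rows gives one term per map from \<open>S\<close> to
  \<open>T\<close>. Non-injective maps repeat a row of \<open>B\<close> and vanish; an injective map
  is its image \<open>J\<close> together with a permutation relative to the enumeration
  \<open>e J\<close>. The enumerations are arbitrary, because another choice permutes columns of one
  factor and rows of the other and the two signs cancel.\<close>

lemma fdet_Cauchy_Binet:
  fixes A :: "'a \<Rightarrow> 'c \<Rightarrow> 'b::{idom,ring_char_0}"
  assumes fin: "finite S" "finite T"
    and e: "\<And>J. J \<subseteq> T \<Longrightarrow> card J = card S \<Longrightarrow> bij_betw (e J) S J"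
  shows "fdet S (\<lambda>i j. \<Sum>l\<in>T. A i l * B l j) =
    (\<Sum>J | J \<subseteq> T \<and> card J = card S. fdet S (\<lambda>i j. A i (e J j)) * fdet S (\<lambda>i j. B (e J i) j))"
proof -
  let ?F = "{f \<in> S \<rightarrow>\<^sub>E T. inj_on f S}" and ?J = "{J. J \<subseteq> T \<and> card J = card S}"
  let ?t = "\<lambda>f. (\<Prod>i\<in>S. A i (f i)) * fdet S (\<lambda>i j. B (f i) j)"
  have finJ: "finite ?J" using fin by simp
  have "fdet S (\<lambda>i j. \<Sum>l\<in>T. A i l * B l j) = sum ?t (S \<rightarrow>\<^sub>E T)"
    by (rule fdet_mult_rows_expand[OF fin])
  also have "\<dots> = sum ?t ?F"
  proof (rule sum.mono_neutral_right)
    show "\<forall>f\<in>(S \<rightarrow>\<^sub>E T) - ?F. ?t f = 0"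
    proof
      fix f assume "f \<in> (S \<rightarrow>\<^sub>E T) - ?F"
      then obtain i j where "i \<in> S" "j \<in> S" "i \<noteq> j" "f i = f j" by (auto simp: inj_on_def)
      then have "fdet S (\<lambda>i j. B (f i) j) = 0"
        by (intro fdet_equal_rows[of S i j] fin) auto
      then show "?t f = 0" by simp
    qed
  qed (auto simp: fin finite_PiE)
  also have "\<dots> = (\<Sum>(J, p)\<in>?J \<times> {p. p permutes S}.
      of_int (sign p) * (\<Prod>i\<in>S. A i (e J (p i))) * fdet S (\<lambda>i j. B (e J i) j))"
  proof (rule sum.reindex_bij_witness[where
        i = "\<lambda>(J, p). restrict (e J \<circ> p) S" and
        j = "\<lambda>f. (f ` S, restrict_id (inv_into S (e (f ` S)) \<circ> f) S)"])
    fix f assume "f \<in> ?F"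
    then have f: "f \<in> S \<rightarrow>\<^sub>E T" "inj_on f S" by auto
    define J where "J = f ` S"
    have J: "J \<subseteq> T" "card J = card S" using f by (auto simp: J_def card_image)
    note b = e[OF J]
    define p where "p = restrict_id (inv_into S (e J) \<circ> f) S"
    have "bij_betw f S J" using f by (simp add: bij_betw_def J_def)
    then have p: "p permutes S"
      unfolding p_def by (intro permutes_restrict_id bij_betw_trans[OF _ bij_betw_inv_into[OF b]])
    have ep: "e J (p i) = f i" if "i \<in> S" for i
      using b that by (auto simp: p_def bij_betw_def J_def intro: f_inv_into_f)
    have "restrict (e J \<circ> p) S = f"
    proof
      fix i show "restrict (e J \<circ> p) S i = f i"
        using ep[of i] PiE_arb[OF f(1), of i] by (cases "i \<in> S") auto
    qed
    then show "(case (f ` S, restrict_id (inv_into S (e (f ` S)) \<circ> f) S) of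
        (J, p) \<Rightarrow> restrict (e J \<circ> p) S) = f"
      by (simp add: J_def p_def)
    show "(f ` S, restrict_id (inv_into S (e (f ` S)) \<circ> f) S) \<in> ?J \<times> {p. p permutes S}"
      using J p by (simp add: J_def p_def)
    have "fdet S (\<lambda>i j. B (f i) j) = fdet S (\<lambda>i j. B (e J (p i)) j)"
      by (rule fdet_cong) (simp_all add: ep)
    also have "\<dots> = of_int (sign p) * fdet S (\<lambda>i j. B (e J i) j)"
      by (rule fdet_permute_rows[OF fin(1) p])
    finally have "?t f = of_int (sign p) * (\<Prod>i\<in>S. A i (e J (p i))) * fdet S (\<lambda>i j. B (e J i) j)"
      using ep by (simp add: mult_ac)
    then show "(case (f ` S, restrict_id (inv_into S (e (f ` S)) \<circ> f) S) of
        (J, p) \<Rightarrow> of_int (sign p) * (\<Prod>i\<in>S. A i (e J (p i))) * fdet S (\<lambda>i j. B (e J i) j)) = ?t f"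
      by (simp add: J_def p_def)
  next
    fix x assume "x \<in> ?J \<times> {p. p permutes S}"
    then obtain J p where x: "x = (J, p)" "J \<subseteq> T" "card J = card S" "p permutes S" by auto
    note b = e[OF x(2,3)]
    define f where "f = restrict (e J \<circ> p) S"
    have bf: "bij_betw f S J"
    proof -
      have "bij_betw (e J \<circ> p) S J"
        by (rule bij_betw_trans[OF permutes_imp_bij[OF x(4)] b])
      then show ?thesis unfolding f_def by (simp cong: bij_betw_cong)
    qed
    then have fS: "f ` S = J" by (simp add: bij_betw_def)
    have "restrict_id (inv_into S (e J) \<circ> f) S = p"
    proof
      fix i show "restrict_id (inv_into S (e J) \<circ> f) S i = p i"
        using x(4) b by (cases "i \<in> S")
          (auto simp: f_def permutes_in_image permutes_not_in bij_betw_def)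
    qed
    then show "((case x of (J, p) \<Rightarrow> restrict (e J \<circ> p) S) ` S,
        restrict_id (inv_into S (e ((case x of (J, p) \<Rightarrow> restrict (e J \<circ> p) S) ` S)) \<circ>
        (case x of (J, p) \<Rightarrow> restrict (e J \<circ> p) S)) S) = x"
      using x fS by (simp add: f_def)
    show "(case x of (J, p) \<Rightarrow> restrict (e J \<circ> p) S) \<in> ?F"
    proof -
      have "f i \<in> T" if "i \<in> S" for i
        using fS x(2) that by auto
      then have "f \<in> S \<rightarrow>\<^sub>E T" by (auto simp: f_def)
      then show ?thesis using bf x(1) by (simp add: bij_betw_def f_def)
    qed
  qed
  also have "\<dots> = (\<Sum>J\<in>?J. \<Sum>p | p permutes S.
      of_int (sign p) * (\<Prod>i\<in>S. A i (e J (p i))) * fdet S (\<lambda>i j. B (e J i) j))"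
    by (rule sum.cartesian_product[symmetric])
  also have "\<dots> = (\<Sum>J\<in>?J. fdet S (\<lambda>i j. A i (e J j)) * fdet S (\<lambda>i j. B (e J i) j))"
    by (simp add: fdet_def sum_distrib_right)
  finally show ?thesis .
qed

text \<open>The case of Cauchy-Binet in which the only admissible \<open>J\<close> is
  \<open>S\<close> itself, enumerated by the identity.\<close>

lemma fdet_mult:
  fixes A B :: "'a \<Rightarrow> 'a \<Rightarrow> 'b::{idom,ring_char_0}"
  assumes "finite S"
  shows "fdet S (\<lambda>i j. \<Sum>l\<in>S. A i l * B l j) = fdet S A * fdet S B"
proof -
  have "{J. J \<subseteq> S \<and> card J = card S} = {S}"
    using assms by (auto dest: card_subset_eq)
  then show ?thesis
    by (subst fdet_Cauchy_Binet[where e = "\<lambda>_ i. i"])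
      (use assms in \<open>auto dest!: card_subset_eq simp: bij_betw_def\<close>)
qed

text \<open>Block elimination: left multiplication by the unipotent matrix \<open>P\<close> clears
  the block with rows in \<open>S\<close> and columns in \<open>T\<close>, leaving the Schur
  complement on \<open>S\<close> and the identity on \<open>T\<close>.\<close>

lemma fdet_Schur:
  fixes M :: "'a \<Rightarrow> 'a \<Rightarrow> 'b::{idom,ring_char_0}"
  assumes fin: "finite S" "finite T" and disj: "S \<inter> T = {}"
    and M: "\<And>i j. i \<in> T \<Longrightarrow> j \<in> T \<Longrightarrow> M i j = (if i = j then 1 else 0)"
  shows "fdet (S \<union> T) M = fdet S (\<lambda>i j. M i j - (\<Sum>l\<in>T. M i l * M l j))"
proof -
  define P where "P i j = (if i = j then 1 else 0) - (if i \<in> S \<and> j \<in> T then M i j else 0)" for i j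
  have "fdet (T \<union> S) P = fdet T P * fdet S P"
    using disj by (intro fdet_block fin) (auto simp: P_def)
  also have "fdet T P = fdet T (\<lambda>i j. if i = j then 1 else 0)"
    using disj by (intro fdet_cong) (auto simp: P_def)
  also have "fdet S P = fdet S (\<lambda>i j. if i = j then 1 else 0)"
    using disj by (intro fdet_cong) (auto simp: P_def)
  finally have P: "fdet (S \<union> T) P = 1" by (simp add: fdet_identity fin Un_commute)
  define Q where "Q i j = (\<Sum>l\<in>S \<union> T. P i l * M l j)" for i j
  have QS: "Q i j = M i j - (\<Sum>l\<in>T. M i l * M l j)" if "i \<in> S" for i j
  proof -
    have "Q i j = (\<Sum>l\<in>S \<union> T. (if l = i then M i j else 0) - (if l \<in> T then M i l * M l j else 0))"
      unfolding Q_def using that by (intro sum.cong) (auto simp: P_def left_diff_distrib)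
    also have "\<dots> = M i j - (\<Sum>l\<in>S \<union> T. if l \<in> T then M i l * M l j else 0)"
      using fin that by (simp add: sum_subtractf)
    also have "(\<Sum>l\<in>S \<union> T. if l \<in> T then M i l * M l j else 0) = (\<Sum>l\<in>T. M i l * M l j)"
      using fin by (intro sum.mono_neutral_cong_right) auto
    finally show ?thesis .
  qed
  have QT: "Q i j = M i j" if "i \<in> T" for i j
  proof -
    have "Q i j = (\<Sum>l\<in>S \<union> T. if l = i then M i j else 0)"
      unfolding Q_def using that disj by (intro sum.cong) (auto simp: P_def)
    then show ?thesis using fin that by simp
  qed
  have "fdet (S \<union> T) M = fdet (S \<union> T) Q"
    unfolding Q_def using P fin by (subst fdet_mult) auto
  also have "\<dots> = fdet S Q * fdet T Q"
  proof (intro fdet_block fin disj)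
    fix i j assume ij: "i \<in> S" "j \<in> T"
    have "(\<Sum>l\<in>T. M i l * M l j) = (\<Sum>l\<in>T. if l = j then M i j else 0)"
      using ij M by (intro sum.cong) auto
    then show "Q i j = 0" using ij fin by (simp add: QS)
  qed
  also have "fdet T Q = fdet T (\<lambda>i j. if i = j then 1 else 0)"
    by (rule fdet_cong) (auto simp: QT M)
  also have "fdet S Q = fdet S (\<lambda>i j. M i j - (\<Sum>l\<in>T. M i l * M l j))"
    by (rule fdet_cong) (auto simp: QS)
  finally show ?thesis by (simp add: fdet_identity fin)
qed

text \<open>Both sides are Schur complements of one matrix with identity blocks on \<open>S\<close>
  and \<open>T\<close> and off-diagonal blocks \<open>A\<close> and \<open>B\<close>. Disjointness
  lets the two index sets share one determinant; in the applications they are faces of different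
  sizes.\<close>

lemma fdet_Sylvester:
  fixes A B :: "'a \<Rightarrow> 'a \<Rightarrow> 'b::{idom,ring_char_0}"
  assumes fin: "finite S" "finite T" and disj: "S \<inter> T = {}"
  shows "fdet S (\<lambda>i j. (if i = j then 1 else 0) - (\<Sum>l\<in>T. A i l * B l j)) =
         fdet T (\<lambda>i j. (if i = j then 1 else 0) - (\<Sum>l\<in>S. B i l * A l j))"
proof -
  define M where "M i j = (if i \<in> S \<and> j \<in> T then A i j else if i \<in> T \<and> j \<in> S then B i j
    else if i = j then 1 else 0)" for i j
  have "fdet S (\<lambda>i j. (if i = j then 1 else 0) - (\<Sum>l\<in>T. A i l * B l j)) =
      fdet S (\<lambda>i j. M i j - (\<Sum>l\<in>T. M i l * M l j))"
    using disj by (intro fdet_cong arg_cong2[where f="(-)"] sum.cong) (auto simp: M_def)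
  also have "\<dots> = fdet (S \<union> T) M"
    using disj by (intro fdet_Schur[symmetric] fin) (auto simp: M_def)
  also have "\<dots> = fdet (T \<union> S) M" by (simp add: Un_commute)
  also have "\<dots> = fdet T (\<lambda>i j. M i j - (\<Sum>l\<in>S. M i l * M l j))"
    using disj by (intro fdet_Schur fin) (auto simp: M_def)
  also have "\<dots> = fdet T (\<lambda>i j. (if i = j then 1 else 0) - (\<Sum>l\<in>S. B i l * A l j))"
    using disj by (intro fdet_cong arg_cong2[where f="(-)"] sum.cong) (auto simp: M_def)
  finally show ?thesis .
qed

section \<open>Cokernel of a square integer matrix\<close>

section \<open>Index of the image of an integer matrix\<close>

text \<open>Congruence modulo the lattice spanned by the columns of \<open>M\<close>. Functions are
  not restricted to \<open>S\<close>; their values elsewhere are ignored by the relation, so the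
  quotient of \<open>UNIV\<close> is the cokernel of \<open>M\<close> on integer vectors over
  \<open>S\<close>.\<close>

definition lattice_cong :: "'a set \<Rightarrow> ('a \<Rightarrow> 'a \<Rightarrow> int) \<Rightarrow> (('a \<Rightarrow> int) \<times> ('a \<Rightarrow> int)) set" where
  "lattice_cong S M = {(x, y). \<exists>c. \<forall>i\<in>S. x i - y i = (\<Sum>j\<in>S. M i j * c j)}"

lemma lattice_congI:
  "\<forall>i\<in>S. x i - y i = (\<Sum>j\<in>S. M i j * c j) \<Longrightarrow> (x, y) \<in> lattice_cong S M"
  by (auto simp: lattice_cong_def)

lemma equiv_lattice_cong: "equiv UNIV (lattice_cong S M)"
proof (rule equivI)
  show "refl (lattice_cong S M)"
    by (auto simp: refl_on_def lattice_cong_def intro!: exI[of _ "\<lambda>_. 0"])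
  show "sym (lattice_cong S M)"
  proof (rule symI)
    fix x y assume "(x, y) \<in> lattice_cong S M"
    then obtain c where c: "\<forall>i\<in>S. x i - y i = (\<Sum>j\<in>S. M i j * c j)" by (auto simp: lattice_cong_def)
    have "\<forall>i\<in>S. y i - x i = (\<Sum>j\<in>S. M i j * (- c j))"
      using c by (auto simp: sum_negf algebra_simps)
    then show "(y, x) \<in> lattice_cong S M" by (rule lattice_congI)
  qed
  show "trans (lattice_cong S M)"
  proof (rule transI)
    fix x y z assume "(x, y) \<in> lattice_cong S M" "(y, z) \<in> lattice_cong S M"
    then obtain c d where c: "\<forall>i\<in>S. x i - y i = (\<Sum>j\<in>S. M i j * c j)"
      and d: "\<forall>i\<in>S. y i - z i = (\<Sum>j\<in>S. M i j * d j)" by (auto simp: lattice_cong_def)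
    have "\<forall>i\<in>S. x i - z i = (\<Sum>j\<in>S. M i j * (c j + d j))"
    proof
      fix i assume i: "i \<in> S"
      have "x i - z i = (x i - y i) + (y i - z i)" by simp
      then show "x i - z i = (\<Sum>j\<in>S. M i j * (c j + d j))"
        using c d i by (simp add: distrib_left sum.distrib)
    qed
    then show "(x, z) \<in> lattice_cong S M" by (rule lattice_congI)
  qed
qed simp

lemma lattice_cong_class_eq_iff:
  "lattice_cong S M `` {x} = lattice_cong S M `` {y} \<longleftrightarrow> (x, y) \<in> lattice_cong S M"
  by (rule eq_equiv_class_iff[OF equiv_lattice_cong]) simp_all

text \<open>Comparison of two maps by their kernels alone, valid also for infinite images, which
  have cardinality 0 on both sides. It lets homology classes be matched with lattice classes without
  constructing a group isomorphism.\<close>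

lemma card_image_eq_of_kernel_eq:
  assumes "\<And>x y. x \<in> A \<Longrightarrow> y \<in> A \<Longrightarrow> f x = f y \<longleftrightarrow> g x = g y"
  shows "card (f ` A) = card (g ` A)"
proof -
  have "bij_betw (\<lambda>y. g (inv_into A f y)) (f ` A) (g ` A)"
    unfolding bij_betw_def
  proof
    have *: "g (inv_into A f (f x)) = g x" if "x \<in> A" for x
      using that assms by (metis f_inv_into_f imageI inv_into_into)
    show "inj_on (\<lambda>y. g (inv_into A f y)) (f ` A)"
      using * assms by (auto simp: inj_on_def)
    show "(\<lambda>y. g (inv_into A f y)) ` f ` A = g ` A"
      using * by (auto simp: image_image)
  qed
  then show ?thesis by (rule bij_betw_same_card)
qed

lemma card_quotient_lattice_cong:
  assumes "\<And>x y. (x, y) \<in> lattice_cong S M \<longleftrightarrow> g x = g y"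
  shows "card (UNIV // lattice_cong S M) = card (range g)"
proof -
  have "UNIV // lattice_cong S M = range (\<lambda>x. lattice_cong S M `` {x})"
    by (auto simp: quotient_def)
  moreover have "card (range (\<lambda>x. lattice_cong S M `` {x})) = card (range g)"
    by (rule card_image_eq_of_kernel_eq) (simp add: lattice_cong_class_eq_iff assms)
  ultimately show ?thesis by simp
qed

text \<open>Right multiplication by an elementary matrix of determinant 1 amounts to an invertible
  integral substitution of the coefficient vector, so the column lattice is unchanged. This is the
  move in the Euclidean reduction of a row.\<close>

lemma column_add:
  fixes M :: "'a \<Rightarrow> 'a \<Rightarrow> int" and q :: int
  assumes "finite S" "l \<in> S" "j \<in> S" "l \<noteq> j"
  defines "M' \<equiv> \<lambda>i k. if k = j then M i j + q * M i l else M i k"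
  shows fdet_column_add: "fdet S M' = fdet S M"
    and lattice_cong_column_add: "lattice_cong S M' = lattice_cong S M"
proof -
  define E where "E i k = (if i = k then 1 else if i = l \<and> k = j then q else 0)" for i k
  have ME: "(\<Sum>k\<in>S. M i k * E k m) = M' i m" if "m \<in> S" for i m
  proof -
    have "(\<Sum>k\<in>S. M i k * E k m) =
        (\<Sum>k\<in>S. (if k = m then M i m else 0) + (if k = l then if m = j then q * M i l else 0 else 0))"
      using assms by (intro sum.cong) (auto simp: E_def)
    then show ?thesis using assms that by (simp add: sum.distrib M'_def)
  qed
  have "S = (S - {l}) \<union> {l}" using assms by auto
  then have "fdet S E = fdet ((S - {l}) \<union> {l}) E" by simp
  also have "\<dots> = fdet (S - {l}) E * fdet {l} E"
    using assms by (intro fdet_block) (auto simp: E_def)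
  also have "fdet (S - {l}) E = fdet (S - {l}) (\<lambda>i j. if i = j then 1 else 0)"
    by (rule fdet_cong) (auto simp: E_def)
  finally have E: "fdet S E = 1" using assms(1) by (simp add: fdet_identity) (simp add: E_def)
  have "fdet S M' = fdet S (\<lambda>i m. \<Sum>k\<in>S. M i k * E k m)"
    by (rule fdet_cong) (auto simp: ME)
  then show "fdet S M' = fdet S M" using assms E by (simp add: fdet_mult)
  have 1: "(\<Sum>k\<in>S. M' i k * c k) = (\<Sum>k\<in>S. M i k * (c k + (if k = l then q * c j else 0)))" for i c
  proof -
    have "(\<Sum>k\<in>S. M' i k * c k) = (\<Sum>k\<in>S. M i k * c k + (if k = j then q * M i l * c j else 0))"
      by (intro sum.cong) (auto simp: M'_def algebra_simps)
    also have "\<dots> = (\<Sum>k\<in>S. M i k * c k) + q * M i l * c j"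
      using assms by (simp add: sum.distrib)
    also have "\<dots> = (\<Sum>k\<in>S. M i k * c k + (if k = l then M i l * (q * c j) else 0))"
      using assms by (simp add: sum.distrib)
    also have "\<dots> = (\<Sum>k\<in>S. M i k * (c k + (if k = l then q * c j else 0)))"
      by (intro sum.cong) (auto simp: algebra_simps)
    finally show ?thesis .
  qed
  have 2: "(\<Sum>k\<in>S. M i k * c k) = (\<Sum>k\<in>S. M' i k * (c k + (if k = l then - q * c j else 0)))" for i c
    unfolding 1 using assms by (intro sum.cong) auto
  show "lattice_cong S M' = lattice_cong S M"
  proof (intro equalityI subsetI)
    fix z assume "z \<in> lattice_cong S M'"
    then obtain x y c where z: "z = (x, y)" and c: "\<forall>i\<in>S. x i - y i = (\<Sum>j\<in>S. M' i j * c j)"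
      by (auto simp: lattice_cong_def)
    show "z \<in> lattice_cong S M" unfolding z by (rule lattice_congI[OF c[unfolded 1]])
  next
    fix z assume "z \<in> lattice_cong S M"
    then obtain x y c where z: "z = (x, y)" and c: "\<forall>i\<in>S. x i - y i = (\<Sum>j\<in>S. M i j * c j)"
      by (auto simp: lattice_cong_def)
    show "z \<in> lattice_cong S M'" unfolding z by (rule lattice_congI[OF c[unfolded 2]])
  qed
qed

lemma card_range_int_mod:
  fixes g :: int
  assumes "g \<noteq> 0"
  shows "card (range (\<lambda>x. x mod g)) = nat \<bar>g\<bar>"
proof (cases "g > 0")
  case True
  have "range (\<lambda>x. x mod g) = {0..<g}"
  proof (intro equalityI subsetI)
    fix y assume "y \<in> {0..<g}"
    then have "y mod g = y" by simp
    then show "y \<in> range (\<lambda>x. x mod g)" by (metis rangeI)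
  qed (use True in auto)
  then show ?thesis using True by simp
next
  case False
  then have g: "g < 0" using assms by simp
  have "range (\<lambda>x. x mod g) = {g<..0}"
  proof (intro equalityI subsetI)
    fix y assume "y \<in> {g<..0}"
    then have "y mod g = y" by (simp add: mod_neg_neg_trivial)
    then show "y \<in> range (\<lambda>x. x mod g)" by (metis rangeI)
  qed (use g in \<open>auto simp: neg_mod_bound neg_mod_sign\<close>)
  then show ?thesis using g by simp
qed

text \<open>Row \<open>s\<close> meets only column \<open>s\<close>, so with a nonzero pivot the
  coordinate \<open>s\<close> of a lattice vector fixes the coefficient of that column: a class is a
  residue modulo the pivot together with a class on \<open>S\<close>. A zero pivot leaves coordinate
  \<open>s\<close> free; the quotient is then infinite and its cardinality 0 agrees with the right
  side.\<close>

lemma card_quotient_lattice_cong_pivot: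
  fixes M :: "'a \<Rightarrow> 'a \<Rightarrow> int"
  assumes fin: "finite S" and s: "s \<notin> S" and zero: "\<And>j. j \<in> S \<Longrightarrow> M s j = 0"
  shows "card (UNIV // lattice_cong (insert s S) M) =
    nat \<bar>M s s\<bar> * card (UNIV // lattice_cong S M)"
proof (cases "M s s = 0")
  case True
  let ?r = "lattice_cong (insert s S) M"
  have inv: "x s = y s" if "(x, y) \<in> ?r" for x y
    using that fin s zero True by (auto simp: lattice_cong_def)
  have "inj (\<lambda>m::int. ?r `` {\<lambda>_. m})"
    by (rule injI) (metis inv lattice_cong_class_eq_iff)
  then have "infinite (range (\<lambda>m::int. ?r `` {\<lambda>_. m}))"
    using finite_imageD infinite_UNIV_int by blast
  moreover have "range (\<lambda>m::int. ?r `` {\<lambda>_. m}) \<subseteq> UNIV // ?r"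
    by (auto simp: quotient_def)
  ultimately have "infinite (UNIV // ?r)" by (meson infinite_super)
  then show ?thesis using True by simp
next
  case False
  let ?g = "M s s"
  \<comment> \<open>The multiple of column \<open>s\<close> that reduces \<open>x s\<close> to its
    residue is subtracted before the class on \<open>S\<close> is taken.\<close>
  define \<phi> where "\<phi> x = (x s mod ?g, lattice_cong S M `` {\<lambda>i. x i - M i s * (x s div ?g)})" for x
  have "card (UNIV // lattice_cong (insert s S) M) = card (range \<phi>)"
  proof (rule card_quotient_lattice_cong)
    fix x y
    have "(x, y) \<in> lattice_cong (insert s S) M \<longleftrightarrow>
      (\<exists>c. x s - y s = ?g * c s \<and> (\<forall>i\<in>S. x i - y i = M i s * c s + (\<Sum>j\<in>S. M i j * c j)))"
      using fin s zero by (simp add: lattice_cong_def)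
    also have "\<dots> \<longleftrightarrow> (\<exists>a c. x s - y s = ?g * a \<and> (\<forall>i\<in>S. x i - y i = M i s * a + (\<Sum>j\<in>S. M i j * c j)))"
    proof safe
      fix a c assume *: "x s - y s = ?g * a" "\<forall>i\<in>S. x i - y i = M i s * a + (\<Sum>j\<in>S. M i j * c j)"
      have "(\<Sum>j\<in>S. M i j * c j) = (\<Sum>j\<in>S. M i j * (c(s := a)) j)" for i
        using s by (intro sum.cong) auto
      then show "\<exists>c. x s - y s = ?g * c s \<and> (\<forall>i\<in>S. x i - y i = M i s * c s + (\<Sum>j\<in>S. M i j * c j))"
        using * by (intro exI[of _ "c(s := a)"]) auto
    qed blast
    also have "\<dots> \<longleftrightarrow> (\<exists>c. x s mod ?g = y s mod ?g \<and>
        (\<forall>i\<in>S. x i - y i = M i s * (x s div ?g - y s div ?g) + (\<Sum>j\<in>S. M i j * c j)))"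
    proof -
      have key: "x s - y s = ?g * a \<longleftrightarrow> x s mod ?g = y s mod ?g \<and> a = x s div ?g - y s div ?g" for a
      proof
        assume "x s - y s = ?g * a"
        then have x: "x s = y s + ?g * a" by simp
        show "x s mod ?g = y s mod ?g \<and> a = x s div ?g - y s div ?g"
          unfolding x using False by simp
      next
        assume a: "x s mod ?g = y s mod ?g \<and> a = x s div ?g - y s div ?g"
        have "x s - y s = ?g * (x s div ?g) + x s mod ?g - (?g * (y s div ?g) + y s mod ?g)"
          by (simp only: mult_div_mod_eq)
        also have "\<dots> = ?g * a" using a by (simp only: right_diff_distrib)
        finally show "x s - y s = ?g * a" .
      qed
      have "(\<exists>a c. (m \<and> a = t) \<and> Q a c) \<longleftrightarrow> (\<exists>c. m \<and> Q t c)"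
        for m :: bool and t :: int and Q :: "int \<Rightarrow> ('a \<Rightarrow> int) \<Rightarrow> bool" by blast
      then show ?thesis unfolding key .
    qed
    also have "\<dots> \<longleftrightarrow> \<phi> x = \<phi> y"
      unfolding \<phi>_def prod.inject lattice_cong_class_eq_iff
      by (auto simp: lattice_cong_def algebra_simps)
    finally show "(x, y) \<in> lattice_cong (insert s S) M \<longleftrightarrow> \<phi> x = \<phi> y" .
  qed
  also have "range \<phi> = range (\<lambda>x. x mod ?g) \<times> (UNIV // lattice_cong S M)"
  proof (intro equalityI subsetI)
    fix z assume "z \<in> range \<phi>"
    then show "z \<in> range (\<lambda>x. x mod ?g) \<times> (UNIV // lattice_cong S M)"
      by (auto simp: \<phi>_def quotient_def)
  next
    fix z assume "z \<in> range (\<lambda>x. x mod ?g) \<times> (UNIV // lattice_cong S M)"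
    then obtain a y where z: "z = (a mod ?g, lattice_cong S M `` {y})"
      by (auto simp: quotient_def)
    define x where "x i = (if i = s then a else y i + M i s * (a div ?g))" for i
    have "\<phi> x = z"
      unfolding \<phi>_def z prod.inject lattice_cong_class_eq_iff
      using s by (auto simp: lattice_cong_def x_def intro!: exI[of _ "\<lambda>_. 0"])
    then show "z \<in> range \<phi>" by blast
  qed
  finally show ?thesis using False by (simp add: card_cartesian_product card_range_int_mod)
qed

text \<open>Euclid's algorithm on the columns, driven by row \<open>s\<close>, leaves at most one
  nonzero entry in that row; then both sides split off the pivot. Singular matrices are covered, as
  their quotient is infinite and has cardinality 0.\<close>

lemma card_quotient_lattice_cong_eq_fdet:
  fixes M :: "'a \<Rightarrow> 'a \<Rightarrow> int"
  assumes "finite S"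
  shows "card (UNIV // lattice_cong S M) = nat \<bar>fdet S M\<bar>"
  using assms
proof (induction S arbitrary: M rule: finite_induct)
  case empty
  have "UNIV // lattice_cong {} M = {UNIV :: ('a \<Rightarrow> int) set}"
    by (auto simp: quotient_def lattice_cong_def)
  then show ?case by simp
next
  case (insert s S)
  note fin = \<open>finite S\<close> and s = \<open>s \<notin> S\<close>
  let ?T = "insert s S"
  have base: "card (UNIV // lattice_cong ?T M) = nat \<bar>fdet ?T M\<bar>" if zero: "\<And>j. j \<in> S \<Longrightarrow> M s j = 0" for M
  proof -
    have "fdet ({s} \<union> S) M = fdet {s} M * fdet S M"
      using fin s zero by (intro fdet_block) auto
    then show ?thesis
      using card_quotient_lattice_cong_pivot[of S s M] fin s zero insert.IH[of M]
      by (simp add: abs_mult nat_mult_distrib)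
  qed
  show ?case
  proof (induction "\<Sum>j\<in>?T. nat \<bar>M s j\<bar>" arbitrary: M rule: less_induct)
    case less
    have reduce: ?case if ne: "l \<in> ?T" "j \<in> ?T" "l \<noteq> j" and nz: "M s l \<noteq> 0"
      and le: "\<bar>M s l\<bar> \<le> \<bar>M s j\<bar>" for l j
    proof -
      \<comment> \<open>The sign makes the absolute value of the new entry equal to the difference
        of the two old ones; unit steps in place of a full division suffice for termination.\<close>
      define q where "q = - sgn (M s j) * sgn (M s l)"
      define M' where "M' = (\<lambda>i k. if k = j then M i j + q * M i l else M i k)"
      have "\<bar>M s j + q * M s l\<bar> < \<bar>M s j\<bar>"
        using nz le by (auto simp: q_def sgn_if split: if_splits)
      then have "(\<Sum>k\<in>?T. nat \<bar>M' s k\<bar>) < (\<Sum>k\<in>?T. nat \<bar>M s k\<bar>)"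
        using fin s ne by (intro sum_strict_mono_ex1) (auto simp: M'_def intro!: bexI[of _ j])
      then have "card (UNIV // lattice_cong ?T M') = nat \<bar>fdet ?T M'\<bar>"
        by (rule less)
      then show ?thesis
        unfolding M'_def using fin ne
        by (simp add: fdet_column_add lattice_cong_column_add)
    qed
    show ?case
    proof (cases "\<exists>j\<in>S. M s j \<noteq> 0")
      case False
      then show ?thesis using base by auto
    next
      case True
      then obtain j where j: "j \<in> S" "M s j \<noteq> 0" by auto
      show ?thesis
      proof (cases "\<exists>l\<in>?T. l \<noteq> j \<and> M s l \<noteq> 0")
        case True
        then obtain l where "l \<in> ?T" "l \<noteq> j" "M s l \<noteq> 0" by auto
        then show ?thesis
          using reduce[of l j] reduce[of j l] j by (cases "\<bar>M s l\<bar> \<le> \<bar>M s j\<bar>") auto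
      next
        case False
        \<comment> \<open>The only nonzero entry of the row sits in column \<open>j\<close>. Adding
          column \<open>j\<close> to column \<open>s\<close> and subtracting back moves it to column
          \<open>s\<close>, where the pivot is expected.\<close>
        define M1 where "M1 = (\<lambda>i k. if k = s then M i s + 1 * M i j else M i k)"
        define M2 where "M2 = (\<lambda>i k. if k = j then M1 i j + (-1) * M1 i s else M1 i k)"
        have "j \<noteq> s" using j s by auto
        have "card (UNIV // lattice_cong ?T M2) = nat \<bar>fdet ?T M2\<bar>"
        proof (rule base)
          fix k assume "k \<in> S"
          then show "M2 s k = 0" using False \<open>j \<noteq> s\<close> s by (auto simp: M2_def M1_def)
        qed
        moreover have "fdet ?T M2 = fdet ?T M1" "lattice_cong ?T M2 = lattice_cong ?T M1"
          unfolding M2_def using fin j \<open>j \<noteq> s\<close>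
          by (intro fdet_column_add lattice_cong_column_add; simp)+
        moreover have "fdet ?T M1 = fdet ?T M" "lattice_cong ?T M1 = lattice_cong ?T M"
          unfolding M1_def using fin j \<open>j \<noteq> s\<close>
          by (intro fdet_column_add lattice_cong_column_add; simp)+
        ultimately show ?thesis by simp
      qed
    qed
  qed
qed

section \<open>The boundary operator of the full simplex and its Hodge identity\<close>

section \<open>Incidence numbers of faces\<close>

text \<open>The incidence number of two faces: the entry of the simplicial boundary matrix in row
  \<open>Y\<close> and column \<open>X\<close>. The ring stays general because homology uses the
  integers and probabilities the reals.\<close>

definition inc :: "nat set \<Rightarrow> nat set \<Rightarrow> 'b::comm_ring_1" where
  "inc Y X = (\<Sum>x\<in>X. if Y = X - {x} then (-1) ^ card {y \<in> X. y < x} else 0)"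

lemma inc_nonzeroD:
  assumes "inc Y X \<noteq> (0::'a::comm_ring_1)"
  obtains x where "x \<notin> Y" "X = insert x Y" "finite X"
proof -
  have "\<exists>x\<in>X. Y = X - {x}"
  proof (rule ccontr)
    assume "\<not> (\<exists>x\<in>X. Y = X - {x})"
    then have "inc Y X = (0::'a)" unfolding inc_def by (intro sum.neutral) auto
    then show False using assms by simp
  qed
  moreover have "finite X" by (rule ccontr) (use assms in \<open>simp add: inc_def\<close>)
  ultimately show thesis using that by blast
qed

lemma inc_insert:
  assumes "finite Y" "x \<notin> Y"
  shows "inc Y (insert x Y) = (-1) ^ card {y \<in> Y. y < x}"
proof -
  have "inc Y (insert x Y) =
      (\<Sum>z\<in>insert x Y. if z = x then (-1) ^ card {y \<in> insert x Y. y < x} else 0)"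
    unfolding inc_def using assms by (intro sum.cong) auto
  also have "\<dots> = (-1) ^ card {y \<in> insert x Y. y < x}" using assms by simp
  also have "{y \<in> insert x Y. y < x} = {y \<in> Y. y < x}" by auto
  finally show ?thesis .
qed

lemma of_int_inc [simp]: "of_int (inc Y X) = inc Y X"
  by (simp add: inc_def if_distrib[of of_int] cong: if_cong)

lemma inc_square:
  assumes "finite Y" "x \<notin> Y"
  shows "inc Y (insert x Y) * inc Y (insert x Y) = 1"
  by (simp add: inc_insert[OF assms] flip: power_add mult_2)

lemma inc_cases_real: "inc Y X = (0::real) \<or> inc Y X = (1::real) \<or> inc Y X = (-1::real)"
proof (cases "inc Y X = (0::real)")
  case False
  then obtain x where x: "x \<notin> Y" "X = insert x Y" "finite X" by (rule inc_nonzeroD)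
  then have "inc Y X = (-1::real) ^ card {y \<in> Y. y < x}" using inc_insert[of Y x] by simp
  then show ?thesis by (metis neg_one_even_power neg_one_odd_power)
qed simp

lemma abs_inc_le_one: "\<bar>inc Y X :: real\<bar> \<le> 1"
  using inc_cases_real[of Y X] by auto

lemma inc_nonzero_card: "inc Y X \<noteq> 0 \<Longrightarrow> card X = Suc (card Y)"
  by (erule inc_nonzeroD) auto

lemma inc_nonzero_subset: "inc Y X \<noteq> 0 \<Longrightarrow> Y \<subseteq> X"
  by (erule inc_nonzeroD) auto

lemma inc_nonzero_iff:
  assumes "finite X"
  shows "inc Y X \<noteq> (0::'b::{comm_ring_1,ring_char_0}) \<longleftrightarrow> Y \<subseteq> X \<and> card X = Suc (card Y)"
proof
  assume "Y \<subseteq> X \<and> card X = Suc (card Y)"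
  then have Y: "Y \<subseteq> X" "card (X - Y) = 1" using assms by (auto simp: card_Diff_subset finite_subset)
  then obtain x where "X - Y = {x}" by (auto simp: card_1_singleton_iff)
  then have x: "x \<notin> Y" "X = insert x Y" using Y by auto
  have "inc Y X * inc Y X = (1::'b)" using inc_square[of Y x] x assms by simp
  then show "inc Y X \<noteq> (0::'b)" by auto
qed (use inc_nonzero_card inc_nonzero_subset in blast)

text \<open>Identities between incidence numbers are proved over all of \<open>Pow V\<close>,
  without reference to a dimension. Nonvanishing of a term fixes the cardinality of the face and
  cuts such a sum down to one size.\<close>

lemma sum_Pow_restrict_nsets:
  assumes "finite V" "\<And>X. X \<subseteq> V \<Longrightarrow> f X \<noteq> 0 \<Longrightarrow> card X = j"
  shows "(\<Sum>X\<in>Pow V. f X) = (\<Sum>X\<in>nsets V j. f X)"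
  using assms
  by (intro sum.mono_neutral_right) (auto simp: nsets_def intro: finite_subset)

text \<open>On the diagonal, \<open>Y\<close> has \<open>card V - card Y\<close> cofaces and
  \<open>card Y\<close> faces. Off the diagonal each sum has at most one term, through the union and
  through the intersection of \<open>Y\<close> and \<open>Y'\<close>, and these two terms cancel.
  The empty face takes part, which is the reduced convention.\<close>

lemma inc_Hodge:
  fixes V :: "nat set"
  assumes V: "finite V" and Y: "Y \<subseteq> V" "Y' \<subseteq> V"
  shows "(\<Sum>X\<in>Pow V. inc Y X * inc Y' X) + (\<Sum>Z\<in>Pow V. inc Z Y * inc Z Y') =
    (if Y = Y' then of_nat (card V) else (0::'b::comm_ring_1))"
proof (cases "Y = Y'")
  case True
  have fY: "finite Y" using Y V by (meson finite_subset)
  have "(\<Sum>X\<in>Pow V. inc Y X * inc Y X :: 'b) = (\<Sum>X\<in>(\<lambda>x. insert x Y) ` (V - Y). 1)"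
  proof (rule sum.mono_neutral_cong_right)
    show "\<forall>X\<in>Pow V - (\<lambda>x. insert x Y) ` (V - Y). inc Y X * inc Y X = (0::'b)"
    proof (safe, rule ccontr)
      fix X assume "X \<subseteq> V" "X \<notin> (\<lambda>x. insert x Y) ` (V - Y)" "inc Y X * inc Y X \<noteq> (0::'b)"
      then have "inc Y X \<noteq> (0::'b)" by auto
      then obtain x where "x \<notin> Y" "X = insert x Y" by (rule inc_nonzeroD)
      then show False using \<open>X \<notin> _\<close> \<open>X \<subseteq> V\<close> by auto
    qed
  qed (use V Y fY inc_square in \<open>auto\<close>)
  moreover have "inj_on (\<lambda>x. insert x Y) (V - Y)" by (auto simp: inj_on_def)
  ultimately have 1: "(\<Sum>X\<in>Pow V. inc Y X * inc Y X :: 'b) = of_nat (card (V - Y))"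
    by (simp add: card_image)
  have "(\<Sum>Z\<in>Pow V. inc Z Y * inc Z Y :: 'b) = (\<Sum>Z\<in>(\<lambda>x. Y - {x}) ` Y. 1)"
  proof (rule sum.mono_neutral_cong_right)
    show "\<forall>Z\<in>Pow V - (\<lambda>x. Y - {x}) ` Y. inc Z Y * inc Z Y = (0::'b)"
    proof (safe, rule ccontr)
      fix Z assume "Z \<notin> (\<lambda>x. Y - {x}) ` Y" "inc Z Y * inc Z Y \<noteq> (0::'b)"
      then have "inc Z Y \<noteq> (0::'b)" by auto
      then obtain x where "x \<notin> Z" "Y = insert x Z" by (rule inc_nonzeroD)
      then show False using \<open>Z \<notin> _\<close> by auto
    qed
    fix Z assume "Z \<in> (\<lambda>x. Y - {x}) ` Y"
    then obtain x where "x \<in> Y" "Z = Y - {x}" by auto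
    then show "inc Z Y * inc Z Y = (1::'b)"
      using inc_square[of Z x] fY by (simp add: insert_absorb)
  qed (use V Y in auto)
  moreover have "inj_on (\<lambda>x. Y - {x}) Y" by (auto simp: inj_on_def)
  ultimately have 2: "(\<Sum>Z\<in>Pow V. inc Z Y * inc Z Y :: 'b) = of_nat (card Y)"
    by (simp add: card_image)
  have "card (V - Y) + card Y = card V"
    using V Y fY by (simp add: card_Diff_subset card_mono)
  then have "of_nat (card (V - Y)) + of_nat (card Y) = (of_nat (card V) :: 'b)"
    by (metis of_nat_add)
  with 1 2 True show ?thesis by simp
next
  case False
  show ?thesis
  proof (cases "\<exists>W a b. a \<notin> W \<and> b \<notin> W \<and> a < b \<and> {Y, Y'} = {insert a W, insert b W}")
    case True
    then obtain W a b where w: "a \<notin> W" "b \<notin> W" "a < b" "{Y, Y'} = {insert a W, insert b W}"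
      by blast
    define A B where "A = insert a W" and "B = insert b W"
    have fW: "finite W" using w(4) Y V
      by (metis doubleton_eq_iff finite_insert finite_subset)
    have sub: "insert a (insert b W) \<subseteq> V" using w(4) Y by (auto simp: doubleton_eq_iff)
    have AB: "A \<noteq> B" using w by (auto simp: A_def B_def)
    have up: "inc A X * inc B X \<noteq> (0::'b) \<Longrightarrow> X = insert a (insert b W)" for X
    proof -
      assume "inc A X * inc B X \<noteq> (0::'b)"
      then have "inc A X \<noteq> (0::'b)" "inc B X \<noteq> (0::'b)" by auto
      then have "A \<subseteq> X" "B \<subseteq> X" "card X = Suc (card A)" "finite X"
        using inc_nonzero_subset inc_nonzero_card inc_nonzeroD by metis+
      moreover have "card (insert a (insert b W)) = Suc (card A)"
        using w fW by (auto simp: A_def)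
      ultimately show ?thesis
        by (metis A_def B_def card_subset_eq insert_subset)
    qed
    have down: "inc Z A * inc Z B \<noteq> (0::'b) \<Longrightarrow> Z = W" for Z
    proof -
      assume "inc Z A * inc Z B \<noteq> (0::'b)"
      then have "inc Z A \<noteq> (0::'b)" "inc Z B \<noteq> (0::'b)" by auto
      then have "Z \<subseteq> A" "Z \<subseteq> B" "card A = Suc (card Z)"
        using inc_nonzero_subset inc_nonzero_card by metis+
      then have "Z \<subseteq> W" "card Z = card W" using w fW by (auto simp: A_def B_def)
      then show ?thesis using fW by (simp add: card_subset_eq)
    qed
    have "(\<Sum>X\<in>Pow V. inc A X * inc B X :: 'b) = (\<Sum>X\<in>{insert a (insert b W)}. inc A X * inc B X)"
      using V sub up by (intro sum.mono_neutral_right) auto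
    also have "\<dots> = inc A (insert b A) * inc B (insert a B)"
      by (simp add: A_def B_def insert_commute)
    also have "\<dots> = - ((-1) ^ card {y\<in>W. y < b} * (-1) ^ card {y\<in>W. y < a})"
    proof -
      \<comment> \<open>On the way up through the union, \<open>a\<close> is counted below
        \<open>b\<close>; this one extra element is the sign that separates the upper path from the
        lower one.\<close>
      have "{y\<in>A. y < b} = insert a {y\<in>W. y < b}" "{y\<in>B. y < a} = {y\<in>W. y < a}"
        using w by (auto simp: A_def B_def)
      then show ?thesis
        using w fW AB by (subst (1 2) inc_insert) (auto simp: A_def B_def)
    qed
    finally have 1: "(\<Sum>X\<in>Pow V. inc A X * inc B X :: 'b) = \<dots>" .
    have "(\<Sum>Z\<in>Pow V. inc Z A * inc Z B :: 'b) = (\<Sum>Z\<in>{W}. inc Z A * inc Z B)"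
      using V sub down by (intro sum.mono_neutral_right) auto
    also have "\<dots> = (-1) ^ card {y\<in>W. y < b} * (-1) ^ card {y\<in>W. y < a}"
      using w fW by (simp add: A_def B_def inc_insert)
    finally have 2: "(\<Sum>Z\<in>Pow V. inc Z A * inc Z B :: 'b) = \<dots>" .
    have "Y = A \<and> Y' = B \<or> Y = B \<and> Y' = A"
      using w(4) by (auto simp: A_def B_def doubleton_eq_iff)
    then show ?thesis using 1 2 AB by (auto simp: mult.commute)
  next
    case none: False
    have none': False if "a \<notin> W" "b \<notin> W" "a \<noteq> b" "Y = insert a W" "Y' = insert b W" for a b W
    proof (cases "a < b")
      case True
      then show False using none that by blast
    next
      case False
      then have "b < a" using that by simp
      moreover have "{Y, Y'} = {insert b W, insert a W}" using that by auto
      ultimately show False using none that by blast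
    qed
    have "inc Y X * inc Y' X = (0::'b)" for X
    proof (rule ccontr)
      assume "inc Y X * inc Y' X \<noteq> (0::'b)"
      then have *: "inc Y X \<noteq> (0::'b)" "inc Y' X \<noteq> (0::'b)" by auto
      obtain x where x: "x \<notin> Y" "X = insert x Y" using *(1) by (rule inc_nonzeroD)
      obtain x' where x': "x' \<notin> Y'" "X = insert x' Y'" using *(2) by (rule inc_nonzeroD)
      have "x \<noteq> x'" using x x' False by auto
      define W where "W = Y \<inter> Y'"
      have "Y = insert x' W" "Y' = insert x W" "x \<notin> W" "x' \<notin> W"
        using x x' \<open>x \<noteq> x'\<close> by (auto simp: W_def)
      then show False using none'[of x' W x] \<open>x \<noteq> x'\<close> by simp
    qed
    moreover have "inc Z Y * inc Z Y' = (0::'b)" for Z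
    proof (rule ccontr)
      assume "inc Z Y * inc Z Y' \<noteq> (0::'b)"
      then have *: "inc Z Y \<noteq> (0::'b)" "inc Z Y' \<noteq> (0::'b)" by auto
      obtain x where x: "x \<notin> Z" "Y = insert x Z" using *(1) by (rule inc_nonzeroD)
      obtain x' where x': "x' \<notin> Z" "Y' = insert x' Z" using *(2) by (rule inc_nonzeroD)
      have "x \<noteq> x'" using x x' False by auto
      then show False using none'[of x Z x'] x x' by simp
    qed
    ultimately show ?thesis using False by simp
  qed
qed

text \<open>Two vertices can be deleted in either order, and the two orders carry opposite
  signs.\<close>

lemma inc_inc_zero:
  fixes V :: "nat set"
  assumes V: "finite V" and X: "X \<subseteq> V"
  shows "(\<Sum>Y\<in>Pow V. inc Z Y * inc Y X) = (0::'b::comm_ring_1)"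
proof (cases "\<exists>a b. a \<notin> Z \<and> b \<notin> Z \<and> a < b \<and> X = insert a (insert b Z)")
  case True
  then obtain a b where w: "a \<notin> Z" "b \<notin> Z" "a < b" "X = insert a (insert b Z)" by blast
  have fZ: "finite Z" using w V X by (metis finite_insert finite_subset)
  have mid: "Y = insert a Z \<or> Y = insert b Z" if "inc Z Y * inc Y X \<noteq> (0::'b)" for Y
  proof -
    have *: "inc Z Y \<noteq> (0::'b)" "inc Y X \<noteq> (0::'b)" using that by auto
    obtain x where x: "x \<notin> Z" "Y = insert x Z" using *(1) by (rule inc_nonzeroD)
    obtain x' where x': "x' \<notin> Y" "X = insert x' Y" using *(2) by (rule inc_nonzeroD)
    show ?thesis using x x' w by auto
  qed
  have ne: "insert a Z \<noteq> insert b Z" using w by auto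
  have "(\<Sum>Y\<in>Pow V. inc Z Y * inc Y X :: 'b) = (\<Sum>Y\<in>{insert a Z, insert b Z}. inc Z Y * inc Y X)"
    using V X w mid by (intro sum.mono_neutral_right) auto
  also have "\<dots> = inc Z (insert a Z) * inc (insert a Z) (insert b (insert a Z)) +
      inc Z (insert b Z) * inc (insert b Z) (insert a (insert b Z))"
    using ne w by (simp add: insert_commute)
  also have "\<dots> = 0"
  proof -
    have "{y\<in>insert a Z. y < b} = insert a {y\<in>Z. y < b}" "{y\<in>insert b Z. y < a} = {y\<in>Z. y < a}"
      using w by auto
    then show ?thesis
      using w fZ by (subst (1 2 3 4) inc_insert) auto
  qed
  finally show ?thesis .
next
  case False
  have "inc Z Y * inc Y X = (0::'b)" for Y
  proof (rule ccontr)
    assume "inc Z Y * inc Y X \<noteq> (0::'b)"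
    then have *: "inc Z Y \<noteq> (0::'b)" "inc Y X \<noteq> (0::'b)" by auto
    obtain x where x: "x \<notin> Z" "Y = insert x Z" using *(1) by (rule inc_nonzeroD)
    obtain x' where x': "x' \<notin> Y" "X = insert x' Y" using *(2) by (rule inc_nonzeroD)
    have ne: "x \<noteq> x'" "x' \<notin> Z" using x x' by auto
    show False
    proof (cases "x < x'")
      case True
      moreover have "X = insert x (insert x' Z)" using x x' by auto
      ultimately show False using False x(1) ne by blast
    next
      case nless: False
      then have "x' < x" using ne by simp
      moreover have "X = insert x' (insert x Z)" using x x' by auto
      ultimately show False using False x(1) ne by blast
    qed
  qed
  then show ?thesis by simp
qed

text \<open>By the Hodge identity the upper Laplacian is \<open>card V\<close> times the identity
  minus the lower one, and the lower one annihilates boundaries. Boundaries are therefore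
  eigenvectors for \<open>card V\<close>.\<close>

lemma inc_Laplacian_inc:
  fixes V :: "nat set"
  assumes V: "finite V" and Y: "Y \<subseteq> V" and X: "X \<subseteq> V"
  shows "(\<Sum>Y'\<in>Pow V. (\<Sum>X'\<in>Pow V. inc Y X' * inc Y' X') * inc Y' X) =
    (of_nat (card V) * inc Y X :: 'b::comm_ring_1)"
proof -
  have "(\<Sum>Y'\<in>Pow V. (\<Sum>X'\<in>Pow V. inc Y X' * inc Y' X') * inc Y' X) =
     (\<Sum>Y'\<in>Pow V. (if Y' = Y then of_nat (card V) * inc Y X else 0)
        - (\<Sum>Z\<in>Pow V. inc Z Y * (inc Z Y' * inc Y' X)) :: 'b)"
  proof (rule sum.cong[OF refl])
    fix Y' assume "Y' \<in> Pow V"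
    then have eq: "(\<Sum>X'\<in>Pow V. inc Y X' * inc Y' X') =
        (if Y = Y' then of_nat (card V) else 0) - (\<Sum>Z\<in>Pow V. inc Z Y * inc Z Y' :: 'b)"
      using inc_Hodge[OF V Y, of Y', where 'b='b] by (simp add: algebra_simps)
    show "(\<Sum>X'\<in>Pow V. inc Y X' * inc Y' X') * inc Y' X =
      (if Y' = Y then of_nat (card V) * inc Y X else 0) -
        (\<Sum>Z\<in>Pow V. inc Z Y * (inc Z Y' * inc Y' X) :: 'b)"
      unfolding eq left_diff_distrib sum_distrib_right by (simp add: mult.assoc)
  qed
  also have "\<dots> = of_nat (card V) * inc Y X - (\<Sum>Y'\<in>Pow V. \<Sum>Z\<in>Pow V. inc Z Y * (inc Z Y' * inc Y' X))"
    using V Y by (simp add: sum_subtractf)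
  also have "(\<Sum>Y'\<in>Pow V. \<Sum>Z\<in>Pow V. inc Z Y * (inc Z Y' * inc Y' X)) =
      (\<Sum>Z\<in>Pow V. inc Z Y * (\<Sum>Y'\<in>Pow V. inc Z Y' * inc Y' X) :: 'b)"
    unfolding sum_distrib_left by (rule sum.swap)
  also have "\<dots> = 0" using inc_inc_zero[OF V X, where 'b='b] by simp
  finally show ?thesis by simp
qed

section \<open>Inverse and determinant of the Laplacian on faces avoiding one vertex\<close>

section \<open>The determinant of the reduced Laplacian\<close>

text \<open>For the lower Laplacian \<open>G\<close> on \<open>V\<close> the eigenvalue identity
  gives \<open>G^2 = m G\<close>, hence \<open>((m + 1) I - G)(I + G) = (m + 1) I\<close>. The
  application has \<open>V = {2..n}\<close>, so that \<open>m + 1 = n\<close>.\<close>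

lemma shifted_Laplacian_inverse:
  assumes V: "finite V" "card V = m" and Y: "Y \<in> nsets V j" "Y'' \<in> nsets V j"
  shows "(\<Sum>Y'\<in>nsets V j. ((if Y = Y' then real (Suc m) else 0) - (\<Sum>Z\<in>Pow V. inc Z Y * inc Z Y'))
      * ((if Y' = Y'' then 1 else 0) + (\<Sum>Z\<in>Pow V. inc Z Y' * inc Z Y''))) =
    (if Y = Y'' then real (Suc m) else 0)"
proof -
  let ?n = "real (Suc m)"
  let ?S = "nsets V j"
  let ?G = "\<lambda>Y Y'. \<Sum>Z\<in>Pow V. inc Z Y * inc Z Y' :: real"
  let ?K = "\<lambda>Y Y'. (if Y = Y' then ?n else 0) - ?G Y Y'"
  have fin: "finite (nsets V i)" for i using V by (simp add: finite_imp_finite_nsets)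
  have subV: "X \<subseteq> V" if "X \<in> nsets V i" for X i using that by (simp add: nsets_def)
  have GG: "(\<Sum>Y'\<in>?S. ?G Y Y' * ?G Y' Y'') = real m * ?G Y Y''" if "Y \<in> ?S" "Y'' \<in> ?S" for Y Y''
  proof -
    have "(\<Sum>Y'\<in>?S. ?G Y Y' * ?G Y' Y'') = (\<Sum>Y'\<in>Pow V. ?G Y Y' * ?G Y' Y'')"
    proof (rule sum_Pow_restrict_nsets[symmetric, OF V(1)])
      fix X assume "X \<subseteq> V" "?G Y X * ?G X Y'' \<noteq> 0"
      then have "?G Y X \<noteq> 0" by auto
      then obtain Z where "inc Z Y * inc Z X \<noteq> (0::real)" by (meson sum.neutral)
      then have "inc Z Y \<noteq> (0::real)" "inc Z X \<noteq> (0::real)" by auto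
      then have "card X = card Y" by (metis inc_nonzero_card)
      then show "card X = j" using that by (simp add: nsets_def)
    qed
    also have "\<dots> = (\<Sum>Y'\<in>Pow V. \<Sum>Z\<in>Pow V. \<Sum>Z'\<in>Pow V.
        inc Z Y * (inc Z Y' * inc Z' Y' * inc Z' Y''))"
      by (simp only: sum_product mult.assoc)
    also have "\<dots> = (\<Sum>Z\<in>Pow V. \<Sum>Y'\<in>Pow V. \<Sum>Z'\<in>Pow V.
        inc Z Y * (inc Z Y' * inc Z' Y' * inc Z' Y''))"
      by (rule sum.swap)
    also have "\<dots> = (\<Sum>Z\<in>Pow V. \<Sum>Z'\<in>Pow V. \<Sum>Y'\<in>Pow V.
        inc Z Y * (inc Z Y' * inc Z' Y' * inc Z' Y''))"
      by (intro sum.cong refl sum.swap)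
    also have "\<dots> = (\<Sum>Z\<in>Pow V. inc Z Y * (\<Sum>Z'\<in>Pow V. (\<Sum>Y'\<in>Pow V. inc Z Y' * inc Z' Y') * inc Z' Y''))"
      by (simp add: sum_distrib_left sum_distrib_right)
    also have "\<dots> = (\<Sum>Z\<in>Pow V. inc Z Y * (real m * inc Z Y''))"
      using that V subV by (intro sum.cong refl arg_cong2[where f="(*)"])
        (simp add: inc_Laplacian_inc)
    finally show ?thesis by (simp add: sum_distrib_left mult_ac)
  qed
    have "(\<Sum>Y'\<in>?S. ?K Y Y' * ((if Y' = Y'' then 1 else 0) + ?G Y' Y'')) =
       (\<Sum>Y'\<in>?S. (if Y' = Y'' then if Y = Y'' then ?n else 0 else 0)
         + (if Y' = Y then ?n * ?G Y Y'' else 0) - (if Y' = Y'' then ?G Y Y'' else 0)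
         - ?G Y Y' * ?G Y' Y'')"
      by (intro sum.cong refl) (auto simp: algebra_simps)
    also have "\<dots> = (if Y = Y'' then ?n else 0) + ?n * ?G Y Y'' - ?G Y Y'' - real m * ?G Y Y''"
      using Y fin GG[OF Y] by (simp only: sum.distrib sum_subtractf) simp
    finally show ?thesis by (simp add: algebra_simps)
qed

text \<open>The preceding inverse gives the product of this determinant with that of
  \<open>I + G\<close>. Sylvester's identity carries \<open>I + G\<close> to faces one vertex
  smaller, where the Hodge identity recognises the same shape again, and Pascal's rule adds the
  exponents. For \<open>m = n - 1\<close> and \<open>j = k\<close> the value is the normalising
  constant of the hypertree measure.\<close>

lemma fdet_shifted_Laplacian:
  assumes V: "finite V" "card V = m" "m > 0"
  shows "fdet (nsets V j) (\<lambda>Y Y'. (if Y = Y' then real (Suc m) else 0)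
      - (\<Sum>Z\<in>Pow V. inc Z Y * inc Z Y')) = real (Suc m) ^ ((m - 1) choose j)"
proof (induction j)
  case 0
  have "nsets V 0 = {{}}" by (auto simp: nsets_def)
  moreover have "inc Z {} = (0::real)" for Z by (simp add: inc_def)
  ultimately show ?case by simp
next
  case (Suc j)
  let ?n = "real (Suc m)"
  let ?S = "nsets V (Suc j)"
  let ?G = "\<lambda>Y Y'. \<Sum>Z\<in>Pow V. inc Z Y * inc Z Y' :: real"
  let ?K = "\<lambda>Y Y'. (if Y = Y' then ?n else 0) - ?G Y Y'"
  have fin: "finite (nsets V i)" for i using V by (simp add: finite_imp_finite_nsets)
  have subV: "X \<subseteq> V" if "X \<in> nsets V i" for X i using that by (simp add: nsets_def)
  have "fdet ?S ?K * fdet ?S (\<lambda>Y Y'. (if Y = Y' then 1 else 0) + ?G Y Y') =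
      fdet ?S (\<lambda>Y Y''. \<Sum>Y'\<in>?S. ?K Y Y' * ((if Y' = Y'' then 1 else 0) + ?G Y' Y''))"
    by (rule fdet_mult[symmetric]) (rule fin)
  also have "\<dots> = fdet ?S (\<lambda>Y Y''. if Y = Y'' then ?n else 0)"
  proof (rule fdet_cong[OF refl])
    fix Y Y'' assume Y: "Y \<in> ?S" "Y'' \<in> ?S"
    show "(\<Sum>Y'\<in>?S. ?K Y Y' * ((if Y' = Y'' then 1 else 0) + ?G Y' Y'')) =
        (if Y = Y'' then ?n else 0)"
      by (rule shifted_Laplacian_inverse[OF V(1,2) Y])
  qed
  also have "\<dots> = ?n ^ (m choose Suc j)"
    using V by (subst fdet_diagonal[OF fin]) (auto simp: card_nsets)
  also have "fdet ?S (\<lambda>Y Y'. (if Y = Y' then 1 else 0) + ?G Y Y') = fdet (nsets V j) ?K"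
  proof -
    have "fdet ?S (\<lambda>Y Y'. (if Y = Y' then 1 else 0) + ?G Y Y') =
        fdet ?S (\<lambda>Y Y'. (if Y = Y' then 1 else 0) - (\<Sum>Z\<in>nsets V j. (- inc Z Y) * inc Z Y'))"
    proof (rule fdet_cong[OF refl])
      fix Y Y' assume "Y \<in> ?S" "Y' \<in> ?S"
      then have "?G Y Y' = (\<Sum>Z\<in>nsets V j. inc Z Y * inc Z Y')"
        by (intro sum_Pow_restrict_nsets V) (auto simp: nsets_def dest!: inc_nonzero_card)
      then show "(if Y = Y' then 1 else 0) + ?G Y Y' =
          (if Y = Y' then 1 else 0) - (\<Sum>Z\<in>nsets V j. (- inc Z Y) * inc Z Y')"
        by (simp add: sum_negf)
    qed
    also have "\<dots> = fdet (nsets V j)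
        (\<lambda>Y Y'. (if Y = Y' then 1 else 0) - (\<Sum>X\<in>?S. inc Y X * (- inc Y' X)))"
      by (rule fdet_Sylvester[OF fin fin]) (auto simp: nsets_def)
    also have "\<dots> = fdet (nsets V j) ?K"
    proof (rule fdet_cong[OF refl])
      fix Y Y' assume Y: "Y \<in> nsets V j" "Y' \<in> nsets V j"
      then have "(\<Sum>X\<in>?S. inc Y X * inc Y' X) = (\<Sum>X\<in>Pow V. inc Y X * inc Y' X :: real)"
        by (intro sum_Pow_restrict_nsets[symmetric] V) (auto simp: nsets_def dest!: inc_nonzero_card)
      then show "(if Y = Y' then 1 else 0) - (\<Sum>X\<in>?S. inc Y X * (- inc Y' X)) = ?K Y Y'"
        using inc_Hodge[OF V(1) subV[OF Y(1)] subV[OF Y(2)], where 'b=real] V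
        by (auto simp: sum_negf algebra_simps)
    qed
    finally show ?thesis .
  qed
  finally have "fdet ?S ?K * ?n ^ ((m - 1) choose j) = ?n ^ (m choose Suc j)"
    using Suc.IH by simp
  also have "m choose Suc j = ((m - 1) choose Suc j) + ((m - 1) choose j)"
    using V(3) by (cases m) simp_all
  finally show ?case by (simp add: power_add)
qed

lemma inc_insert_least:
  assumes "finite Z" "\<And>y. y \<in> Z \<Longrightarrow> x < y"
  shows "inc Z (insert x Z) = 1"
proof -
  have "x \<notin> Z" and empty: "{y \<in> Z. y < x} = {}" using assms(2) by (auto dest: less_asym)
  then show ?thesis unfolding inc_insert[OF assms(1) \<open>x \<notin> Z\<close>] empty by simp
qed

section \<open>Homology of a complex with full skeleton as a cokernel\<close>

section \<open>Homology of hypertrees\<close>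

lemma lookup_sum_frag: "Poly_Mapping.lookup (sum f A) i = (\<Sum>a\<in>A. Poly_Mapping.lookup (f a) i)"
  by (induction A rule: infinite_finite_induct) (auto simp: lookup_add)

lemma lookup_simplicial_boundary:
  assumes "finite S" "Poly_Mapping.keys c \<subseteq> S"
  shows "Poly_Mapping.lookup (simplicial_boundary c) Z = (\<Sum>X\<in>S. inc Z X * Poly_Mapping.lookup c X)"
proof -
  have 1: "Poly_Mapping.lookup (frag_of (X - {x})) Z = (if Z = X - {x} then 1 else 0)" for X x
    by (auto simp: lookup_single when_def)
  have "Poly_Mapping.lookup (simplicial_boundary c) Z =
      (\<Sum>X\<in>Poly_Mapping.keys c. Poly_Mapping.lookup c X * inc Z X)"
    unfolding simplicial_boundary_def frag_extend_def lookup_sum_frag lookup_frag_cmul inc_def 1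
    by (intro sum.cong arg_cong2[where f="(*)"] refl) (auto intro!: sum.cong)
  also have "\<dots> = (\<Sum>X\<in>S. Poly_Mapping.lookup c X * inc Z X)"
    using assms by (intro sum.mono_neutral_left) (auto simp: in_keys_iff)
  finally show ?thesis by (simp add: mult.commute)
qed

definition complex_of_facets :: "nat \<Rightarrow> nat \<Rightarrow> nat set set \<Rightarrow> nat set set" where
  "complex_of_facets n k F = F \<union> {X. X \<subseteq> {1..n} \<and> card X \<le> k}"

text \<open>A cycle is determined by its coefficients on faces avoiding the vertex 1, and every
  integer vector on those faces comes from a cycle, namely the boundary of a chain of cones with
  apex 1. In these coordinates the boundaries from \<open>F\<close> are combinations of the columns
  of \<open>M\<close>, so the homology is the cokernel of a square matrix.\<close>

lemma order_simplicial_homology: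
  fixes n k :: nat and F :: "nat set set"
  assumes k: "k \<ge> 1" and n: "n \<ge> 1"
    and F: "F \<subseteq> nsets {1..n} (k + 1)" and e: "bij_betw e (nsets {2..n} k) F"
  defines "H \<equiv> simplicial_homology (k - 1) (complex_of_facets n k F)"
  shows "Coset.order H = nat \<bar>fdet (nsets {2..n} k) (\<lambda>i j. inc i (e j))\<bar>"
    and "finite (carrier H) \<longleftrightarrow> fdet (nsets {2..n} k) (\<lambda>i j. inc i (e j) :: int) \<noteq> 0"
proof -
  let ?C = "complex_of_facets n k F"
  let ?R = "nsets {2..n} k" and ?V = "{1..n}"
  define M :: "nat set \<Rightarrow> nat set \<Rightarrow> int" where "M i j = inc i (e j)" for i j
  let ?l = "Poly_Mapping.lookup"
  define CY where "CY = simplicial_cycles (k - 1) (complex_of_facets n k F)"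
  define BD where "BD = simplicial_boundaries (k - 1) (complex_of_facets n k F)"
  have finR: "finite ?R" by (simp add: finite_imp_finite_nsets)
  have finF: "finite F" using F by (meson finite_atLeastAtMost finite_imp_finite_nsets finite_subset)
  have RV: "i \<subseteq> ?V" "1 \<notin> i" "finite i" "card i = k" "insert 1 i \<subseteq> ?V" if "i \<in> ?R" for i
    using that n by (auto simp: nsets_def)
  have kk: "k - 1 + 1 = k" using k by simp
  have Fmem: "X \<subseteq> ?V" "finite X" "card X = k + 1" if "X \<in> F" for X
    using subsetD[OF F that] by (auto simp: nsets_def)
  have sk: "{X \<in> ?C. card X = k - 1 + 1} = nsets ?V k"
    unfolding kk
  proof (intro equalityI subsetI)
    fix X assume "X \<in> {X \<in> ?C. card X = k}"
    then have "X \<subseteq> ?V" "card X = k" using Fmem[of X] by (auto simp: complex_of_facets_def)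
    then show "X \<in> nsets ?V k" by (auto simp: nsets_def intro: finite_subset)
  qed (simp add: complex_of_facets_def nsets_def)
  have sk1: "{X \<in> ?C. card X = k - 1 + 1 + 1} = F"
    unfolding kk
  proof (intro equalityI subsetI)
    fix X assume "X \<in> F"
    then show "X \<in> {X \<in> ?C. card X = k + 1}" using Fmem[of X] by (simp add: complex_of_facets_def)
  qed (auto simp: complex_of_facets_def)
  have cyc: "c \<in> CY \<longleftrightarrow> Poly_Mapping.keys c \<subseteq> nsets ?V k \<and> simplicial_boundary c = 0" for c
    unfolding CY_def simplicial_cycles_def simplicial_chain_group_def sk by simp
  have B: "BD = simplicial_boundary ` {b. Poly_Mapping.keys b \<subseteq> F}"
    unfolding BD_def simplicial_boundaries_def simplicial_chain_group_def sk1
    by (simp add: free_Abelian_group_def)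
  have boundary_cycle: "simplicial_boundary b \<in> CY" if b: "Poly_Mapping.keys b \<subseteq> nsets ?V (k + 1)" for b
  proof -
    let ?E = "nsets ?V (k + 1)"
    have finE: "finite ?E" by (simp add: finite_imp_finite_nsets)
    have keys: "Poly_Mapping.keys (simplicial_boundary b) \<subseteq> nsets ?V k"
    proof
      fix Z assume "Z \<in> Poly_Mapping.keys (simplicial_boundary b)"
      then have "(\<Sum>X\<in>?E. inc Z X * ?l b X) \<noteq> 0"
        by (simp add: in_keys_iff lookup_simplicial_boundary[OF finE b])
      then obtain X where X: "X \<in> ?E" "inc Z X * ?l b X \<noteq> 0" by (meson sum.neutral)
      then have "inc Z X \<noteq> (0::int)" by auto
      then have "Z \<subseteq> X" "card X = Suc (card Z)"
        using inc_nonzero_subset inc_nonzero_card by blast+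
      then show "Z \<in> nsets ?V k" using X(1) by (auto simp: nsets_def intro: finite_subset)
    qed
    have "?l (simplicial_boundary (simplicial_boundary b)) W = 0" for W
    proof -
      have "?l (simplicial_boundary (simplicial_boundary b)) W =
          (\<Sum>Y\<in>Pow ?V. inc W Y * ?l (simplicial_boundary b) Y)"
        using keys by (intro lookup_simplicial_boundary) (auto simp: nsets_def)
      also have "\<dots> = (\<Sum>Y\<in>Pow ?V. \<Sum>X\<in>?E. inc W Y * (inc Y X * ?l b X))"
        by (simp add: lookup_simplicial_boundary[OF finE b] sum_distrib_left)
      also have "\<dots> = (\<Sum>X\<in>?E. (\<Sum>Y\<in>Pow ?V. inc W Y * inc Y X) * ?l b X)"
        by (subst sum.swap) (simp add: sum_distrib_right mult.assoc)
      also have "\<dots> = 0"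
        by (intro sum.neutral ballI) (subst inc_inc_zero, auto simp: nsets_def)
      finally show ?thesis .
    qed
    then have "simplicial_boundary (simplicial_boundary b) = 0" by (intro poly_mapping_eqI) simp
    then show ?thesis using keys by (simp add: cyc)
  qed
  have boundary_diff: "simplicial_boundary (a - b) = simplicial_boundary a - simplicial_boundary b" for a b
    by (simp add: simplicial_boundary_def frag_extend_diff)
  have cyc_diff: "a - b \<in> CY" if "a \<in> CY" "b \<in> CY" for a b
    using that keys_diff[of a b] by (auto simp: cyc boundary_diff)
  \<comment> \<open>If \<open>Y\<close> contains 1, the face \<open>Z = Y - {1}\<close> lies in
    \<open>Y\<close> and otherwise only in sets avoiding 1, whose coefficients vanish; the boundary
    at \<open>Z\<close> then kills the coefficient of \<open>Y\<close>.\<close>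
  have cyc_zero: "c = 0" if c: "c \<in> CY" and z: "\<And>i. i \<in> ?R \<Longrightarrow> ?l c i = 0" for c
  proof (rule poly_mapping_eqI)
    fix Y
    show "?l c Y = ?l 0 Y"
    proof (cases "Y \<in> nsets ?V k")
      case False
      then show ?thesis using c by (auto simp: cyc in_keys_iff subset_eq)
    next
      case True
      show ?thesis
      proof (cases "1 \<in> Y")
        case False
        have "Y \<subseteq> {2..n}"
        proof
          fix y assume y: "y \<in> Y"
          then have "y \<in> {1..n}" "y \<noteq> 1" using True False by (auto simp: nsets_def)
          then show "y \<in> {2..n}" by auto
        qed
        then have "Y \<in> ?R" using True by (auto simp: nsets_def)
        then show ?thesis using z by simp
      next
        case 1: True
        define Z where "Z = Y - {1}"
        have Z: "Y = insert 1 Z" "1 \<notin> Z" "finite Z" "card Y = Suc (card Z)"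
          using 1 True card_Suc_Diff1[of Y 1, symmetric]
          by (auto simp: Z_def nsets_def simp del: One_nat_def)
        have "0 = (\<Sum>X\<in>nsets ?V k. inc Z X * ?l c X)"
          using c lookup_simplicial_boundary[of "nsets ?V k" c Z]
          by (simp add: cyc finite_imp_finite_nsets)
        also have "\<dots> = (\<Sum>X\<in>{Y}. inc Z X * ?l c X)"
        proof (rule sum.mono_neutral_right)
          show "\<forall>X\<in>nsets ?V k - {Y}. inc Z X * ?l c X = 0"
          proof (rule ballI, rule ccontr)
            fix X assume "X \<in> nsets ?V k - {Y}" and nz0: "inc Z X * ?l c X \<noteq> 0"
            then have X: "X \<in> nsets ?V k" "X \<noteq> Y" by auto
            then have nz: "inc Z X \<noteq> (0::int)" "?l c X \<noteq> 0" using nz0 by auto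
            obtain x where x: "x \<notin> Z" "X = insert x Z" using nz(1) by (rule inc_nonzeroD)
            have "x \<noteq> 1" using x(2) X(2) Z(1) by blast
            then have "1 \<notin> X" using x(2) Z(2) by simp
            have "X \<subseteq> {1..n}" using X(1) by (simp add: nsets_def)
            have "X \<subseteq> {2..n}"
            proof
              fix y assume "y \<in> X"
              then have "y \<in> {1..n}" "y \<noteq> 1" using \<open>X \<subseteq> {1..n}\<close> \<open>1 \<notin> X\<close> by blast+
              then show "y \<in> {2..n}" by auto
            qed
            then have "X \<in> ?R" using X by (auto simp: nsets_def)
            then show False using z nz by simp
          qed
        qed (use True in \<open>auto simp: finite_imp_finite_nsets\<close>)
        also have "\<dots> = inc Z Y * ?l c Y" by simp
        finally have "inc Z Y * ?l c Y = 0" by simp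
        moreover have "inc Z Y \<noteq> (0::int)"
          using Z by (subst inc_nonzero_iff) auto
        ultimately show ?thesis by simp
      qed
    qed
  qed
  have lookup_R: "?l (simplicial_boundary b) i = (\<Sum>j\<in>?R. M i j * ?l b (e j))"
    if "Poly_Mapping.keys b \<subseteq> F" for b i
    by (subst lookup_simplicial_boundary[OF finF that])
      (simp add: M_def sum.reindex_bij_betw[OF e, symmetric, of "\<lambda>X. inc i X * ?l b X"])
  \<comment> \<open>\<open>f\<close> is the homology class as a coset, \<open>g\<close> the class of
    the coefficient vector in the cokernel; it suffices that they have the same kernel on
    cycles.\<close>
  define f where "f c = BD #>\<^bsub>simplicial_chain_group (k - 1) ?C\<lparr>carrier := CY\<rparr>\<^esub> c" for c
  define g where "g c = lattice_cong ?R M `` {?l c}" for c :: "nat set \<Rightarrow>\<^sub>0 int"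
  have f: "f c = (\<lambda>b. b + c) ` BD" for c
    by (auto simp: f_def r_coset_def simplicial_chain_group_def free_Abelian_group_def)
  have B0: "0 \<in> BD" unfolding B by (rule image_eqI[of _ _ 0]) (auto simp: simplicial_boundary_def)
  have Bdiff: "a - b \<in> BD" if ab0: "a \<in> BD" "b \<in> BD" for a b
  proof -
    obtain a' b' where ab: "a = simplicial_boundary a'" "Poly_Mapping.keys a' \<subseteq> F"
      "b = simplicial_boundary b'" "Poly_Mapping.keys b' \<subseteq> F" using ab0 unfolding B by blast
    then have "Poly_Mapping.keys (a' - b') \<subseteq> F" using keys_diff[of a' b'] by auto
    then show ?thesis unfolding B ab(1,3) boundary_diff[symmetric] by blast
  qed
  have Badd: "a + b \<in> BD" if "a \<in> BD" "b \<in> BD" for a b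
    using Bdiff[OF that(1) Bdiff[OF B0 that(2)]] by simp
  have f_eq: "f c = f c' \<longleftrightarrow> c - c' \<in> BD" for c c'
  proof
    assume "f c = f c'"
    moreover have "c \<in> f c" unfolding f using B0 by (intro image_eqI[of _ _ 0]) auto
    ultimately have "c \<in> (\<lambda>b. b + c') ` BD" by (simp add: f)
    then obtain b where "c = b + c'" "b \<in> BD" by blast
    then show "c - c' \<in> BD" by simp
  next
    assume d: "c - c' \<in> BD"
    have sub: "f a \<subseteq> f a'" if "a - a' \<in> BD" for a a'
    proof
      fix z assume "z \<in> f a"
      then obtain b where b: "z = b + a" "b \<in> BD" by (auto simp: f)
      then have "z = (b + (a - a')) + a'" by simp
      then show "z \<in> f a'" unfolding f using Badd[OF b(2) that] by blast
    qed
    have "c' - c \<in> BD" using Bdiff[OF B0 d] by simp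
    then show "f c = f c'" using sub d by blast
  qed
  have fg: "f c = f c' \<longleftrightarrow> g c = g c'" if c: "c \<in> CY" "c' \<in> CY" for c c'
    unfolding f_eq g_def lattice_cong_class_eq_iff
  proof
    assume "c - c' \<in> BD"
    then obtain b where b: "c - c' = simplicial_boundary b" "Poly_Mapping.keys b \<subseteq> F"
      by (auto simp: B)
    have "?l c i - ?l c' i = (\<Sum>j\<in>?R. M i j * ?l b (e j))" for i
      using lookup_R[OF b(2), of i] b(1)[symmetric] by (simp add: lookup_minus)
    then show "(?l c, ?l c') \<in> lattice_cong ?R M" by (intro lattice_congI) auto
  next
    assume "(?l c, ?l c') \<in> lattice_cong ?R M"
    then obtain d where d: "\<forall>i\<in>?R. ?l c i - ?l c' i = (\<Sum>j\<in>?R. M i j * d j)"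
      by (auto simp: lattice_cong_def)
    define b where "b = (\<Sum>j\<in>?R. frag_cmul (d j) (frag_of (e j)))"
    have eF: "e j \<in> F" if "j \<in> ?R" for j using e that by (auto simp: bij_betw_def)
    have lb: "?l b X = (\<Sum>j\<in>?R. if X = e j then d j else 0)" for X
      unfolding b_def lookup_sum_frag
      by (intro sum.cong refl) (auto simp: lookup_single when_def)
    have kb: "Poly_Mapping.keys b \<subseteq> F"
    proof
      fix X assume "X \<in> Poly_Mapping.keys b"
      then have "(\<Sum>j\<in>?R. if X = e j then d j else 0) \<noteq> 0" by (simp add: in_keys_iff lb)
      then obtain j where "j \<in> ?R" "(if X = e j then d j else 0) \<noteq> 0"
        by (rule sum.not_neutral_contains_not_neutral)
      then have "j \<in> ?R" "X = e j" by (simp_all split: if_splits)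
      then show "X \<in> F" using eF by simp
    qed
    have lbe: "?l b (e j) = d j" if "j \<in> ?R" for j
    proof -
      have "?l b (e j) = (\<Sum>j'\<in>?R. if j' = j then d j else 0)"
        unfolding lb using e that by (intro sum.cong) (auto simp: bij_betw_def inj_on_def)
      then show ?thesis using finR that by simp
    qed
    have "c - c' - simplicial_boundary b = 0"
    proof (rule cyc_zero)
      show "c - c' - simplicial_boundary b \<in> CY"
        using c kb F by (intro cyc_diff boundary_cycle) auto
      fix i assume i: "i \<in> ?R"
      have "?l (simplicial_boundary b) i = (\<Sum>j\<in>?R. M i j * d j)"
        unfolding lookup_R[OF kb] by (intro sum.cong) (auto simp: lbe)
      then show "?l (c - c' - simplicial_boundary b) i = 0"
        using d i by (simp add: lookup_minus)
    qed
    then have "c - c' = simplicial_boundary b" by simp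
    then show "c - c' \<in> BD" using kb by (auto simp: B)
  qed
  have img: "g ` CY = UNIV // lattice_cong ?R M"
  proof (intro equalityI subsetI)
    fix z assume "z \<in> UNIV // lattice_cong ?R M"
    then obtain y where y: "z = lattice_cong ?R M `` {y}" by (auto simp: quotient_def)
    \<comment> \<open>A chain of cones with apex 1 over the faces \<open>j\<close>. Its boundary has
      coefficient \<open>y i\<close> at \<open>i\<close>, with sign \<open>+1\<close> because 1 is
      the least vertex.\<close>
    define b where "b = (\<Sum>j\<in>?R. frag_cmul (y j) (frag_of (insert 1 j)))"
    have lb: "?l b X = (\<Sum>j\<in>?R. if X = insert 1 j then y j else 0)" for X
      unfolding b_def lookup_sum_frag
      by (intro sum.cong refl) (auto simp: lookup_single when_def)
    have kb: "Poly_Mapping.keys b \<subseteq> (insert 1) ` ?R"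
    proof
      fix X assume "X \<in> Poly_Mapping.keys b"
      then have "(\<Sum>j\<in>?R. if X = insert 1 j then y j else 0) \<noteq> 0" by (simp add: in_keys_iff lb)
      then obtain j where "j \<in> ?R" "(if X = insert 1 j then y j else 0) \<noteq> 0"
        by (rule sum.not_neutral_contains_not_neutral)
      then have "j \<in> ?R" "X = insert 1 j" by (simp_all split: if_splits)
      then show "X \<in> (insert 1) ` ?R" by simp
    qed
    have inj: "inj_on (insert 1) ?R" using RV(2) by (auto simp: inj_on_def insert_ident)
    have lbj: "?l b (insert 1 j) = y j" if "j \<in> ?R" for j
    proof -
      have "?l b (insert 1 j) = (\<Sum>j'\<in>?R. if j' = j then y j else 0)"
        unfolding lb using inj that by (intro sum.cong) (auto simp: inj_on_def)
      then show ?thesis using finR that by simp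
    qed
    have "Poly_Mapping.keys b \<subseteq> nsets ?V (k + 1)"
    proof
      fix X assume "X \<in> Poly_Mapping.keys b"
      then obtain j where j: "j \<in> ?R" "X = insert 1 j" using kb by blast
      show "X \<in> nsets ?V (k + 1)"
        using RV[OF j(1)] unfolding j(2) by (simp add: nsets_def)
    qed
    then have cyc_b: "simplicial_boundary b \<in> CY" by (rule boundary_cycle)
    have "?l (simplicial_boundary b) i = y i" if i: "i \<in> ?R" for i
    proof -
      have "?l (simplicial_boundary b) i = (\<Sum>X\<in>(insert 1) ` ?R. inc i X * ?l b X)"
        using kb finR by (intro lookup_simplicial_boundary) auto
      also have "\<dots> = (\<Sum>j\<in>?R. inc i (insert 1 j) * y j)"
        using lbj by (subst sum.reindex[OF inj]) (auto intro!: sum.cong)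
      also have "\<dots> = (\<Sum>j\<in>?R. if j = i then y i else 0)"
      proof (rule sum.cong[OF refl])
        fix j assume j: "j \<in> ?R"
        show "inc i (insert 1 j) * y j = (if j = i then y i else 0)"
        proof (cases "j = i")
          case True
          have "inc i (insert 1 i) = (1::int)"
            using i RV(3)[OF i] by (intro inc_insert_least) (auto simp: nsets_def)
          then show ?thesis using True by simp
        next
          case False
          have "inc i (insert 1 j) = (0::int)"
          proof (rule ccontr)
            assume "inc i (insert 1 j) \<noteq> (0::int)"
            then have "i \<subseteq> insert 1 j" by (rule inc_nonzero_subset)
            then have "i \<subseteq> j" using RV[OF i] by auto
            then show False using RV[OF i] RV[OF j] False by (metis card_subset_eq)
          qed
          then show ?thesis using False by simp
        qed
      qed
      also have "\<dots> = y i" using finR i by simp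
      finally show ?thesis .
    qed
    then have "g (simplicial_boundary b) = z"
      unfolding g_def y lattice_cong_class_eq_iff
      by (intro lattice_congI[of _ _ _ _ "\<lambda>_. 0"]) auto
    then show "z \<in> g ` CY" using cyc_b by blast
  qed (auto simp: g_def quotient_def)
  have carrier: "carrier H = f ` CY"
    by (simp add: H_def simplicial_homology_def carrier_FactGroup f_def CY_def BD_def)
  have "card (carrier H) = card (UNIV // lattice_cong ?R M)"
    unfolding carrier img[symmetric] by (rule card_image_eq_of_kernel_eq) (rule fg)
  also have "\<dots> = nat \<bar>fdet ?R M\<bar>" by (rule card_quotient_lattice_cong_eq_fdet[OF finR])
  finally have card: "card (carrier H) = nat \<bar>fdet ?R M\<bar>" .
  then show "Coset.order H = nat \<bar>fdet ?R (\<lambda>i j. inc i (e j))\<bar>"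
    by (simp add: order_def M_def[abs_def])
  \<comment> \<open>An infinite set has cardinality 0, so for a nonempty carrier finiteness is
    equivalent to nonzero cardinality.\<close>
  have "0 \<in> CY" by (simp add: cyc simplicial_boundary_def)
  then have "carrier H \<noteq> {}" using carrier by auto
  then have "finite (carrier H) \<longleftrightarrow> card (carrier H) \<noteq> 0"
    by (metis card_0_eq card.infinite)
  then show "finite (carrier H) \<longleftrightarrow> fdet ?R (\<lambda>i j. inc i (e j) :: int) \<noteq> 0"
    unfolding card by (simp add: M_def[abs_def])
qed

section \<open>Weighted matrix-tree formulas for hypertrees\<close>

section \<open>The determinantal formula for hypertrees\<close>

text \<open>The enumeration chosen by \<open>SOME\<close> affects the determinant only by a sign,
  which the square removes. The choice is meaningful when \<open>F\<close> has
  \<open>(n - 1) choose k\<close> elements.\<close>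

definition facet_weight :: "nat \<Rightarrow> nat \<Rightarrow> nat set set \<Rightarrow> real" where
  "facet_weight n k F =
     (fdet (nsets {2..n} k) (\<lambda>i j. inc i ((SOME e. bij_betw e (nsets {2..n} k) F) j)))\<^sup>2"

lemma of_int_fdet: "of_int (fdet S A) = fdet S (\<lambda>i j. of_int (A i j))"
  by (simp add: fdet_def)

lemma ex_bij_betw_facets:
  assumes "F \<subseteq> nsets {1..n} (k + 1)" "card F = (n - 1) choose k"
  shows "bij_betw (SOME e. bij_betw e (nsets {2..n} k) F) (nsets {2..n} k) F"
proof -
  have "finite F" "finite (nsets {2..n} k)"
    using assms(1) by (auto intro: finite_subset simp: finite_imp_finite_nsets)
  then have "\<exists>e. bij_betw e (nsets {2..n} k) F"
    using assms(2) by (intro finite_same_card_bij) auto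
  then show ?thesis by (rule someI_ex)
qed

lemma order_square_eq_facet_weight:
  assumes "k \<ge> 1" "n \<ge> 1" "F \<subseteq> nsets {1..n} (k + 1)" "card F = (n - 1) choose k"
  shows "(real (Coset.order (simplicial_homology (k - 1) (complex_of_facets n k F))))\<^sup>2 = facet_weight n k F"
    and "finite (carrier (simplicial_homology (k - 1) (complex_of_facets n k F))) \<longleftrightarrow> facet_weight n k F \<noteq> 0"
proof -
  let ?R = "nsets {2..n} k" and ?e = "SOME e. bij_betw e (nsets {2..n} k) F"
  have e: "bij_betw ?e ?R F" by (rule ex_bij_betw_facets[OF assms(3,4)])
  have fd: "facet_weight n k F = (real_of_int (fdet ?R (\<lambda>i j. inc i (?e j))))\<^sup>2"
    unfolding facet_weight_def of_int_fdet by simp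
  show "(real (Coset.order (simplicial_homology (k - 1) (complex_of_facets n k F))))\<^sup>2 = facet_weight n k F"
    unfolding fd order_simplicial_homology(1)[OF assms(1,2,3) e] by simp
  show "finite (carrier (simplicial_homology (k - 1) (complex_of_facets n k F))) \<longleftrightarrow> facet_weight n k F \<noteq> 0"
    unfolding fd order_simplicial_homology(2)[OF assms(1,2,3) e] by simp
qed

text \<open>Hypertrees correspond to their sets of top faces, the lower skeleton being complete.
  Facet sets with infinite homology have weight 0, so the sum may run over all sets of the right
  size.\<close>

lemma measure_hypertree_measure:
  assumes k: "k \<ge> 1" and n: "n \<ge> k + 1"
  shows "measure (hypertree_measure n k)
      {C \<in> space (hypertree_measure n k). Q {X \<in> C. card X = k + 1}} =
    (\<Sum>F | F \<subseteq> nsets {1..n} (k + 1) \<and> card F = (n - 1) choose k \<and> Q F. facet_weight n k F)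
      / real n ^ ((n - 2) choose k)"
proof -
  let ?w = "\<lambda>C. (real (Coset.order (simplicial_homology (k - 1) C)))\<^sup>2 / real n ^ ((n - 2) choose k)"
  let ?H = "hypertrees n k" and ?top = "\<lambda>C. {X \<in> C. card X = k + 1}"
  let ?E = "{C \<in> ?H. Q (?top C)}"
  let ?F = "{F. F \<subseteq> nsets {1..n} (k + 1) \<and> card F = (n - 1) choose k \<and> Q F}"
  have finH: "finite ?H"
    by (rule finite_subset[of _ "Pow (Pow {1..n})"]) (auto simp: hypertrees_def simplicial_complex_on_def)
  have sp: "space (hypertree_measure n k) = ?H"
    by (simp add: hypertree_measure_def space_point_measure)
  have "emeasure (hypertree_measure n k) ?E = (\<Sum>C\<in>?E. ennreal (?w C))"
    unfolding hypertree_measure_def using finH by (intro emeasure_point_measure_finite) auto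
  also have "\<dots> = ennreal (\<Sum>C\<in>?E. ?w C)" by (rule sum_ennreal) simp
  finally have "measure (hypertree_measure n k) ?E = (\<Sum>C\<in>?E. ?w C)"
    by (simp add: measure_def sum_nonneg)
  also have "\<dots> = (\<Sum>F\<in>{F \<in> ?F. facet_weight n k F \<noteq> 0}. facet_weight n k F / real n ^ ((n - 2) choose k))"
  proof (rule sum.reindex_bij_witness[where i = "complex_of_facets n k" and j = ?top])
    fix C assume "C \<in> ?E"
    then have C: "simplicial_complex_on n C" "dimensional k C"
      "\<And>X. X \<subseteq> {1..n} \<Longrightarrow> card X \<le> k \<Longrightarrow> X \<in> C" "card (?top C) = (n - 1) choose k"
      "finite (carrier (simplicial_homology (k - 1) C))" "Q (?top C)"
      by (auto simp: hypertrees_def)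
    have sub: "X \<subseteq> {1..n}" if "X \<in> C" for X using C(1) that by (auto simp: simplicial_complex_on_def)
    have top: "?top C \<subseteq> nsets {1..n} (k + 1)"
    proof
      fix X assume "X \<in> ?top C"
      then have "X \<subseteq> {1..n}" "card X = k + 1" using sub by auto
      then show "X \<in> nsets {1..n} (k + 1)" by (auto simp: nsets_def intro: finite_subset)
    qed
    have small: "X \<in> ?top C \<or> card X \<le> k" if "X \<in> C" for X
      using C(2) that by (auto simp: dimensional_def le_Suc_eq)
    show CC: "complex_of_facets n k (?top C) = C"
    proof (intro equalityI subsetI)
      fix X assume "X \<in> complex_of_facets n k (?top C)"
      then show "X \<in> C" using C(3) by (auto simp: complex_of_facets_def)
    next
      fix X assume "X \<in> C"
      then show "X \<in> complex_of_facets n k (?top C)"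
        using sub[of X] small[of X] by (auto simp: complex_of_facets_def)
    qed
    have "k \<ge> 1" "n \<ge> 1" using k n by auto
    note ow = order_square_eq_facet_weight[OF this top C(4), unfolded CC]
    show "?top C \<in> {F \<in> ?F. facet_weight n k F \<noteq> 0}" using top C ow by simp
    show "facet_weight n k (?top C) / real n ^ ((n - 2) choose k) = ?w C" using ow by simp
  next
    fix F assume "F \<in> {F \<in> ?F. facet_weight n k F \<noteq> 0}"
    then have F: "F \<subseteq> nsets {1..n} (k + 1)" "card F = (n - 1) choose k" "Q F" "facet_weight n k F \<noteq> 0"
      by auto
    let ?C = "complex_of_facets n k F"
    have Fmem: "X \<subseteq> {1..n}" "finite X" "card X = k + 1" if "X \<in> F" for X
      using subsetD[OF F(1) that] by (auto simp: nsets_def)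
    show top: "?top ?C = F"
    proof (intro equalityI subsetI)
      fix X assume "X \<in> F"
      then show "X \<in> ?top ?C" using Fmem[of X] by (simp add: complex_of_facets_def)
    qed (auto simp: complex_of_facets_def)
    have "k \<ge> 1" "n \<ge> 1" using k n by auto
    note ow = order_square_eq_facet_weight[OF this F(1,2)]
    \<comment> \<open>The complex must attain dimension \<open>k\<close>;
      \<open>n \<ge> k + 1\<close> makes the prescribed number of facets positive.\<close>
    have "F \<noteq> {}"
    proof
      assume "F = {}"
      then have "(n - 1) choose k = 0" using F(2) by simp
      then show False using n by (simp add: binomial_eq_0_iff)
    qed
    then obtain X0 where X0: "X0 \<in> F" by blast
    have Cmem: "X \<subseteq> {1..n}" "card X \<le> k + 1" if "X \<in> ?C" for X
      using Fmem[of X] that by (auto simp: complex_of_facets_def)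
    have "X0 \<in> ?C" "card X0 = k + 1" using Fmem[OF X0] X0 by (auto simp: complex_of_facets_def)
    then have "dimensional k ?C"
      unfolding dimensional_def using Cmem(2) by blast
    moreover have "simplicial_complex_on n ?C"
      unfolding simplicial_complex_on_def
    proof safe
      fix X x assume "X \<in> ?C" "x \<in> X"
      then show "x \<in> {1..n}" using Cmem(1) by blast
    next
      fix X Y assume X: "X \<in> ?C" "Y \<subseteq> X"
      then have XV: "X \<subseteq> {1..n}" "card X \<le> k + 1" using Cmem by blast+
      then have fX: "finite X" by (meson finite_atLeastAtMost finite_subset)
      show "Y \<in> ?C"
      proof (cases "Y = X")
        case False
        then have "card Y < card X" using X fX by (intro psubset_card_mono) auto
        then show ?thesis using X XV by (auto simp: complex_of_facets_def)
      qed (use X in simp)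
    qed
    moreover have "X \<in> ?C" if "X \<subseteq> {1..n}" "card X \<le> k" for X
      using that by (simp add: complex_of_facets_def)
    ultimately show "?C \<in> ?E" using top F ow by (simp add: hypertrees_def)
  qed
  also have "\<dots> = (\<Sum>F\<in>?F. facet_weight n k F / real n ^ ((n - 2) choose k))"
    by (intro sum.mono_neutral_left) (auto intro: finite_subset[of _ "Pow (nsets {1..n} (k + 1))"]
        simp: finite_imp_finite_nsets)
  finally show ?thesis by (simp add: sp sum_divide_distrib)
qed

text \<open>The generating function of hypertrees in the facet variables \<open>w\<close>: in
  Cauchy-Binet the columns of one factor are scaled by \<open>w\<close>, and the two minors agree up
  to transposition.\<close>

lemma weighted_hypertree_sum:
  fixes w :: "nat set \<Rightarrow> real"
  shows "(\<Sum>F | F \<subseteq> nsets {1..n} (k + 1) \<and> card F = (n - 1) choose k. facet_weight n k F * prod w F) =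
    fdet (nsets {2..n} k) (\<lambda>Y Y'. \<Sum>X\<in>nsets {1..n} (k + 1). w X * inc Y X * inc Y' X)"
proof -
  let ?R = "nsets {2..n} k" and ?T = "nsets {1..n} (k + 1)"
  let ?e = "\<lambda>F. SOME e. bij_betw e (nsets {2..n} k) F"
  have fin: "finite ?R" "finite ?T" by (simp_all add: finite_imp_finite_nsets)
  have cR: "card ?R = (n - 1) choose k" by simp
  have "fdet ?R (\<lambda>Y Y'. \<Sum>X\<in>?T. (w X * inc Y X) * inc Y' X) =
    (\<Sum>F | F \<subseteq> ?T \<and> card F = card ?R.
      fdet ?R (\<lambda>Y j. w (?e F j) * inc Y (?e F j)) * fdet ?R (\<lambda>i Y. inc Y (?e F i)))"
    by (rule fdet_Cauchy_Binet[OF fin]) (rule ex_bij_betw_facets, simp_all)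
  also have "\<dots> = (\<Sum>F | F \<subseteq> ?T \<and> card F = (n - 1) choose k. facet_weight n k F * prod w F)"
  proof (rule sum.cong)
    fix F assume "F \<in> {F. F \<subseteq> ?T \<and> card F = (n - 1) choose k}"
    then have e: "bij_betw (?e F) ?R F" by (intro ex_bij_betw_facets) auto
    have 1: "fdet ?R (\<lambda>Y j. w (?e F j) * inc Y (?e F j)) =
        prod (\<lambda>j. w (?e F j)) ?R * fdet ?R (\<lambda>Y j. inc Y (?e F j))"
      by (subst (1 2) fdet_transpose[OF fin(1), symmetric]) (rule fdet_scale_rows)
    have 2: "fdet ?R (\<lambda>i Y. inc Y (?e F i)) = fdet ?R (\<lambda>Y j. inc Y (?e F j) :: real)"
      by (rule fdet_transpose[OF fin(1)])
    have "prod (\<lambda>j. w (?e F j)) ?R = prod w F" by (rule prod.reindex_bij_betw[OF e])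
    then show "fdet ?R (\<lambda>Y j. w (?e F j) * inc Y (?e F j)) * fdet ?R (\<lambda>i Y. inc Y (?e F i)) =
        facet_weight n k F * prod w F"
      unfolding 1 2 facet_weight_def by (simp add: power2_eq_square)
  qed (simp only: cR)
  finally show ?thesis by simp
qed

text \<open>The row of a face containing 1 is minus a combination of rows of faces avoiding 1,
  because boundaries are cycles. Eliminating those rows gives the Gram matrix over faces avoiding 1
  with metric \<open>I + G\<close>, which is \<open>n\<close> times the inverse of the reduced
  Laplacian.\<close>

lemma reduced_coboundary_Gram:
  assumes k: "k \<ge> 1" and n: "n \<ge> 1" and X: "X \<subseteq> {1..n}" "X' \<subseteq> {1..n}"
  shows "(\<Sum>Y\<in>nsets {2..n} k. inc Y X * (inc Y X' +
      (\<Sum>Y'\<in>nsets {2..n} k. (\<Sum>Z\<in>Pow {2..n}. inc Z Y * inc Z Y') * inc Y' X'))) =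
    (\<Sum>Y\<in>nsets {1..n} k. inc Y X * inc Y X' :: real)"
proof -
  let ?R = "nsets {2..n} k" and ?S = "nsets {1..n} k" and ?Q = "nsets {2..n} (k - 1)"
  have fin: "finite ?R" "finite ?S" "finite ?Q" by (simp_all add: finite_imp_finite_nsets)
  have V: "{1..n} = insert 1 {2..n}" using n by auto
  have sub: "Z \<subseteq> {2..n}" "1 \<notin> Z" "finite Z" "insert 1 Z \<subseteq> {1..n}" if "Z \<in> nsets {2..n} j" for Z j
    using that n by (auto simp: nsets_def)
  have S: "?S = ?R \<union> (insert 1) ` ?Q"
  proof (intro equalityI subsetI)
    fix Y assume Y: "Y \<in> ?S"
    show "Y \<in> ?R \<union> (insert 1) ` ?Q"
    proof (cases "1 \<in> Y")
      case True
      then have "Y = insert 1 (Y - {1})" "Y - {1} \<in> ?Q"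
        using Y by (auto simp: nsets_def V)
      then show ?thesis by blast
    next
      case False
      have "Y \<subseteq> {2..n}"
      proof
        fix x assume "x \<in> Y"
        then have "x \<in> {1..n}" "x \<noteq> 1" using False Y by (auto simp: nsets_def)
        then show "x \<in> {2..n}" by auto
      qed
      then show ?thesis using Y by (auto simp: nsets_def)
    qed
  next
    fix Y assume "Y \<in> ?R \<union> (insert 1) ` ?Q"
    then consider "Y \<in> ?R" | Z where "Z \<in> ?Q" "Y = insert 1 Z" by blast
    then show "Y \<in> ?S"
    proof cases
      case 1
      then show ?thesis using nsets_mono[of "{2..n}" "{1..n}" k] V by auto
    next
      case 2
      have "card Z = k - 1" using 2(1) by (simp add: nsets_def)
      then have "card Y = k" using sub(2,3)[OF 2(1)] k by (simp add: 2(2))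
      moreover have "finite Y" "Y \<subseteq> {1..n}" using sub(3,4)[OF 2(1)] by (simp_all add: 2(2))
      ultimately show ?thesis by (simp add: nsets_def)
    qed
  qed
  have disj: "?R \<inter> (insert 1) ` ?Q = {}" using sub by blast
  have inj: "inj_on (insert 1) ?Q" using sub by (auto simp: inj_on_def insert_ident)
  have sum_S: "(\<Sum>Y\<in>?S. g Y) = (\<Sum>Y\<in>?R. g Y) + (\<Sum>Z\<in>?Q. g (insert 1 Z))"
    for g :: "nat set \<Rightarrow> real"
    unfolding S sum.union_disjoint[OF fin(1) finite_imageI[OF fin(3)] disj] sum.reindex[OF inj] comp_def ..
  \<comment> \<open>This is the coefficient at \<open>Z\<close> of the boundary of a boundary; among
    faces containing 1 only \<open>insert 1 Z\<close> contributes, with sign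
    \<open>+1\<close>.\<close>
  have up: "inc (insert 1 Z) X = - (\<Sum>Y\<in>?R. inc Z Y * inc Y X :: real)"
    if Z: "Z \<in> ?Q" and X: "X \<subseteq> {1..n}" for Z X
  proof -
    have "0 = (\<Sum>Y\<in>Pow {1..n}. inc Z Y * inc Y X :: real)" using inc_inc_zero[of "{1..n}" X] X by simp
    also have "\<dots> = (\<Sum>Y\<in>?S. inc Z Y * inc Y X)"
      using Z k by (intro sum_Pow_restrict_nsets) (auto simp: nsets_def dest!: inc_nonzero_card)
    also have "\<dots> = (\<Sum>Y\<in>?R. inc Z Y * inc Y X) + (\<Sum>Z'\<in>?Q. inc Z (insert 1 Z') * inc (insert 1 Z') X)"
      by (rule sum_S)
    also have "(\<Sum>Z'\<in>?Q. inc Z (insert 1 Z') * inc (insert 1 Z') X) =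
        (\<Sum>Z'\<in>?Q. if Z' = Z then inc (insert 1 Z) X else 0 :: real)"
    proof (rule sum.cong[OF refl])
      fix Z' assume Z': "Z' \<in> ?Q"
      show "inc Z (insert 1 Z') * inc (insert 1 Z') X = (if Z' = Z then inc (insert 1 Z) X else 0 :: real)"
      proof (cases "Z' = Z")
        case True
        have "inc Z (insert 1 Z) = (1::real)"
          using sub(1,3)[OF Z] by (intro inc_insert_least) auto
        then show ?thesis using True by simp
      next
        case False
        have "inc Z (insert 1 Z') = (0::real)"
        proof (rule ccontr)
          assume "inc Z (insert 1 Z') \<noteq> (0::real)"
          then have "Z \<subseteq> insert 1 Z'" by (rule inc_nonzero_subset)
          then have "Z \<subseteq> Z'" using sub[OF Z] by auto
          moreover have "card Z = card Z'" using Z Z' by (auto simp: nsets_def)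
          ultimately show False using False card_subset_eq[OF sub(3)[OF Z']] by auto
        qed
        then show ?thesis using False by simp
      qed
    qed
    also have "\<dots> = inc (insert 1 Z) X" using fin Z by simp
    finally show ?thesis by simp
  qed
  have G: "(\<Sum>Z\<in>Pow {2..n}. inc Z Y * inc Z Y') = (\<Sum>Z\<in>?Q. inc Z Y * inc Z Y' :: real)" if "Y \<in> ?R" for Y Y'
    using that by (intro sum_Pow_restrict_nsets) (auto simp: nsets_def dest!: inc_nonzero_card)
  have "(\<Sum>Y\<in>?S. inc Y X * inc Y X' :: real) = (\<Sum>Y\<in>?R. inc Y X * inc Y X') +
      (\<Sum>Z\<in>?Q. inc (insert 1 Z) X * inc (insert 1 Z) X')"
    by (rule sum_S)
  also have "(\<Sum>Z\<in>?Q. inc (insert 1 Z) X * inc (insert 1 Z) X') =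
     (\<Sum>Z\<in>?Q. (\<Sum>Y\<in>?R. inc Z Y * inc Y X) * (\<Sum>Y'\<in>?R. inc Z Y' * inc Y' X') :: real)"
    by (intro sum.cong refl) (simp only: up[OF _ X(1)] up[OF _ X(2)] minus_mult_minus)
  also have "\<dots> = (\<Sum>Z\<in>?Q. \<Sum>Y\<in>?R. \<Sum>Y'\<in>?R. inc Y X * (inc Z Y * inc Z Y' * inc Y' X'))"
    by (simp add: sum_product mult_ac)
  also have "\<dots> = (\<Sum>Y\<in>?R. \<Sum>Z\<in>?Q. \<Sum>Y'\<in>?R. inc Y X * (inc Z Y * inc Z Y' * inc Y' X'))"
    by (rule sum.swap)
  also have "\<dots> = (\<Sum>Y\<in>?R. \<Sum>Y'\<in>?R. \<Sum>Z\<in>?Q. inc Y X * (inc Z Y * inc Z Y' * inc Y' X'))"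
    by (intro sum.cong refl sum.swap)
  also have "\<dots> = (\<Sum>Y\<in>?R. inc Y X * (\<Sum>Y'\<in>?R. (\<Sum>Z\<in>Pow {2..n}. inc Z Y * inc Z Y') * inc Y' X'))"
    by (intro sum.cong refl) (simp add: G sum_distrib_left sum_distrib_right)
  finally show ?thesis by (simp add: sum.distrib distrib_left)
qed

text \<open>\<open>u\<close> is the deviation from weight 1. At \<open>u = 0\<close> the matrix is
  the reduced Laplacian \<open>K\<close>, which has an explicit inverse and is factored out. The
  other factor is carried over to facets, where the preceding Gram identity erases the vertex 1, and
  then back to all \<open>k\<close>-sets.\<close>

lemma fdet_reduced_eq_full:
  fixes u :: "nat set \<Rightarrow> real"
  assumes k: "k \<ge> 1" and n: "n \<ge> 2"
  shows "fdet (nsets {2..n} k) (\<lambda>Y Y'. \<Sum>X\<in>nsets {1..n} (k + 1). (1 - u X) * inc Y X * inc Y' X) =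
    real n ^ ((n - 2) choose k) *
    fdet (nsets {1..n} k) (\<lambda>Y Y'. (if Y = Y' then 1 else 0)
      - (\<Sum>X\<in>nsets {1..n} (k + 1). u X * inc Y X * inc Y' X) / real n)"
proof -
  let ?R = "nsets {2..n} k" and ?S = "nsets {1..n} k" and ?T = "nsets {1..n} (k + 1)"
  let ?G = "\<lambda>Y Y'. \<Sum>Z\<in>Pow {2..n}. inc Z Y * inc Z Y' :: real"
  let ?K = "\<lambda>Y Y'. (if Y = Y' then real n else 0) - ?G Y Y'"
  \<comment> \<open>\<open>P\<close> is the inverse of \<open>K\<close> applied to the boundary
    matrix.\<close>
  let ?P = "\<lambda>Y X. (inc Y X + (\<Sum>Y'\<in>?R. ?G Y Y' * inc Y' X)) / real n"
  have fin: "finite ?R" "finite ?S" "finite ?T" by (simp_all add: finite_imp_finite_nsets)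
  have n0: "real n \<noteq> 0" using n by simp
  have cV: "card {2..n} = n - 1" "Suc (n - 1) = n" "card {1..n} = n" using n by auto
  have Hodge: "(\<Sum>X\<in>?T. inc Y X * inc Y' X) = ?K Y Y'" if Y: "Y \<in> ?R" "Y' \<in> ?R" for Y Y'
  proof -
    have sub: "Y \<subseteq> {1..n}" "Y' \<subseteq> {1..n}" using Y by (auto simp: nsets_def)
    have "(\<Sum>X\<in>?T. inc Y X * inc Y' X) = (\<Sum>X\<in>Pow {1..n}. inc Y X * inc Y' X :: real)"
      using Y by (intro sum_Pow_restrict_nsets[symmetric]) (auto simp: nsets_def dest!: inc_nonzero_card)
    moreover have "(\<Sum>Z\<in>Pow {1..n}. inc Z Y * inc Z Y') = ?G Y Y'"
    proof (rule sum.mono_neutral_right)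
      show "\<forall>Z\<in>Pow {1..n} - Pow {2..n}. inc Z Y * inc Z Y' = (0::real)"
      proof (safe, rule ccontr)
        fix Z x assume "x \<in> Z" "x \<notin> {2..n}" "inc Z Y * inc Z Y' \<noteq> (0::real)"
        then have "inc Z Y \<noteq> (0::real)" by auto
        then have "Z \<subseteq> Y" by (rule inc_nonzero_subset)
        then show False using \<open>x \<in> Z\<close> \<open>x \<notin> {2..n}\<close> Y by (auto simp: nsets_def)
      qed
    qed auto
    moreover have "(\<Sum>X\<in>Pow {1..n}. inc Y X * inc Y' X) + (\<Sum>Z\<in>Pow {1..n}. inc Z Y * inc Z Y') =
        (if Y = Y' then real n else 0)"
      using inc_Hodge[OF _ sub, where 'b=real] by simp
    ultimately show ?thesis by linarith
  qed
  have KP: "(\<Sum>Y'\<in>?R. ?K Y Y' * ?P Y' X) = inc Y X" if Y: "Y \<in> ?R" for Y X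
  proof -
    have P: "?P Y' X = (\<Sum>Y''\<in>?R. ((if Y' = Y'' then 1 else 0) + ?G Y' Y'') * inc Y'' X) / real n"
      if "Y' \<in> ?R" for Y'
    proof -
      have "(\<Sum>Y''\<in>?R. ((if Y' = Y'' then 1 else 0) + ?G Y' Y'') * inc Y'' X) =
          (\<Sum>Y''\<in>?R. (if Y'' = Y' then inc Y' X else 0) + ?G Y' Y'' * inc Y'' X)"
        by (intro sum.cong refl) (auto simp: distrib_right)
      also have "\<dots> = inc Y' X + (\<Sum>Y''\<in>?R. ?G Y' Y'' * inc Y'' X)"
        using fin that by (simp only: sum.distrib) simp
      finally show ?thesis by simp
    qed
    have "(\<Sum>Y'\<in>?R. ?K Y Y' * ?P Y' X) =
        (\<Sum>Y'\<in>?R. \<Sum>Y''\<in>?R. ?K Y Y' * ((if Y' = Y'' then 1 else 0) + ?G Y' Y'') * inc Y'' X) / real n"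
      by (simp add: P sum_distrib_left sum_divide_distrib mult.assoc)
    also have "\<dots> = (\<Sum>Y''\<in>?R. (\<Sum>Y'\<in>?R. ?K Y Y' * ((if Y' = Y'' then 1 else 0) + ?G Y' Y'')) * inc Y'' X) / real n"
      by (subst sum.swap) (simp add: sum_distrib_right)
    also have "\<dots> = (\<Sum>Y''\<in>?R. (if Y = Y'' then real n else 0) * inc Y'' X) / real n"
      by (intro arg_cong2[where f="(/)"] sum.cong refl)
        (simp only: shifted_Laplacian_inverse[OF finite_atLeastAtMost cV(1) Y, unfolded cV(2)])
    also have "\<dots> = (\<Sum>Y''\<in>?R. if Y'' = Y then real n * inc Y X else 0) / real n"
      by (intro arg_cong2[where f="(/)"] sum.cong refl) auto
    also have "\<dots> = inc Y X" using fin Y n0 by simp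
    finally show ?thesis .
  qed
  have "fdet ?R (\<lambda>Y Y'. \<Sum>X\<in>?T. (1 - u X) * inc Y X * inc Y' X) =
    fdet ?R (\<lambda>Y Y'. \<Sum>Y''\<in>?R. ?K Y Y'' * ((if Y'' = Y' then 1 else 0) - (\<Sum>X\<in>?T. ?P Y'' X * (u X * inc Y' X))))"
  proof (rule fdet_cong[OF refl])
    fix Y Y' assume Y: "Y \<in> ?R" "Y' \<in> ?R"
    have "(\<Sum>Y''\<in>?R. ?K Y Y'' * ((if Y'' = Y' then 1 else 0) - (\<Sum>X\<in>?T. ?P Y'' X * (u X * inc Y' X)))) =
      (\<Sum>Y''\<in>?R. (if Y'' = Y' then ?K Y Y' else 0) - (\<Sum>X\<in>?T. ?K Y Y'' * ?P Y'' X * (u X * inc Y' X)))"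
      by (intro sum.cong refl) (auto simp: right_diff_distrib sum_distrib_left mult.assoc)
    also have "\<dots> = ?K Y Y' - (\<Sum>Y''\<in>?R. \<Sum>X\<in>?T. ?K Y Y'' * ?P Y'' X * (u X * inc Y' X))"
      using fin Y by (simp only: sum_subtractf) simp
    also have "(\<Sum>Y''\<in>?R. \<Sum>X\<in>?T. ?K Y Y'' * ?P Y'' X * (u X * inc Y' X)) =
       (\<Sum>X\<in>?T. (\<Sum>Y''\<in>?R. ?K Y Y'' * ?P Y'' X) * (u X * inc Y' X))"
      by (subst sum.swap) (simp only: sum_distrib_right)
    also have "\<dots> = (\<Sum>X\<in>?T. inc Y X * (u X * inc Y' X))"
      by (simp only: KP[OF Y(1)])
    also have "?K Y Y' = (\<Sum>X\<in>?T. inc Y X * inc Y' X)" by (rule Hodge[OF Y, symmetric])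
    finally have rhs: "(\<Sum>Y''\<in>?R. ?K Y Y'' * ((if Y'' = Y' then 1 else 0) - (\<Sum>X\<in>?T. ?P Y'' X * (u X * inc Y' X)))) =
        (\<Sum>X\<in>?T. inc Y X * inc Y' X) - (\<Sum>X\<in>?T. inc Y X * (u X * inc Y' X))" .
    show "(\<Sum>X\<in>?T. (1 - u X) * inc Y X * inc Y' X) =
      (\<Sum>Y''\<in>?R. ?K Y Y'' * ((if Y'' = Y' then 1 else 0) - (\<Sum>X\<in>?T. ?P Y'' X * (u X * inc Y' X))))"
      unfolding rhs sum_subtractf[symmetric] by (intro sum.cong refl) (simp add: algebra_simps)
  qed
  also have "\<dots> = fdet ?R ?K * fdet ?R (\<lambda>Y Y'. (if Y = Y' then 1 else 0) - (\<Sum>X\<in>?T. ?P Y X * (u X * inc Y' X)))"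
    by (rule fdet_mult[OF fin(1)])
  also have "fdet ?R ?K = real n ^ ((n - 2) choose k)"
  proof -
    have "n - 1 > 0" "n - 1 - 1 = n - 2" using n by auto
    then show ?thesis
      using fdet_shifted_Laplacian[OF finite_atLeastAtMost cV(1), of k] unfolding cV(2) by simp
  qed
  also have "fdet ?R (\<lambda>Y Y'. (if Y = Y' then 1 else 0) - (\<Sum>X\<in>?T. ?P Y X * (u X * inc Y' X))) =
      fdet ?T (\<lambda>X X'. (if X = X' then 1 else 0) - (\<Sum>Y\<in>?R. (u X * inc Y X) * ?P Y X'))"
    by (subst fdet_Sylvester[OF fin(1,3)]) (auto simp: nsets_def)
  also have "\<dots> = fdet ?T (\<lambda>X X'. (if X = X' then 1 else 0) - (\<Sum>Y\<in>?S. (u X * inc Y X) * (inc Y X' / real n)))"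
  proof (intro fdet_cong[OF refl] arg_cong2[where f="(-)"] refl)
    fix X X' assume "X \<in> ?T" "X' \<in> ?T"
    then have X: "X \<subseteq> {1..n}" "X' \<subseteq> {1..n}" by (auto simp: nsets_def)
    have "(\<Sum>Y\<in>?R. (u X * inc Y X) * ?P Y X') =
       u X * (\<Sum>Y\<in>?R. inc Y X * (inc Y X' + (\<Sum>Y'\<in>?R. ?G Y Y' * inc Y' X'))) / real n"
      by (simp add: sum_distrib_left sum_divide_distrib mult.assoc)
    also have "\<dots> = u X * (\<Sum>Y\<in>?S. inc Y X * inc Y X') / real n"
      using reduced_coboundary_Gram[OF k _ X] n by simp
    finally show "(\<Sum>Y\<in>?R. (u X * inc Y X) * ?P Y X') = (\<Sum>Y\<in>?S. (u X * inc Y X) * (inc Y X' / real n))"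
      by (simp add: sum_distrib_left sum_divide_distrib mult.assoc)
  qed
  also have "\<dots> = fdet ?S (\<lambda>Y Y'. (if Y = Y' then 1 else 0) - (\<Sum>X\<in>?T. (inc Y X / real n) * (u X * inc Y' X)))"
    by (subst fdet_Sylvester[OF fin(2,3)]) (auto simp: nsets_def)
  also have "\<dots> = fdet ?S (\<lambda>Y Y'. (if Y = Y' then 1 else 0) - (\<Sum>X\<in>?T. u X * inc Y X * inc Y' X) / real n)"
    by (intro fdet_cong[OF refl] arg_cong2[where f="(-)"] refl) (simp add: sum_divide_distrib mult_ac)
  finally show ?thesis .
qed

text \<open>A bordered form of the identity minus \<open>1/n\<close> times the Laplacian over
  \<open>N\<close>. The facets in \<open>N\<close> are those whose status is prescribed, the facets
  in \<open>A\<close> those required to be present; each of the latter adds a row and a column. The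
  zero block on \<open>A\<close> is the limit of the diagonal entry \<open>1/t\<close> for facet
  weight \<open>t\<close>.\<close>

definition local_matrix :: "nat \<Rightarrow> nat \<Rightarrow> nat set set \<Rightarrow> nat set set \<Rightarrow> nat set \<Rightarrow> nat set \<Rightarrow> real" where
  "local_matrix n k N A x y =
    (if x \<in> nsets {1..n} k then
       if y \<in> nsets {1..n} k then (if x = y then 1 else 0) - (\<Sum>X\<in>N. inc x X * inc y X) / real n
       else if y \<in> A then inc x y else 0
     else if y \<in> nsets {1..n} k then - inc y x / real n else 0)"

lemma tendsto_fdet:
  fixes A :: "'c \<Rightarrow> 'a \<Rightarrow> 'a \<Rightarrow> real"
  assumes "\<And>i j. i \<in> S \<Longrightarrow> j \<in> S \<Longrightarrow> ((\<lambda>t. A t i j) \<longlongrightarrow> B i j) F"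
  shows "((\<lambda>t. fdet S (A t)) \<longlongrightarrow> fdet S B) F"
  unfolding fdet_def
  by (intro tendsto_sum tendsto_mult tendsto_const tendsto_prod assms)
    (auto simp: permutes_in_image)

text \<open>Weight 0 forbids a facet and weight \<open>t \<rightarrow> \<infinity>\<close> enforces it; the
  Schur complement keeps the determinant finite in the limit.\<close>

lemma facet_weight_local:
  assumes k: "k \<ge> 1" and n: "n \<ge> 2" and A: "A \<subseteq> N" and N: "N \<subseteq> nsets {1..n} (k + 1)"
  shows "(\<Sum>F | F \<subseteq> nsets {1..n} (k + 1) \<and> card F = (n - 1) choose k \<and> F \<inter> N = A. facet_weight n k F)
     / real n ^ ((n - 2) choose k) = fdet (nsets {1..n} k \<union> A) (local_matrix n k N A)"
proof -
  let ?S = "nsets {1..n} k" and ?T = "nsets {1..n} (k + 1)"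
  let ?Fs = "{F. F \<subseteq> ?T \<and> card F = (n - 1) choose k}"
  let ?c = "real n ^ ((n - 2) choose k)"
  have n0: "real n \<noteq> 0" using n by simp
  have finT: "finite ?T" and finS: "finite ?S" by (simp_all add: finite_imp_finite_nsets)
  then have finN: "finite N" and finA: "finite A" using N A by (meson finite_subset)+
  have finFs: "finite ?Fs" using finT by simp
  have disj: "?S \<inter> A = {}" using A N by (auto simp: nsets_def)
  \<comment> \<open>After division by \<open>t ^ card A\<close>, a facet set that misses members of
    \<open>A\<close> carries a positive power of \<open>1/t\<close> and disappears in the
    limit.\<close>
  define w :: "real \<Rightarrow> nat set \<Rightarrow> real" where
    "w t X = (if X \<in> A then t else if X \<in> N then 0 else 1)" for t X
  define M where "M t x y = local_matrix n k N A x y + (if x = y \<and> x \<in> A then 1 / t else 0)" for t x y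
  have prod_w: "prod (w t) F / t ^ card A = (if F \<inter> (N - A) = {} then (1 / t) ^ card (A - F) else 0)"
    if "t > 0" "F \<in> ?Fs" for t F
  proof (cases "F \<inter> (N - A) = {}")
    case True
    have finF: "finite F" using that finT by (auto intro: finite_subset)
    have "prod (w t) F = prod (w t) (F \<inter> A)"
      using True finF by (intro prod.mono_neutral_right) (auto simp: w_def)
    also have "\<dots> = t ^ card (F \<inter> A)" by (simp add: w_def)
    finally have "prod (w t) F = t ^ card (F \<inter> A)" .
    moreover have "card A = card (F \<inter> A) + card (A - F)"
      using finA by (metis Int_commute card_Int_Diff)
    ultimately show ?thesis using True that by (simp add: power_add power_one_over)
  next
    case False
    then obtain X where "X \<in> F" "X \<in> N" "X \<notin> A" by blast
    then have "X \<in> F" "w t X = 0" by (auto simp: w_def)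
    moreover have finF: "finite F" using that finT by (auto intro: finite_subset)
    ultimately have "prod (w t) F = 0" by (intro prod_zero) auto
    then show ?thesis using False by simp
  qed
  have eq: "(\<Sum>F\<in>?Fs. facet_weight n k F * (prod (w t) F / t ^ card A)) = ?c * fdet (?S \<union> A) (M t)"
    if t: "t > 0" for t
  proof -
    have "(\<Sum>F\<in>?Fs. facet_weight n k F * prod (w t) F) =
        fdet (nsets {2..n} k) (\<lambda>Y Y'. \<Sum>X\<in>?T. (1 - (1 - w t X)) * inc Y X * inc Y' X)"
      unfolding weighted_hypertree_sum by simp
    also have "\<dots> = ?c * fdet ?S (\<lambda>Y Y'. (if Y = Y' then 1 else 0)
        - (\<Sum>X\<in>?T. (1 - w t X) * inc Y X * inc Y' X) / real n)"
      by (rule fdet_reduced_eq_full[OF k n])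
    also have "fdet ?S (\<lambda>Y Y'. (if Y = Y' then 1 else 0)
        - (\<Sum>X\<in>?T. (1 - w t X) * inc Y X * inc Y' X) / real n) = fdet (?S \<union> A) (\<lambda>x y. (if x \<in> A then t else 1) * M t x y)"
    proof -
      \<comment> \<open>Scaling the rows in \<open>A\<close> by \<open>t\<close> turns their
        diagonal entry \<open>1 / t\<close> into 1, as the Schur complement requires.\<close>
      define L where "L x y = (if x \<in> A then t else 1) * M t x y" for x y
      have "fdet (?S \<union> A) L = fdet ?S (\<lambda>i j. L i j - (\<Sum>l\<in>A. L i l * L l j))"
        using disj t by (intro fdet_Schur finS finA) (auto simp: L_def M_def local_matrix_def)
      also have "\<dots> = fdet ?S (\<lambda>Y Y'. (if Y = Y' then 1 else 0)
        - (\<Sum>X\<in>?T. (1 - w t X) * inc Y X * inc Y' X) / real n)"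
      proof (rule fdet_cong[OF refl])
        fix Y Y' assume Y: "Y \<in> ?S" "Y' \<in> ?S"
        have notA: "Y \<notin> A" "Y' \<notin> A" using Y disj by auto
        have L1: "L Y Y' = (if Y = Y' then 1 else 0) - (\<Sum>X\<in>N. inc Y X * inc Y' X) / real n"
          using Y notA by (auto simp: L_def M_def local_matrix_def)
        have L2: "(\<Sum>l\<in>A. L Y l * L l Y') = (\<Sum>l\<in>A. inc Y l * (- t * inc Y' l / real n))"
          using Y notA disj by (intro sum.cong refl) (auto simp: L_def M_def local_matrix_def)
        have "(\<Sum>X\<in>?T. (1 - w t X) * inc Y X * inc Y' X) =
           (\<Sum>X\<in>N. (1 - w t X) * inc Y X * inc Y' X)"
          using N A finT by (intro sum.mono_neutral_right) (auto simp: w_def)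
        also have "\<dots> = (\<Sum>X\<in>N. inc Y X * inc Y' X - (if X \<in> A then t * inc Y X * inc Y' X else 0))"
          using A by (intro sum.cong refl) (auto simp: w_def left_diff_distrib)
        also have "\<dots> = (\<Sum>X\<in>N. inc Y X * inc Y' X) - (\<Sum>X\<in>N. if X \<in> A then t * inc Y X * inc Y' X else 0)"
          by (rule sum_subtractf)
        also have "(\<Sum>X\<in>N. if X \<in> A then t * inc Y X * inc Y' X else 0) = (\<Sum>X\<in>A. t * inc Y X * inc Y' X)"
          using A finN by (intro sum.mono_neutral_cong_right) auto
        finally have "(\<Sum>X\<in>?T. (1 - w t X) * inc Y X * inc Y' X) =
           (\<Sum>X\<in>N. inc Y X * inc Y' X) - (\<Sum>X\<in>A. t * inc Y X * inc Y' X)" .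
        then show "L Y Y' - (\<Sum>l\<in>A. L Y l * L l Y') = (if Y = Y' then 1 else 0)
            - (\<Sum>X\<in>?T. (1 - w t X) * inc Y X * inc Y' X) / real n"
          unfolding L1 L2 by (simp add: diff_divide_distrib sum_divide_distrib sum_negf mult_ac)
      qed
      finally show ?thesis by (simp add: L_def[abs_def])
    qed
    also have "\<dots> = (\<Prod>x\<in>?S \<union> A. if x \<in> A then t else 1) * fdet (?S \<union> A) (M t)"
      by (rule fdet_scale_rows)
    also have "(\<Prod>x\<in>?S \<union> A. if x \<in> A then t else 1) = (\<Prod>x\<in>A. t)"
      using finS finA by (intro prod.mono_neutral_cong_right) auto
    finally have "(\<Sum>F\<in>?Fs. facet_weight n k F * prod (w t) F) = ?c * (t ^ card A * fdet (?S \<union> A) (M t))"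
      by simp
    then show ?thesis using t by (simp add: sum_divide_distrib[symmetric])
  qed
  have lim0: "((\<lambda>t::real. 1 / t) \<longlongrightarrow> 0) at_top"
    using tendsto_divide_0[OF tendsto_const filterlim_at_top_imp_at_infinity[OF filterlim_ident]] .
  have "((\<lambda>t. \<Sum>F\<in>?Fs. facet_weight n k F * (prod (w t) F / t ^ card A)) \<longlongrightarrow>
      (\<Sum>F\<in>?Fs. facet_weight n k F * (if F \<inter> N = A then 1 else 0))) at_top"
  proof (intro tendsto_sum tendsto_mult tendsto_const)
    fix F assume F: "F \<in> ?Fs"
    have "((\<lambda>t. if F \<inter> (N - A) = {} then (1 / t) ^ card (A - F) else 0) \<longlongrightarrow>
        (if F \<inter> N = A then 1 else 0 :: real)) at_top"
    proof (cases "F \<inter> (N - A) = {}")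
      case True
      have "((\<lambda>t::real. (1 / t) ^ card (A - F)) \<longlongrightarrow> 0 ^ card (A - F)) at_top"
        by (intro tendsto_power lim0)
      moreover have "F \<inter> N = A \<longleftrightarrow> card (A - F) = 0" using True A finA by auto
      ultimately show ?thesis using True by (auto simp: power_0_left)
    next
      case False
      then have "F \<inter> N \<noteq> A" by auto
      then show ?thesis using False by simp
    qed
    then show "((\<lambda>t. prod (w t) F / t ^ card A) \<longlongrightarrow> (if F \<inter> N = A then 1 else 0)) at_top"
      by (rule Lim_transform_eventually)
        (rule eventually_mono[OF eventually_gt_at_top[of 0]], simp only: prod_w[OF _ F])
  qed
  moreover have "((\<lambda>t. \<Sum>F\<in>?Fs. facet_weight n k F * (prod (w t) F / t ^ card A)) \<longlongrightarrow>
      ?c * fdet (?S \<union> A) (local_matrix n k N A)) at_top"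
  proof (rule Lim_transform_eventually)
    have "((\<lambda>t. M t i j) \<longlongrightarrow> local_matrix n k N A i j) at_top" for i j
    proof (cases "i = j \<and> i \<in> A")
      case True
      then have "M t i j = local_matrix n k N A i j + 1 / t" for t by (auto simp: M_def)
      then show ?thesis
        using tendsto_add[OF tendsto_const lim0, of "local_matrix n k N A i j"] by simp
    next
      case False
      then have "M t i j = local_matrix n k N A i j" for t by (auto simp: M_def)
      then show ?thesis by simp
    qed
    then show "((\<lambda>t. ?c * fdet (?S \<union> A) (M t)) \<longlongrightarrow> ?c * fdet (?S \<union> A) (local_matrix n k N A)) at_top"
      by (intro tendsto_mult tendsto_const tendsto_fdet)
    show "\<forall>\<^sub>F t in at_top. ?c * fdet (?S \<union> A) (M t) =
        (\<Sum>F\<in>?Fs. facet_weight n k F * (prod (w t) F / t ^ card A))"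
      by (rule eventually_mono[OF eventually_gt_at_top[of 0]]) (simp only: eq)
  qed
  ultimately have eq1: "(\<Sum>F\<in>?Fs. facet_weight n k F * (if F \<inter> N = A then 1 else 0)) =
      ?c * fdet (?S \<union> A) (local_matrix n k N A)"
    by (rule tendsto_unique[OF trivial_limit_at_top_linorder])
  have eq2: "(\<Sum>F\<in>?Fs. facet_weight n k F * (if F \<inter> N = A then 1 else 0)) =
      (\<Sum>F | F \<subseteq> ?T \<and> card F = (n - 1) choose k \<and> F \<inter> N = A. facet_weight n k F)"
    using finFs by (intro sum.mono_neutral_cong_right) auto
  show ?thesis unfolding eq2[symmetric] eq1 using n0 by simp
qed

declare finite_imp_finite_nsets [simp]

section \<open>First-order and second-order determinant estimates\<close>

section \<open>Perturbation bounds for determinants\<close>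

text \<open>The products of the Leibniz expansions are compared one factor at a time; entries
  bounded by 1 keep the remaining factors from amplifying a difference.\<close>

lemma fdet_diff_le:
  fixes A B :: "'a \<Rightarrow> 'a \<Rightarrow> real"
  assumes fin: "finite S"
    and A: "\<And>i j. i \<in> S \<Longrightarrow> j \<in> S \<Longrightarrow> \<bar>A i j\<bar> \<le> 1"
    and B: "\<And>i j. i \<in> S \<Longrightarrow> j \<in> S \<Longrightarrow> \<bar>B i j\<bar> \<le> 1"
    and AB: "\<And>i j. i \<in> S \<Longrightarrow> j \<in> S \<Longrightarrow> \<bar>A i j - B i j\<bar> \<le> \<epsilon>"
  shows "\<bar>fdet S A - fdet S B\<bar> \<le> fact (card S) * (real (card S) * \<epsilon>)"
proof -
  let ?P = "{p. p permutes S}"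
  have "fdet S A - fdet S B = (\<Sum>p\<in>?P. of_int (sign p) * ((\<Prod>i\<in>S. A i (p i)) - (\<Prod>i\<in>S. B i (p i))))"
    by (simp add: fdet_def sum_subtractf right_diff_distrib)
  also have "\<bar>\<dots>\<bar> \<le> (\<Sum>p\<in>?P. \<bar>of_int (sign p) * ((\<Prod>i\<in>S. A i (p i)) - (\<Prod>i\<in>S. B i (p i)))\<bar>)"
    by (rule sum_abs)
  also have "\<dots> \<le> (\<Sum>p\<in>?P. real (card S) * \<epsilon>)"
  proof (rule sum_mono)
    fix p assume "p \<in> ?P"
    then have p: "\<And>i. i \<in> S \<Longrightarrow> p i \<in> S" by (simp add: permutes_in_image)
    have "\<bar>(\<Prod>i\<in>S. A i (p i)) - (\<Prod>i\<in>S. B i (p i))\<bar> \<le> (\<Sum>i\<in>S. \<bar>A i (p i) - B i (p i)\<bar>)"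
      using norm_prod_diff[of S "\<lambda>i. A i (p i)" "\<lambda>i. B i (p i)"] A B p by simp
    also have "\<dots> \<le> (\<Sum>i\<in>S. \<epsilon>)" by (intro sum_mono AB p)
    finally show "\<bar>of_int (sign p) * ((\<Prod>i\<in>S. A i (p i)) - (\<Prod>i\<in>S. B i (p i)))\<bar> \<le> real (card S) * \<epsilon>"
      by (simp add: abs_mult flip: of_int_abs)
  qed
  also have "\<dots> = fact (card S) * (real (card S) * \<epsilon>)"
    using card_permutations[OF refl fin] by simp
  finally show ?thesis .
qed

text \<open>The error must be of second order, since about \<open>n\<close> such determinants get
  multiplied. A permutation other than the identity has at least two off-diagonal factors, whence
  \<open>\<epsilon>\<^sup>2\<close>; the diagonal product lies between \<open>1 - s\<close> and
  \<open>1 - s + s\<^sup>2\<close> for \<open>s = sum a S\<close>.\<close>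

lemma fdet_near_identity:
  fixes A :: "'a \<Rightarrow> 'a \<Rightarrow> real"
  assumes fin: "finite S" and eps: "0 \<le> \<epsilon>" "\<epsilon> \<le> 1"
    and diag: "\<And>i. i \<in> S \<Longrightarrow> A i i = 1 - a i" and a: "\<And>i. i \<in> S \<Longrightarrow> 0 \<le> a i \<and> a i \<le> 1"
    and off: "\<And>i j. i \<in> S \<Longrightarrow> j \<in> S \<Longrightarrow> i \<noteq> j \<Longrightarrow> \<bar>A i j\<bar> \<le> \<epsilon>"
  shows "\<bar>fdet S A - (1 - sum a S)\<bar> \<le> fact (card S) * \<epsilon>\<^sup>2 + (sum a S)\<^sup>2"
proof -
  let ?P = "{p. p permutes S}"
  let ?t = "\<lambda>p. of_int (sign p) * (\<Prod>i\<in>S. A i (p i)) :: real"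
  have finP: "finite ?P" by (rule finite_permutations[OF fin])
  have le1: "\<bar>A i j\<bar> \<le> 1" if "i \<in> S" "j \<in> S" for i j
    using off[OF that] diag[OF that(1)] a[OF that(1)] eps by (cases "i = j") auto
  have split: "fdet S A = (\<Prod>i\<in>S. 1 - a i) + sum ?t (?P - {id})"
  proof -
    have "fdet S A = ?t id + sum ?t (?P - {id})"
      unfolding fdet_def by (rule sum.remove[OF finP]) (simp add: permutes_id)
    then show ?thesis by (simp add: diag)
  qed
  have "\<bar>sum ?t (?P - {id})\<bar> \<le> (\<Sum>p\<in>?P - {id}. \<bar>?t p\<bar>)" by (rule sum_abs)
  also have "\<dots> \<le> (\<Sum>p\<in>?P - {id}. \<epsilon>\<^sup>2)"
  proof (rule sum_mono)
    fix p assume "p \<in> ?P - {id}"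
    then have p: "p permutes S" "p \<noteq> id" by auto
    then obtain i where i: "p i \<noteq> i" by (auto simp: fun_eq_iff)
    have iS: "i \<in> S" using i permutes_not_in[OF p(1)] by auto
    then have piS: "p i \<in> S" using p(1) by (simp add: permutes_in_image)
    have inj: "inj p" using p(1) by (rule permutes_inj)
    have ppi: "p (p i) \<noteq> p i" using i inj by (auto dest: injD)
    have ppiS: "p (p i) \<in> S" using piS p(1) by (simp add: permutes_in_image)
    have "\<bar>\<Prod>j\<in>S. A j (p j)\<bar> = (\<Prod>j\<in>S. \<bar>A j (p j)\<bar>)" by (rule abs_prod)
    also have "\<dots> = \<bar>A i (p i)\<bar> * (\<bar>A (p i) (p (p i))\<bar> * (\<Prod>j\<in>S - {i} - {p i}. \<bar>A j (p j)\<bar>))"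
      using fin iS piS i by (simp add: prod.remove[of S i] prod.remove[of "S - {i}" "p i"])
    also have "\<dots> \<le> \<epsilon> * (\<epsilon> * 1)"
    proof (intro mult_mono)
      show "\<bar>A i (p i)\<bar> \<le> \<epsilon>" using off[OF iS piS] i by auto
      show "\<bar>A (p i) (p (p i))\<bar> \<le> \<epsilon>" using off[OF piS ppiS] ppi by auto
      show "(\<Prod>j\<in>S - {i} - {p i}. \<bar>A j (p j)\<bar>) \<le> 1"
        using le1 p(1) by (intro prod_le_1) (auto simp: permutes_in_image)
    qed (use eps in \<open>auto intro!: mult_nonneg_nonneg prod_nonneg\<close>)
    finally show "\<bar>?t p\<bar> \<le> \<epsilon>\<^sup>2"
      by (simp add: abs_mult power2_eq_square flip: of_int_abs)
  qed
  also have "\<dots> \<le> (\<Sum>p\<in>?P. \<epsilon>\<^sup>2)" by (rule sum_mono2[OF finP]) auto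
  also have "\<dots> = fact (card S) * \<epsilon>\<^sup>2" using card_permutations[OF refl fin] by simp
  finally have 1: "\<bar>sum ?t (?P - {id})\<bar> \<le> fact (card S) * \<epsilon>\<^sup>2" .
  have lower: "1 - sum a S \<le> (\<Prod>i\<in>S. 1 - a i)"
    by (rule Weierstrass_prod_ineq) (use a in auto)
  have s0: "sum a S \<ge> 0" using a by (simp add: sum_nonneg)
  have "(\<Prod>i\<in>S. 1 - a i) \<le> (\<Prod>i\<in>S. exp (- a i))"
  proof (rule prod_mono)
    fix i assume "i \<in> S"
    then show "0 \<le> 1 - a i \<and> 1 - a i \<le> exp (- a i)"
      using a[of i] exp_ge_add_one_self[of "- a i"] by auto
  qed
  also have "\<dots> = exp (- sum a S)" using exp_sum[OF fin, of "\<lambda>i. - a i"] by (simp add: sum_negf)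
  also have "\<dots> \<le> 1 / (1 + sum a S)"
  proof -
    have "1 + sum a S \<le> exp (sum a S)" by (rule exp_ge_add_one_self)
    then show ?thesis using s0 by (simp add: exp_minus field_simps)
  qed
  also have "\<dots> \<le> 1 - sum a S + (sum a S)\<^sup>2"
  proof -
    have "1 \<le> (1 - sum a S + (sum a S)\<^sup>2) * (1 + sum a S)"
      using s0 by (simp add: algebra_simps power2_eq_square)
    then show ?thesis using s0 by (simp add: pos_divide_le_eq)
  qed
  finally have upper: "(\<Prod>i\<in>S. 1 - a i) \<le> 1 - sum a S + (sum a S)\<^sup>2" .
  show ?thesis using split 1 lower upper by (simp add: abs_le_iff)
qed

section \<open>Block structure of the determinant of a local event\<close>

section \<open>Local events\<close>

text \<open>Distinct \<open>k\<close>-sets lie in at most one common set of size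
  \<open>k + 1\<close>, their union, so at most one term is nonzero.\<close>

lemma abs_sum_inc_inc_le_one:
  assumes "finite F" "\<And>X. X \<in> F \<Longrightarrow> card X = k + 1" "x \<noteq> y" "card x = k" "card y = k"
  shows "\<bar>\<Sum>X\<in>F. inc x X * inc y X :: real\<bar> \<le> 1"
proof -
  have uniq: "X = x \<union> y" if X: "X \<in> F" "inc x X * inc y X \<noteq> (0::real)" for X
  proof -
    have nz: "inc x X \<noteq> (0::real)" "inc y X \<noteq> (0::real)" using X by auto
    have fX: "finite X" using nz(1) by (rule inc_nonzeroD)
    have sub: "x \<subseteq> X" "y \<subseteq> X" using nz inc_nonzero_subset by blast+
    then have fin: "finite x" "finite y" using fX by (auto intro: finite_subset)
    have "x \<subset> x \<union> y"
    proof
      show "x \<noteq> x \<union> y"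
      proof
        assume "x = x \<union> y"
        then have "y \<subseteq> x" by auto
        then have "y = x" using fin assms(4,5) by (simp add: card_subset_eq)
        then show False using assms(3) by simp
      qed
    qed auto
    then have "k < card (x \<union> y)" using fin assms(4) by (metis finite_UnI psubset_card_mono)
    moreover have "card (x \<union> y) \<le> card X" using sub fX by (intro card_mono) auto
    ultimately have "card (x \<union> y) = card X" using assms(2)[OF X(1)] by simp
    then show ?thesis using sub fX by (intro card_subset_eq[symmetric]) auto
  qed
  have "(\<Sum>X\<in>F. inc x X * inc y X :: real) = (\<Sum>X\<in>F \<inter> {x \<union> y}. inc x X * inc y X)"
    using assms(1) uniq by (intro sum.mono_neutral_right) auto
  also have "\<bar>\<dots>\<bar> \<le> 1"
  proof (cases "x \<union> y \<in> F")
    case True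
    then show ?thesis
      using abs_inc_le_one[of x "x \<union> y"] abs_inc_le_one[of y "x \<union> y"]
      by (simp add: abs_mult mult_le_one)
  qed simp
  finally show ?thesis .
qed

text \<open>\<open>B\<close> stands for the \<open>k\<close>-sets of a copy at distance less than
  \<open>r\<close> from the root, \<open>A\<close> for its facets, \<open>U\<close> for a vertex set
  containing all of them. The estimates see \<open>U\<close> only through its size, so it may be
  larger than the copy. By the last assumption every facet of \<open>A\<close> is among those
  constrained through \<open>B\<close>.\<close>

locale facet_config =
  fixes n k :: nat and U :: "nat set" and A B :: "nat set set"
  assumes k: "k \<ge> 1" and n: "n \<ge> 2" and U: "U \<subseteq> {1..n}"
    and B: "B \<subseteq> nsets U k" and A: "A \<subseteq> nsets U (k + 1)"
    and AB: "\<And>X. X \<in> A \<Longrightarrow> \<exists>Y\<in>B. Y \<subseteq> X"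
begin

abbreviation "S \<equiv> nsets {1..n} k"
abbreviation "T \<equiv> nsets {1..n} (k + 1)"

definition "N = {X \<in> T. \<exists>Y\<in>B. Y \<subseteq> X}"

text \<open>The upper Laplacian on \<open>k\<close>-sets; \<open>\<theta>\<close> below is its part
  over the constrained facets \<open>N\<close>.\<close>

definition L :: "nat set \<Rightarrow> nat set \<Rightarrow> real" where "L x y = (\<Sum>X\<in>T. inc x X * inc y X)"

definition \<theta> :: "nat set \<Rightarrow> nat set \<Rightarrow> real" where "\<theta> x y = (\<Sum>X\<in>N. inc x X * inc y X)"

text \<open>The local matrix after the change of basis: entries between two \<open>k\<close>-sets
  vanish once one of them is in \<open>B\<close>, while entries between \<open>B\<close> and
  \<open>A\<close> survive unchanged.\<close>

definition M :: "nat set \<Rightarrow> nat set \<Rightarrow> real" where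
  "M x y = (if x \<in> S \<and> y \<in> S \<and> (x \<in> B \<or> y \<in> B) then 0 else local_matrix n k N A x y)"

text \<open>The limit of \<open>M\<close> on the bounded index set after its rows in
  \<open>A\<close> are multiplied by \<open>n\<close>. Apart from the diagonal it is
  skew-symmetric.\<close>

definition D0 :: "nat set \<Rightarrow> nat set \<Rightarrow> real" where
  "D0 x y = (if x \<in> S then
       if y \<in> S then (if x = y \<and> x \<notin> B then 1 else 0)
       else if y \<in> A then inc x y else 0
     else if y \<in> S then - inc y x else 0)"

lemma finU: "finite U" using U by (rule finite_subset) simp

lemma fin [simp]: "finite S" "finite T" "finite A" "finite B" "finite N" "finite (nsets U j)"
proof -
  show "finite S" "finite T" by (simp_all add: finite_imp_finite_nsets)
  show "finite (nsets U j)" for j using finU by (simp add: finite_imp_finite_nsets)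
  then show "finite A" "finite B" using A B by (meson finite_subset)+
  show "finite N" using \<open>finite T\<close> by (simp add: N_def)
qed

lemma n0: "real n > 0" using n by simp

lemma US: "nsets U k \<subseteq> S" and UT: "nsets U (k + 1) \<subseteq> T"
  using U by (simp_all add: nsets_mono)

lemma BS: "B \<subseteq> S" using B US by blast

lemma AN: "A \<subseteq> N" and NT: "N \<subseteq> T" using A UT AB by (auto simp: N_def)

lemma S_dest: "x \<in> S \<Longrightarrow> x \<subseteq> {1..n} \<and> finite x \<and> card x = k" by (simp add: nsets_def)

lemma T_dest: "X \<in> T \<Longrightarrow> X \<subseteq> {1..n} \<and> finite X \<and> card X = k + 1" by (simp add: nsets_def)

lemma B_dest: "x \<in> B \<Longrightarrow> x \<subseteq> U \<and> finite x \<and> card x = k" using B by (auto simp: nsets_def)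

lemma A_dest: "x \<in> A \<Longrightarrow> x \<subseteq> U \<and> finite x \<and> card x = k + 1" using A by (auto simp: nsets_def)

lemma ST: "S \<inter> T = {}" by (auto simp: nsets_def)

lemma SA: "S \<inter> A = {}" using ST AN NT by blast

lemma sum_S: "(\<Sum>x\<in>S. f x) = (\<Sum>x\<in>Pow {1..n}. f x)"
  if "\<And>x. x \<subseteq> {1..n} \<Longrightarrow> f x \<noteq> (0::real) \<Longrightarrow> card x = k"
  using that by (intro sum_Pow_restrict_nsets[symmetric]) auto

lemma L_sym: "L x y = L y x" by (simp add: L_def mult.commute)

lemma L_inc:
  assumes "y \<in> S" "X \<in> T"
  shows "(\<Sum>l\<in>S. L y l * inc l X) = real n * inc y X"
proof -
  have "(\<Sum>l\<in>S. L y l * inc l X) = (\<Sum>l\<in>Pow {1..n}. L y l * inc l X)"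
    using T_dest[OF assms(2)] by (intro sum_S) (auto dest!: inc_nonzero_card)
  also have "\<dots> = (\<Sum>l\<in>Pow {1..n}. (\<Sum>X'\<in>Pow {1..n}. inc y X' * inc l X') * inc l X)"
    unfolding L_def using S_dest[OF assms(1)]
    by (intro sum.cong refl arg_cong2[where f="(*)"] sum_Pow_restrict_nsets[symmetric])
      (auto dest!: inc_nonzero_card)
  also have "\<dots> = real n * inc y X"
    using inc_Laplacian_inc[of "{1..n}" y X, where 'b=real] S_dest[OF assms(1)] T_dest[OF assms(2)]
    by simp
  finally show ?thesis .
qed

lemma inc_B_N: "y \<in> B \<Longrightarrow> X \<in> T \<Longrightarrow> inc y X \<noteq> (0::real) \<Longrightarrow> X \<in> N"
  using inc_nonzero_subset by (auto simp: N_def)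

text \<open>All facets containing \<open>y\<close> in \<open>B\<close> belong to \<open>N\<close>,
  so restricting the Laplacian to \<open>N\<close> loses nothing against column \<open>y\<close>,
  and boundaries are eigenvectors for \<open>n\<close>. Thus the columns of \<open>L\<close> in
  \<open>B\<close> are null vectors of \<open>I - \<theta> / n\<close>.\<close>

lemma theta_L:
  assumes "x \<in> S" "y \<in> B"
  shows "(\<Sum>l\<in>S. \<theta> x l * L l y) = real n * L x y"
proof -
  have yS: "y \<in> S" using assms BS by auto
  have "(\<Sum>l\<in>S. \<theta> x l * L l y) = (\<Sum>l\<in>S. \<Sum>X\<in>N. inc x X * (L y l * inc l X))"
  proof (intro sum.cong refl)
    fix l
    show "\<theta> x l * L l y = (\<Sum>X\<in>N. inc x X * (L y l * inc l X))"
      unfolding \<theta>_def sum_distrib_right L_sym[of l y] by (simp only: mult_ac)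
  qed
  also have "\<dots> = (\<Sum>X\<in>N. inc x X * (\<Sum>l\<in>S. L y l * inc l X))"
    by (subst sum.swap) (simp add: sum_distrib_left)
  also have "\<dots> = (\<Sum>X\<in>N. inc x X * (real n * inc y X))"
    using L_inc[OF yS] NT by (intro sum.cong refl) (auto simp: subset_iff)
  also have "\<dots> = (\<Sum>X\<in>T. inc x X * (real n * inc y X))"
    using NT inc_B_N[OF assms(2)] by (intro sum.mono_neutral_left) auto
  finally show ?thesis by (simp add: L_def sum_distrib_left mult_ac)
qed

lemma local_matrix_SS:
  "x \<in> S \<Longrightarrow> y \<in> S \<Longrightarrow> local_matrix n k N A x y = (if x = y then 1 else 0) - \<theta> x y / real n"
  by (simp add: local_matrix_def \<theta>_def)

text \<open>The columns of the Laplacian \<open>L\<close> indexed by \<open>B\<close> span the kernel of the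
  restricted operator, so a change of basis clears the rows and columns in \<open>B\<close>.\<close>

lemma fdet_local_matrix:
  "(fdet B (\<lambda>x y. L x y / real n))\<^sup>2 * fdet (S \<union> A) (local_matrix n k N A) = fdet (S \<union> A) M"
proof -
  let ?M = "local_matrix n k N A"
  \<comment> \<open>Basis vectors in \<open>B\<close> are replaced by the null vectors. The factor
    \<open>1/n\<close> keeps the determinant of the substitution close to 1.\<close>
  define C where "C x y = (if y \<in> B then if x \<in> S then L x y / real n else 0
    else if x = y then 1 else 0)" for x y
  define P where "P x y = (\<Sum>l\<in>S \<union> A. ?M x l * C l y)" for x y
  have finSA: "finite (S \<union> A)" by simp
  have notS: "x \<notin> S" if "x \<in> A" for x using that SA by auto
  have SS0: "(\<Sum>l\<in>S. ?M x l * L l y) = 0" if "x \<in> S" "y \<in> B" for x y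
  proof -
    have "(\<Sum>l\<in>S. ?M x l * L l y) = (\<Sum>l\<in>S. (if l = x then L x y else 0) - \<theta> x l * L l y / real n)"
      using that by (intro sum.cong refl) (auto simp: local_matrix_SS left_diff_distrib)
    also have "\<dots> = L x y - (\<Sum>l\<in>S. \<theta> x l * L l y) / real n"
      using that by (simp add: sum_subtractf sum_divide_distrib)
    finally show ?thesis using theta_L[OF that] n0 by simp
  qed
  have P1: "P x y = ?M x y" if "y \<in> S \<union> A" "y \<notin> B" for x y
  proof -
    have "P x y = (\<Sum>l\<in>S \<union> A. if l = y then ?M x y else 0)"
      unfolding P_def using that by (intro sum.cong refl) (auto simp: C_def)
    then show ?thesis using that finSA by simp
  qed
  have P2: "P x y = (\<Sum>l\<in>S. ?M x l * L l y) / real n" if "y \<in> B" for x y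
  proof -
    have "P x y = (\<Sum>l\<in>S. ?M x l * (L l y / real n))"
      unfolding P_def using that notS finSA by (intro sum.mono_neutral_cong_right) (auto simp: C_def)
    then show ?thesis by (simp add: sum_divide_distrib)
  qed
  have P3: "P x y = 0" if "x \<in> S" "y \<in> B" for x y using P2[OF that(2)] SS0[OF that] by simp
  have LA: "(\<Sum>l\<in>S. L y l * inc l x) = real n * inc y x" if "x \<in> A" "y \<in> B" for x y
    using L_inc that AN NT BS by blast
  have P4: "P x y = - inc y x / real n" if "x \<in> A" "y \<in> B" for x y
  proof -
    have "(\<Sum>l\<in>S. ?M x l * L l y) = - (\<Sum>l\<in>S. L y l * inc l x) / real n"
      using notS[OF that(1)] by (simp add: local_matrix_def sum_negf sum_divide_distrib L_sym mult_ac)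
    then show ?thesis using P2[OF that(2)] LA[OF that] n0 by simp
  qed
  \<comment> \<open>\<open>M\<close> is the local matrix transformed by \<open>C\<close> on the
    right and its transpose on the left. The incidence entries between \<open>B\<close> and
    \<open>A\<close> return unchanged, since \<open>L / n\<close> fixes boundaries.\<close>
  have Q: "(\<Sum>l\<in>S \<union> A. C l x * P l y) = M x y" if x: "x \<in> S \<union> A" and y: "y \<in> S \<union> A" for x y
  proof (cases "x \<in> B")
    case False
    have "(\<Sum>l\<in>S \<union> A. C l x * P l y) = (\<Sum>l\<in>S \<union> A. if l = x then P x y else 0)"
      using False by (intro sum.cong refl) (auto simp: C_def)
    also have "\<dots> = P x y" using x finSA by simp
    also have "\<dots> = M x y"
    proof (cases "y \<in> B")
      case True
      then have "y \<in> S" using BS by auto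
      then show ?thesis using True x P3[of x y] P4[of x y] notS[of x]
        by (auto simp: M_def local_matrix_def)
    next
      case False
      then show ?thesis using P1[OF y] \<open>x \<notin> B\<close> by (simp add: M_def)
    qed
    finally show ?thesis .
  next
    case True
    then have xS: "x \<in> S" using BS by auto
    have "(\<Sum>l\<in>S \<union> A. C l x * P l y) = (\<Sum>l\<in>S. L l x / real n * P l y)"
      using True notS finSA by (intro sum.mono_neutral_cong_right) (auto simp: C_def)
    also have "\<dots> = M x y"
    proof (cases "y \<in> B")
      case True
      then have "y \<in> S" using BS by auto
      then show ?thesis using True xS by (simp add: P3 M_def)
    next
      case notB: False
      show ?thesis
      proof (cases "y \<in> S")
        case yS: True
        have "(\<Sum>l\<in>S. L l x / real n * P l y) = (\<Sum>l\<in>S. ?M y l * L l x) / real n"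
          unfolding sum_divide_distrib
        proof (intro sum.cong refl)
          fix l assume "l \<in> S"
          then show "L l x / real n * P l y = ?M y l * L l x / real n"
            using P1[OF y notB] yS by (auto simp: local_matrix_SS \<theta>_def mult_ac)
        qed
        also have "\<dots> = 0" using SS0[OF yS True] by simp
        finally show ?thesis using True xS yS by (simp add: M_def)
      next
        case False
        then have yA: "y \<in> A" using y by auto
        have "(\<Sum>l\<in>S. L l x / real n * P l y) = (\<Sum>l\<in>S. L x l * inc l y) / real n"
          unfolding sum_divide_distrib
        proof (intro sum.cong refl)
          fix l assume "l \<in> S"
          then show "L l x / real n * P l y = L x l * inc l y / real n"
            using P1[OF y notB] yA False by (auto simp: local_matrix_def L_sym)
        qed
        also have "\<dots> = inc x y" using LA[OF yA True] n0 by simp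
        finally show ?thesis using xS yA False by (simp add: M_def local_matrix_def)
      qed
    qed
    finally show ?thesis .
  qed
  have SAeq: "S \<union> A = B \<union> (S \<union> A - B)" using BS by auto
  have "fdet (S \<union> A) C = fdet (B \<union> (S \<union> A - B)) C" using SAeq by simp
  also have "\<dots> = fdet B C * fdet (S \<union> A - B) C"
    by (intro fdet_block) (auto simp: C_def)
  also have "fdet B C = fdet B (\<lambda>x y. L x y / real n)"
    by (rule fdet_cong) (use BS in \<open>auto simp: C_def\<close>)
  also have "fdet (S \<union> A - B) C = fdet (S \<union> A - B) (\<lambda>x y. if x = y then 1 else 0)"
    by (rule fdet_cong) (auto simp: C_def)
  finally have C: "fdet (S \<union> A) C = fdet B (\<lambda>x y. L x y / real n)" by (simp add: fdet_identity)
  have "fdet (S \<union> A) M = fdet (S \<union> A) (\<lambda>x y. \<Sum>l\<in>S \<union> A. C l x * P l y)"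
    by (rule fdet_cong[OF refl]) (simp only: Q)
  also have "\<dots> = fdet (S \<union> A) (\<lambda>x l. C l x) * fdet (S \<union> A) P"
    by (rule fdet_mult[OF finSA])
  also have "fdet (S \<union> A) P = fdet (S \<union> A) ?M * fdet (S \<union> A) C"
    unfolding P_def by (rule fdet_mult[OF finSA])
  also have "fdet (S \<union> A) (\<lambda>x l. C l x) = fdet (S \<union> A) C"
    by (rule fdet_transpose[OF finSA])
  finally show ?thesis unfolding C by (simp add: power2_eq_square)
qed

lemma N_outside:
  assumes "X \<in> N"
  shows "card (X - U) \<le> 1"
proof -
  obtain b where b: "b \<in> B" "b \<subseteq> X" using assms by (auto simp: N_def)
  have X: "finite X" "card X = k + 1" using assms T_dest NT by blast+
  have "card (X - b) = 1" using X b B_dest[OF b(1)] by (simp add: card_Diff_subset)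
  moreover have "X - U \<subseteq> X - b" using B_dest[OF b(1)] by auto
  ultimately show ?thesis using X by (metis card_mono finite_Diff)
qed

text \<open>A constrained facet contains some \<open>b\<close> of \<open>B\<close> inside
  \<open>U\<close>. A \<open>k\<close>-face that omitted a vertex outside \<open>U\<close> would
  have to be that \<open>b\<close>, which is excluded; so leaving a facet through a face outside
  \<open>B\<close> never loses its outside vertex.\<close>

lemma N_outside_cases:
  assumes X: "X \<in> N" and x: "x \<in> S" "x \<notin> B" "x \<subseteq> X"
  shows "x - U = X - U"
proof -
  obtain b where b: "b \<in> B" "b \<subseteq> X" using X by (auto simp: N_def)
  have fX: "finite X" "card X = k + 1" using X T_dest NT by blast+
  show ?thesis
  proof (rule ccontr)
    assume "x - U \<noteq> X - U"
    then obtain v where v: "v \<in> X" "v \<notin> U" "v \<notin> x" using x(3) by auto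
    have "card (X - {v}) = k" using v fX by simp
    moreover have "x \<subseteq> X - {v}" "b \<subseteq> X - {v}" using x(3) b v B_dest[OF b(1)] by auto
    ultimately have "x = X - {v}" "b = X - {v}"
      using card_subset_eq[of "X - {v}"] fX S_dest[OF x(1)] B_dest[OF b(1)] by auto
    then show False using x(2) b(1) by simp
  qed
qed

lemma theta_nonzeroD:
  assumes "\<theta> x y \<noteq> 0" "x \<in> S" "y \<in> S" "x \<notin> B" "y \<notin> B"
  shows "x - U = y - U" "card (x - U) \<le> 1"
proof -
  obtain X where "X \<in> N" "inc x X * inc y X \<noteq> (0::real)"
    using assms(1) unfolding \<theta>_def by (meson sum.neutral)
  then have "X \<in> N" "x \<subseteq> X" "y \<subseteq> X" using inc_nonzero_subset by (metis mult_eq_0_iff)+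
  then show "x - U = y - U" "card (x - U) \<le> 1"
    using N_outside_cases[of X x] N_outside_cases[of X y] N_outside[of X] assms by auto
qed

abbreviation "block v \<equiv> {x \<in> S. x - U = {v}}"

text \<open>The key of an index is its part outside \<open>U\<close>, which is constant along
  nonzero entries. Sets with at least two outside vertices lie in no constrained facet and give
  identity blocks; the empty key collects everything inside \<open>U\<close>.\<close>

lemma fdet_M_blocks:
  "fdet (S \<union> A) M = fdet (nsets U k \<union> A) M * (\<Prod>v\<in>{1..n} - U. fdet (block v) M)"
proof -
  let ?K = "Pow ({1..n} - U)" and ?b = "\<lambda>c. {x \<in> S \<union> A. x - U = c}"
  have A0: "x - U = {}" if "x \<in> A" for x using A_dest[OF that] by auto
  have B0: "x - U = {}" if "x \<in> B" for x using B_dest[OF that] by auto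
  have "fdet (S \<union> A) M = (\<Prod>c\<in>?K. fdet (?b c) M)"
  proof (rule fdet_block_keys)
    show "(\<lambda>x. x - U) ` (S \<union> A) \<subseteq> ?K"
      using S_dest A_dest U by fastforce
    fix x y assume xy: "x \<in> S \<union> A" "y \<in> S \<union> A" "x - U \<noteq> y - U"
    show "M x y = 0"
    proof (cases "x \<in> S \<and> y \<in> S")
      case True
      then show ?thesis
        using xy theta_nonzeroD[of x y] by (auto simp: M_def local_matrix_SS)
    next
      case False
      have "inc x y = (0::real)" if "y \<in> A"
        using inc_nonzero_subset[of x y] A0[OF that] xy by auto
      moreover have "inc y x = (0::real)" if "x \<in> A"
        using inc_nonzero_subset[of y x] A0[OF that] xy by auto
      ultimately show ?thesis using False xy by (auto simp: M_def local_matrix_def)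
    qed
  qed auto
  also have "\<dots> = (\<Prod>c\<in>insert {} ((\<lambda>v. {v}) ` ({1..n} - U)). fdet (?b c) M)"
  proof (rule prod.mono_neutral_right)
    show "\<forall>c\<in>?K - insert {} ((\<lambda>v. {v}) ` ({1..n} - U)). fdet (?b c) M = 1"
    proof
      fix c assume c: "c \<in> ?K - insert {} ((\<lambda>v. {v}) ` ({1..n} - U))"
      then have "finite c" "c \<noteq> {}" "\<And>v. c \<noteq> {v}" by (auto intro: finite_subset)
      then have card: "\<not> card c \<le> 1"
        by (metis One_nat_def card_0_eq card_1_singletonE le_SucE le_zero_eq)
      have "fdet (?b c) M = fdet (?b c) (\<lambda>x y. if x = y then 1 else 0)"
      proof (rule fdet_cong[OF refl])
        fix x y assume xy: "x \<in> ?b c" "y \<in> ?b c"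
        then have *: "x \<in> S" "y \<in> S" "x \<notin> B" "y \<notin> B" using A0 B0 \<open>c \<noteq> {}\<close> by auto
        have "\<theta> x y = 0" using theta_nonzeroD(2)[OF _ *] card xy by auto
        then show "M x y = (if x = y then 1 else 0)" using * by (simp add: M_def local_matrix_SS)
      qed
      then show "fdet (?b c) M = 1" by (simp add: fdet_identity)
    qed
  qed auto
  also have "\<dots> = fdet (?b {}) M * (\<Prod>v\<in>{1..n} - U. fdet (?b {v}) M)"
    by (subst prod.insert) (auto simp: prod.reindex inj_on_def)
  also have "?b {} = nsets U k \<union> A"
    using US A0 by (auto simp: nsets_def)
  also have "(\<Prod>v\<in>{1..n} - U. fdet (?b {v}) M) = (\<Prod>v\<in>{1..n} - U. fdet (block v) M)"
    using A0 by (intro prod.cong fdet_cong) auto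
  finally show ?thesis .
qed

section \<open>Size of the blocks and of their entries\<close>

lemma theta_diag: "x \<in> S \<Longrightarrow> \<theta> x x = real (card {X \<in> N. x \<subseteq> X})"
proof -
  assume x: "x \<in> S"
  have "\<theta> x x = (\<Sum>X\<in>{X \<in> N. x \<subseteq> X}. 1)"
    unfolding \<theta>_def
  proof (rule sum.mono_neutral_cong_right)
    show "\<forall>X\<in>N - {X \<in> N. x \<subseteq> X}. inc x X * inc x X = (0::real)"
      using inc_nonzero_subset by fastforce
    fix X assume "X \<in> {X \<in> N. x \<subseteq> X}"
    then have "X \<in> T" "x \<subseteq> X" using NT by auto
    then have "inc x X \<noteq> (0::real)" using T_dest S_dest[OF x] by (subst inc_nonzero_iff) auto
    then show "inc x X * inc x X = (1::real)" using inc_cases_real[of x X] by auto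
  qed auto
  then show ?thesis by simp
qed

lemma theta_off_diag: "x \<in> S \<Longrightarrow> y \<in> S \<Longrightarrow> x \<noteq> y \<Longrightarrow> \<bar>\<theta> x y\<bar> \<le> 1"
  unfolding \<theta>_def using NT T_dest S_dest by (intro abs_sum_inc_inc_le_one[of _ k]) auto

text \<open>A coface of \<open>x\<close> is determined by its one additional vertex.\<close>

lemma card_supersets_le:
  assumes "finite W" "x \<in> S" "\<And>X. X \<in> F \<Longrightarrow> X \<in> T \<and> x \<subseteq> X \<and> X \<subseteq> W \<union> x"
  shows "card F \<le> card W"
proof -
  have "F \<subseteq> (\<lambda>v. insert v x) ` W"
  proof
    fix X assume "X \<in> F"
    then have X: "X \<in> T" "x \<subseteq> X" "X \<subseteq> W \<union> x" using assms(3) by auto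
    then have "card (X - x) = 1" using T_dest S_dest[OF assms(2)] by (simp add: card_Diff_subset)
    then obtain v where "X - x = {v}" by (auto simp: card_1_singleton_iff)
    then have "X = insert v x" "v \<in> W" using X by auto
    then show "X \<in> (\<lambda>v. insert v x) ` W" by auto
  qed
  then have "card F \<le> card ((\<lambda>v. insert v x) ` W)" using assms(1) by (intro card_mono) auto
  also have "\<dots> \<le> card W" by (rule card_image_le[OF assms(1)])
  finally show ?thesis .
qed

lemma theta_diag_bounds: "x \<in> S \<Longrightarrow> 0 \<le> \<theta> x x \<and> \<theta> x x \<le> real n"
  using card_supersets_le[of "{1..n}" x "{X \<in> N. x \<subseteq> X}"] NT T_dest
  by (auto simp: theta_diag)

text \<open>Removing \<open>v\<close> leaves an arbitrary \<open>(k - 1)\<close>-subset of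
  \<open>U\<close>, so the block size does not grow with \<open>n\<close>.\<close>

lemma card_block:
  assumes "v \<in> {1..n} - U"
  shows "card (block v) = card U choose (k - 1)"
proof -
  have "bij_betw (insert v) (nsets U (k - 1)) (block v)"
  proof (rule bij_betw_byWitness[where f' = "\<lambda>x. x - {v}"])
    show "\<forall>Z\<in>nsets U (k - 1). insert v Z - {v} = Z"
      using assms by (auto simp: nsets_def)
    show "\<forall>x\<in>block v. insert v (x - {v}) = x" by auto
    show "insert v ` nsets U (k - 1) \<subseteq> block v"
      using assms U k by (fastforce simp: nsets_def card_insert_if)
    show "(\<lambda>x. x - {v}) ` block v \<subseteq> nsets U (k - 1)"
      by (auto simp: nsets_def card_Diff_singleton_if)
  qed
  then show ?thesis using bij_betw_same_card by fastforce
qed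

text \<open>Double counting: the constrained facets with a face in the block of \<open>v\<close> are
  the sets \<open>insert v b\<close> for \<open>b\<close> in \<open>B\<close>, and each of them has
  exactly \<open>k\<close> faces of size \<open>k\<close> that contain \<open>v\<close>. This trace
  becomes the exponent of the limit.\<close>

lemma sum_theta_block:
  assumes v: "v \<in> {1..n} - U"
  shows "(\<Sum>x\<in>block v. \<theta> x x) = real (k * card B)"
proof -
  have "(\<Sum>x\<in>block v. \<theta> x x) = (\<Sum>X\<in>N. \<Sum>x\<in>block v. inc x X * inc x X)"
    unfolding \<theta>_def by (rule sum.swap)
  also have "\<dots> = (\<Sum>X\<in>insert v ` B. \<Sum>x\<in>block v. inc x X * inc x X)"
  proof (rule sum.mono_neutral_right)
    show "insert v ` B \<subseteq> N"
      using v B_dest U by (fastforce simp: N_def nsets_def card_insert_if)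
    show "\<forall>X\<in>N - insert v ` B. (\<Sum>x\<in>block v. inc x X * inc x X) = (0::real)"
    proof (safe, rule ccontr)
      fix X assume X: "X \<in> N" "X \<notin> insert v ` B" "(\<Sum>x\<in>block v. inc x X * inc x X) \<noteq> (0::real)"
      then obtain x where "x \<in> block v" "inc x X * inc x X \<noteq> (0::real)" by (meson sum.neutral)
      then have x: "x \<in> S" "x - U = {v}" "x \<subseteq> X" using inc_nonzero_subset by fastforce+
      then have vX: "v \<in> X" by auto
      obtain b where b: "b \<in> B" "b \<subseteq> X" using X by (auto simp: N_def)
      have "insert v b \<subseteq> X" "card (insert v b) = card X" "finite X"
        using b vX v B_dest[OF b(1)] T_dest[of X] X(1) NT by (auto simp: card_insert_if)
      then have "X = insert v b" by (intro card_subset_eq[symmetric]) auto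
      then show False using X(2) b(1) by auto
    qed
  qed simp
  also have "\<dots> = (\<Sum>b\<in>B. \<Sum>x\<in>block v. inc x (insert v b) * inc x (insert v b))"
  proof (subst sum.reindex)
    show "inj_on (insert v) B"
    proof (rule inj_onI)
      fix x y assume "x \<in> B" "y \<in> B" "insert v x = insert v y"
      moreover from this have "v \<notin> x" "v \<notin> y" using v B_dest by auto
      ultimately show "x = y" by (simp add: insert_ident)
    qed
  qed simp
  also have "\<dots> = (\<Sum>b\<in>B. real k)"
  proof (rule sum.cong[OF refl])
    fix b assume b: "b \<in> B"
    have vb: "v \<notin> b" using v B_dest[OF b] by auto
    let ?f = "\<lambda>y. insert v (b - {y})"
    have "(\<Sum>x\<in>block v. inc x (insert v b) * inc x (insert v b)) = (\<Sum>x\<in>?f ` b. 1::real)"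
    proof (rule sum.mono_neutral_cong_right)
      show "?f ` b \<subseteq> block v"
      proof
        fix x assume "x \<in> ?f ` b"
        then obtain y where y: "y \<in> b" "x = ?f y" by auto
        have bk: "card b = k" "finite b" "b \<subseteq> U" using B_dest[OF b] by auto
        then have "card x = k" using y vb k by (simp add: card_insert_if)
        moreover have "x \<subseteq> {1..n}" "finite x" "x - U = {v}" using y bk U v by auto
        ultimately show "x \<in> block v" by (simp add: nsets_def)
      qed
      show "\<forall>x\<in>block v - ?f ` b. inc x (insert v b) * inc x (insert v b) = (0::real)"
      proof (safe, rule ccontr)
        fix x assume x: "x \<in> S" "x - U = {v}" "x \<notin> ?f ` b"
          "inc x (insert v b) * inc x (insert v b) \<noteq> (0::real)"
        then have "inc x (insert v b) \<noteq> (0::real)" by auto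
        then obtain y where y: "y \<notin> x" "insert v b = insert y x" by (rule inc_nonzeroD)
        have "y \<in> b" "x = ?f y" using y x(2) vb by auto
        then show False using x(3) by auto
      qed
      fix x assume "x \<in> ?f ` b"
      then obtain y where y: "y \<in> b" "x = ?f y" by auto
      have "inc x (insert y x) * inc x (insert y x) = (1::real)"
        using y v vb B_dest[OF b] by (intro inc_square) auto
      moreover have "insert y x = insert v b" using y by auto
      ultimately show "inc x (insert v b) * inc x (insert v b) = (1::real)" by simp
    qed simp
    moreover have "inj_on ?f b" using vb by (auto simp: inj_on_def)
    ultimately show "(\<Sum>x\<in>block v. inc x (insert v b) * inc x (insert v b)) = real k"
      using B_dest[OF b] by (simp add: card_image)
  qed
  finally show ?thesis by simp
qed

text \<open>Off-diagonal entries are at most \<open>1 / n\<close> and the trace defect is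
  \<open>k * card B / n\<close>, so the second-order expansion leaves an error that stays negligible
  after multiplication over about \<open>n\<close> vertices.\<close>

lemma fdet_block_estimate:
  assumes v: "v \<in> {1..n} - U"
  shows "\<bar>fdet (block v) M - (1 - real (k * card B) / real n)\<bar>
    \<le> (fact (card U choose (k - 1)) + (real (k * card B))\<^sup>2) / (real n)\<^sup>2"
proof -
  have notB: "x \<notin> B" if "x \<in> block v" for x using B_dest that by auto
  have M: "M x y = (if x = y then 1 else 0) - \<theta> x y / real n" if "x \<in> block v" "y \<in> block v" for x y
    using that notB by (simp add: M_def local_matrix_SS)
  have "\<bar>fdet (block v) M - (1 - (\<Sum>x\<in>block v. \<theta> x x / real n))\<bar>
    \<le> fact (card (block v)) * (1 / real n)\<^sup>2 + (\<Sum>x\<in>block v. \<theta> x x / real n)\<^sup>2"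
  proof (rule fdet_near_identity)
    show "1 / real n \<le> 1" using n by simp
    fix x assume x: "x \<in> block v"
    show "M x x = 1 - \<theta> x x / real n" using M[OF x x] by simp
    show "0 \<le> \<theta> x x / real n \<and> \<theta> x x / real n \<le> 1" using theta_diag_bounds[of x] x n0 by simp
  next
    fix x y assume "x \<in> block v" "y \<in> block v" "x \<noteq> y"
    then show "\<bar>M x y\<bar> \<le> 1 / real n"
      using M[of x y] theta_off_diag[of x y] n0 by (simp add: divide_right_mono)
  qed auto
  also have "(\<Sum>x\<in>block v. \<theta> x x / real n) = real (k * card B) / real n"
    using sum_theta_block[OF v] by (simp add: sum_divide_distrib[symmetric])
  finally show ?thesis
    unfolding card_block[OF v] by (simp add: power_divide add_divide_distrib)
qed

text \<open>The factors \<open>1 / n\<close> that matter sit in the rows of \<open>A\<close>, and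
  multiplying these rows by \<open>n\<close> gives a finite limit. The remaining deviation from
  \<open>D0\<close> is \<open>\<theta> / n\<close> on \<open>k\<close>-subsets of \<open>U\<close>
  outside \<open>B\<close>.\<close>

lemma fdet_core_estimate:
  "\<bar>real n ^ card A * fdet (nsets U k \<union> A) M - fdet (nsets U k \<union> A) D0\<bar> \<le>
    fact ((card U choose k) + card A) *
      (real ((card U choose k) + card A) * (real (card U + 1) / real n))"
proof -
  let ?Q = "nsets U k \<union> A"
  define M' where "M' x y = (if x \<in> A then real n else 1) * M x y" for x y
  have notS: "x \<notin> S" if "x \<in> A" for x using that SA by auto
  have cQ: "card ?Q = (card U choose k) + card A"
    using SA US by (subst card_Un_disjoint) auto
  have "fdet ?Q M' = (\<Prod>x\<in>?Q. if x \<in> A then real n else 1) * fdet ?Q M"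
    unfolding M'_def by (rule fdet_scale_rows)
  also have "(\<Prod>x\<in>?Q. if x \<in> A then real n else 1) = (\<Prod>x\<in>A. real n)"
    by (intro prod.mono_neutral_cong_right) auto
  finally have scale: "real n ^ card A * fdet ?Q M = fdet ?Q M'" by simp
  \<comment> \<open>Constrained cofaces of such an \<open>x\<close> stay inside \<open>U\<close>;
    this replaces the trivial bound \<open>n\<close> by a constant.\<close>
  have small: "\<theta> x x \<le> real (card U)" if x: "x \<in> nsets U k" "x \<notin> B" for x
  proof -
    have xS: "x \<in> S" using x US by auto
    have "card {X \<in> N. x \<subseteq> X} \<le> card U"
    proof (rule card_supersets_le[OF finU xS])
      fix X assume X: "X \<in> {X \<in> N. x \<subseteq> X}"
      then have "x - U = X - U" using N_outside_cases[of X x] xS x by auto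
      then show "X \<in> T \<and> x \<subseteq> X \<and> X \<subseteq> U \<union> x" using X NT x by auto
    qed
    then show ?thesis using theta_diag[OF xS] by simp
  qed
  have n1: "1 / real n \<le> 1" using n by simp
  have "\<bar>fdet ?Q M' - fdet ?Q D0\<bar> \<le> fact (card ?Q) * (real (card ?Q) * (real (card U + 1) / real n))"
  proof (rule fdet_diff_le)
    fix x y assume xy: "x \<in> ?Q" "y \<in> ?Q"
    have "\<bar>M' x y\<bar> \<le> 1 \<and> \<bar>D0 x y\<bar> \<le> 1 \<and> \<bar>M' x y - D0 x y\<bar> \<le> real (card U + 1) / real n"
    proof (cases "x \<in> S")
      case xS: True
      then have xA: "x \<notin> A" using notS by auto
      show ?thesis
      proof (cases "y \<in> S")
        case yS: True
        show ?thesis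
        proof (cases "x \<in> B \<or> y \<in> B")
          case True
          then show ?thesis using xS yS xA by (auto simp: M'_def M_def D0_def)
        next
          case False
          have xU: "x \<in> nsets U k" using xy xA by auto
          have M'xy: "M' x y = (if x = y then 1 else 0) - \<theta> x y / real n"
            using xS yS xA False by (simp add: M'_def M_def local_matrix_SS)
          show ?thesis
          proof (cases "x = y")
            case True
            have "0 \<le> \<theta> x x" "\<theta> x x \<le> real n" using theta_diag_bounds[OF xS] by auto
            moreover have "\<theta> x x / real n \<le> real (card U + 1) / real n"
              using small[OF xU] False n0 by (intro divide_right_mono) auto
            ultimately show ?thesis
              using True M'xy xS False n0 by (auto simp: D0_def)
          next
            case ne: False
            have "\<bar>\<theta> x y / real n\<bar> \<le> 1 / real n"
              using theta_off_diag[OF xS yS ne] n0 by (simp add: divide_right_mono)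
            moreover have "1 / real n \<le> real (card U + 1) / real n"
              using n0 by (intro divide_right_mono) auto
            ultimately show ?thesis using ne M'xy xS yS n1 by (auto simp: D0_def)
          qed
        qed
      next
        case False
        then have "y \<in> A" using xy US by auto
        then show ?thesis using xS False xA abs_inc_le_one[of x y]
          by (simp add: M'_def M_def local_matrix_def D0_def)
      qed
    next
      case False
      then have "x \<in> A" using xy US by auto
      then show ?thesis using False abs_inc_le_one[of y x] n0
        by (simp add: M'_def M_def local_matrix_def D0_def)
    qed
    then show "\<bar>M' x y\<bar> \<le> 1" "\<bar>D0 x y\<bar> \<le> 1" "\<bar>M' x y - D0 x y\<bar> \<le> real (card U + 1) / real n"
      by auto
  qed simp
  then show ?thesis unfolding scale cQ .
qed

text \<open>The change of basis costs nothing in the limit. By the Hodge identity the diagonal of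
  \<open>L\<close> lies between \<open>n - k\<close> and \<open>n\<close>, and its other entries are
  at most 1, so \<open>L / n\<close> on \<open>B\<close> is within \<open>O(1/n)\<close> of the
  identity.\<close>

lemma fdet_L_estimate:
  "\<bar>fdet B (\<lambda>x y. L x y / real n) - 1\<bar> \<le> fact (card B) * (real (card B) * (real (k + 1) / real n))"
proof -
  have n1: "1 / real n \<le> 1" using n by simp
  have diag: "real n - real k \<le> L x x \<and> L x x \<le> real n" if x: "x \<in> B" for x
  proof -
    have xS: "x \<in> S" using x BS by auto
    have "L x x = (\<Sum>X\<in>Pow {1..n}. inc x X * inc x X)"
      unfolding L_def using S_dest[OF xS]
      by (intro sum_Pow_restrict_nsets[symmetric]) (auto dest!: inc_nonzero_card)
    then have H: "L x x + (\<Sum>Z\<in>Pow {1..n}. inc Z x * inc Z x) = real n"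
      using inc_Hodge[of "{1..n}" x x, where 'b=real] S_dest[OF xS] by simp
    have "(\<Sum>Z\<in>Pow {1..n}. inc Z x * inc Z x :: real) \<le> (\<Sum>Z\<in>(\<lambda>y. x - {y}) ` x. 1)"
    proof -
      have "(\<Sum>Z\<in>Pow {1..n}. inc Z x * inc Z x :: real) =
          (\<Sum>Z\<in>(\<lambda>y. x - {y}) ` x. inc Z x * inc Z x)"
      proof (rule sum.mono_neutral_right)
        show "\<forall>Z\<in>Pow {1..n} - (\<lambda>y. x - {y}) ` x. inc Z x * inc Z x = (0::real)"
        proof (safe, rule ccontr)
          fix Z assume Z: "Z \<notin> (\<lambda>y. x - {y}) ` x" "inc Z x * inc Z x \<noteq> (0::real)"
          then have "inc Z x \<noteq> (0::real)" by auto
          then obtain y where "y \<notin> Z" "x = insert y Z" by (rule inc_nonzeroD)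
          then show False using Z(1) by auto
        qed
      qed (use S_dest[OF xS] in auto)
      also have "\<dots> \<le> (\<Sum>Z\<in>(\<lambda>y. x - {y}) ` x. 1)"
      proof (rule sum_mono)
        fix Z show "inc Z x * inc Z x \<le> (1::real)" using inc_cases_real[of Z x] by auto
      qed
      finally show ?thesis .
    qed
    also have "\<dots> \<le> real k"
      using S_dest[OF xS] card_image_le[of x "\<lambda>y. x - {y}"] by simp
    finally have "(\<Sum>Z\<in>Pow {1..n}. inc Z x * inc Z x :: real) \<le> real k" .
    moreover have "0 \<le> (\<Sum>Z\<in>Pow {1..n}. inc Z x * inc Z x :: real)" by (intro sum_nonneg) auto
    moreover have "0 \<le> L x x" unfolding L_def by (intro sum_nonneg) auto
    ultimately show ?thesis using H by linarith
  qed
  have off: "\<bar>L x y\<bar> \<le> 1" if "x \<in> B" "y \<in> B" "x \<noteq> y" for x y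
    unfolding L_def using that BS T_dest S_dest by (intro abs_sum_inc_inc_le_one[of _ k]) auto
  have "\<bar>fdet B (\<lambda>x y. L x y / real n) - fdet B (\<lambda>x y. if x = y then 1 else 0)\<bar> \<le>
      fact (card B) * (real (card B) * (real (k + 1) / real n))"
  proof (rule fdet_diff_le)
    fix x y assume xy: "x \<in> B" "y \<in> B"
    have "\<bar>L x y / real n\<bar> \<le> 1 \<and> \<bar>L x y / real n - (if x = y then 1 else 0)\<bar> \<le> real (k + 1) / real n"
    proof (cases "x = y")
      case True
      have "0 \<le> L x x" unfolding L_def by (intro sum_nonneg) auto
      moreover have "L x x / real n - 1 = (L x x - real n) / real n"
        using n0 by (simp add: diff_divide_distrib)
      ultimately show ?thesis using diag[OF xy(1)] True n0 by (auto simp: divide_right_mono)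
    next
      case False
      have "\<bar>L x y / real n\<bar> \<le> 1 / real n"
        using off[OF xy False] n0 by (simp add: divide_right_mono)
      moreover have "1 / real n \<le> real (k + 1) / real n"
        using n0 by (intro divide_right_mono) auto
      ultimately show ?thesis using False n1 by auto
    qed
    then show "\<bar>L x y / real n\<bar> \<le> 1" "\<bar>L x y / real n - (if x = y then 1 else 0)\<bar> \<le> real (k + 1) / real n"
      by auto
  qed (auto)
  then show ?thesis by (simp add: fdet_identity)
qed

end

section \<open>The limit of the probability of a local event\<close>

definition cofaces :: "nat \<Rightarrow> nat \<Rightarrow> nat set set \<Rightarrow> nat set set" where
  "cofaces n k B = {X \<in> nsets {1..n} (k + 1). \<exists>Y\<in>B. Y \<subseteq> X}"

definition local_prob :: "nat \<Rightarrow> nat \<Rightarrow> nat set set \<Rightarrow> nat set set \<Rightarrow> real" where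
  "local_prob n k A B =
     (\<Sum>F | F \<subseteq> nsets {1..n} (k + 1) \<and> card F = (n - 1) choose k \<and> F \<inter> cofaces n k B = A.
       facet_weight n k F) / real n ^ ((n - 2) choose k)"

text \<open>Agrees with \<open>D0\<close> on the index set of the core block but does not mention
  \<open>n\<close>, so its determinant can be held fixed while the vertex set grows.\<close>

definition core_matrix :: "nat set set \<Rightarrow> nat set set \<Rightarrow> nat set \<Rightarrow> nat set \<Rightarrow> real" where
  "core_matrix A B x y =
     (if x \<in> A then if y \<in> A then 0 else - inc y x
      else if y \<in> A then inc x y else if x = y \<and> x \<notin> B then 1 else 0)"

context facet_config
begin

text \<open>The sum of the logarithms is compared with \<open>- c\<close>. The error terms come from
  \<open>ln (1 + y) - y\<close>, from the deviation of \<open>y\<close> from \<open>- c / n\<close>,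
  and from the \<open>card U\<close> vertices that have no block. The largeness assumption keeps
  \<open>y\<close> within \<open>1/2\<close>, where the logarithmic error is at most
  \<open>2 * y\<^sup>2\<close>.\<close>

lemma prod_blocks_estimate:
  defines "c \<equiv> real (k * card B)"
  defines "K \<equiv> fact (card U choose (k - 1)) + c\<^sup>2"
  assumes large: "(c + K) / real n \<le> 1 / 2"
  obtains e where "(\<Prod>v\<in>{1..n} - U. fdet (block v) M) = exp (- c + e)"
    "\<bar>e\<bar> \<le> (2 * (c + K)\<^sup>2 + K + real (card U) * c) / real n"
proof -
  let ?W = "{1..n} - U"
  define y where "y v = fdet (block v) M - 1" for v
  have c0: "c \<ge> 0" and K0: "K \<ge> 0" by (simp_all add: c_def K_def)
  have nn: "1 / (real n)\<^sup>2 \<le> 1 / real n" using n by (simp add: field_simps power2_eq_square)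
  have y1: "\<bar>y v + c / real n\<bar> \<le> K / (real n)\<^sup>2" if "v \<in> ?W" for v
    using fdet_block_estimate[OF that] by (simp add: y_def c_def K_def algebra_simps)
  have Kn: "K / (real n)\<^sup>2 \<le> K / real n"
    using mult_left_mono[OF nn K0] by simp
  have y2: "\<bar>y v\<bar> \<le> (c + K) / real n" if "v \<in> ?W" for v
  proof -
    have "\<bar>y v\<bar> \<le> \<bar>y v + c / real n\<bar> + \<bar>c / real n\<bar>" by linarith
    also have "\<dots> \<le> K / real n + c / real n"
      using y1[OF that] Kn c0 by simp
    finally show ?thesis by (simp add: add_divide_distrib)
  qed
  have y3: "\<bar>y v\<bar> \<le> 1 / 2" if "v \<in> ?W" for v using y2[OF that] large by linarith
  define E where "E = (\<Sum>v\<in>?W. ln (1 + y v))"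
  have "(\<Prod>v\<in>?W. fdet (block v) M) = (\<Prod>v\<in>?W. exp (ln (1 + y v)))"
  proof (rule prod.cong[OF refl])
    fix v assume "v \<in> ?W"
    then have "1 + y v > 0" using y3[of v] by auto
    then show "fdet (block v) M = exp (ln (1 + y v))" by (simp add: y_def)
  qed
  also have "\<dots> = exp E" unfolding E_def by (simp add: exp_sum)
  finally have P: "(\<Prod>v\<in>?W. fdet (block v) M) = exp (- c + (E + c))" by simp
  have cW: "real (card ?W) = real n - real (card U)" "card ?W \<le> n"
    using U finU card_mono[of "{1..n}" U] by (auto simp: card_Diff_subset of_nat_diff)
  have "\<bar>E + c\<bar> \<le> \<bar>\<Sum>v\<in>?W. ln (1 + y v) - y v\<bar> + \<bar>\<Sum>v\<in>?W. y v + c / real n\<bar>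
      + \<bar>c - real (card ?W) * (c / real n)\<bar>"
  proof -
    have "E + c = (\<Sum>v\<in>?W. ln (1 + y v) - y v) + (\<Sum>v\<in>?W. y v + c / real n)
        + (c - real (card ?W) * (c / real n))"
      by (simp add: E_def sum_subtractf sum.distrib)
    moreover have "\<bar>a + b + c\<bar> \<le> \<bar>a\<bar> + \<bar>b\<bar> + \<bar>c\<bar>" for a b c :: real by linarith
    ultimately show ?thesis by (simp only:)
  qed
  also have "\<bar>\<Sum>v\<in>?W. ln (1 + y v) - y v\<bar> \<le> (\<Sum>v\<in>?W. 2 * ((c + K) / real n)\<^sup>2)"
  proof -
    have "\<bar>\<Sum>v\<in>?W. ln (1 + y v) - y v\<bar> \<le> (\<Sum>v\<in>?W. \<bar>ln (1 + y v) - y v\<bar>)" by (rule sum_abs)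
    also have "\<dots> \<le> (\<Sum>v\<in>?W. 2 * ((c + K) / real n)\<^sup>2)"
    proof (rule sum_mono)
      fix v assume v: "v \<in> ?W"
      have "\<bar>ln (1 + y v) - y v\<bar> \<le> 2 * (y v)\<^sup>2"
        by (rule abs_ln_one_plus_x_minus_x_bound[OF y3[OF v]])
      also have "(y v)\<^sup>2 \<le> ((c + K) / real n)\<^sup>2"
        using y2[OF v] by (metis abs_ge_zero power2_abs power_mono)
      finally show "\<bar>ln (1 + y v) - y v\<bar> \<le> 2 * ((c + K) / real n)\<^sup>2" by simp
    qed
    finally show ?thesis .
  qed
  also have "(\<Sum>v\<in>?W. 2 * ((c + K) / real n)\<^sup>2) \<le> 2 * (c + K)\<^sup>2 / real n"
  proof -
    have "(\<Sum>v\<in>?W. 2 * ((c + K) / real n)\<^sup>2) \<le> real n * (2 * ((c + K) / real n)\<^sup>2)"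
      using cW(2) by (simp add: mult_right_mono)
    also have "\<dots> = 2 * (c + K)\<^sup>2 / real n" using n0 by (simp add: power2_eq_square field_simps)
    finally show ?thesis .
  qed
  also have "\<bar>\<Sum>v\<in>?W. y v + c / real n\<bar> \<le> K / real n"
  proof -
    have "\<bar>\<Sum>v\<in>?W. y v + c / real n\<bar> \<le> (\<Sum>v\<in>?W. \<bar>y v + c / real n\<bar>)" by (rule sum_abs)
    also have "\<dots> \<le> (\<Sum>v\<in>?W. K / (real n)\<^sup>2)" by (rule sum_mono) (rule y1)
    also have "\<dots> \<le> real n * (K / (real n)\<^sup>2)" using cW(2) K0 by (simp add: mult_right_mono divide_right_mono)
    also have "\<dots> = K / real n" using n0 by (simp add: power2_eq_square)
    finally show ?thesis .
  qed
  also have "\<bar>c - real (card ?W) * (c / real n)\<bar> = real (card U) * c / real n"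
    using n0 c0 unfolding cW by (simp add: field_simps)
  finally have "\<bar>E + c\<bar> \<le> (2 * (c + K)\<^sup>2 + K + real (card U) * c) / real n"
    by (simp add: add_divide_distrib)
  with P show thesis by (rule that)
qed

text \<open>Here \<open>d\<close> is the determinant of the change of basis,
  \<open>exp (- c + e)\<close> the product over outside vertices and \<open>q\<close> the scaled
  core. The bounds depend on sizes only, which permits \<open>U\<close>, \<open>A\<close> and
  \<open>B\<close> to vary with \<open>n\<close>.\<close>

lemma local_prob_estimate:
  defines "c \<equiv> real (k * card B)"
  defines "K \<equiv> fact (card U choose (k - 1)) + c\<^sup>2"
  assumes large: "(c + K) / real n \<le> 1 / 2"
  obtains d e q where
    "local_prob n k A B * real n ^ card A * d\<^sup>2 = exp (- c + e) * q"
    "\<bar>d - 1\<bar> \<le> fact (card B) * (real (card B) * real (k + 1)) / real n"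
    "\<bar>e\<bar> \<le> (2 * (c + K)\<^sup>2 + K + real (card U) * c) / real n"
    "\<bar>q - fdet (nsets U k \<union> A) (core_matrix A B)\<bar> \<le> fact ((card U choose k) + card A) *
      (real ((card U choose k) + card A) * real (card U + 1)) / real n"
proof -
  obtain e where e: "(\<Prod>v\<in>{1..n} - U. fdet (block v) M) = exp (- c + e)"
    "\<bar>e\<bar> \<le> (2 * (c + K)\<^sup>2 + K + real (card U) * c) / real n"
    using prod_blocks_estimate large unfolding c_def K_def by blast
  define d where "d = fdet B (\<lambda>x y. L x y / real n)"
  define q where "q = real n ^ card A * fdet (nsets U k \<union> A) M"
  have N: "cofaces n k B = N" by (simp add: cofaces_def N_def)
  have "local_prob n k A B = fdet (S \<union> A) (local_matrix n k N A)"
    unfolding local_prob_def N by (rule facet_weight_local[OF k n AN NT])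
  then have "local_prob n k A B * d\<^sup>2 = fdet (nsets U k \<union> A) M * exp (- c + e)"
    using fdet_local_matrix fdet_M_blocks e(1) by (simp add: d_def mult.commute)
  then have "local_prob n k A B * real n ^ card A * d\<^sup>2 = exp (- c + e) * q"
    by (simp add: q_def algebra_simps)
  moreover have "\<bar>d - 1\<bar> \<le> fact (card B) * (real (card B) * real (k + 1)) / real n"
    using fdet_L_estimate by (simp add: d_def)
  moreover have "fdet (nsets U k \<union> A) D0 = fdet (nsets U k \<union> A) (core_matrix A B)"
  proof (rule fdet_cong[OF refl])
    fix x y assume "x \<in> nsets U k \<union> A" "y \<in> nsets U k \<union> A"
    then have "x \<in> S \<longleftrightarrow> x \<notin> A" "y \<in> S \<longleftrightarrow> y \<notin> A" using SA US by blast+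
    then show "D0 x y = core_matrix A B x y" by (auto simp: D0_def core_matrix_def)
  qed
  then have "\<bar>q - fdet (nsets U k \<union> A) (core_matrix A B)\<bar> \<le> fact ((card U choose k) + card A) *
      (real ((card U choose k) + card A) * real (card U + 1)) / real n"
    using fdet_core_estimate by (simp add: q_def)
  ultimately show thesis using e(2) by (intro that)
qed

end

lemma tendsto_of_abs_le_const_div:
  fixes f :: "nat \<Rightarrow> real"
  assumes "\<forall>\<^sub>F n in sequentially. \<bar>f n - l\<bar> \<le> C / real n"
  shows "f \<longlonglongrightarrow> l"
proof -
  have "(\<lambda>n. C / real n) \<longlonglongrightarrow> 0" by (rule lim_const_over_n)
  then have "(\<lambda>n. f n - l) \<longlonglongrightarrow> 0"
    by (rule Lim_null_comparison[rotated]) (use assms in simp)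
  then show ?thesis by (simp add: LIM_zero_iff)
qed

text \<open>The configurations for different \<open>n\<close> share only their sizes and core
  determinant. This freedom is used later to follow the least and the most likely copy for each
  \<open>n\<close>.\<close>

lemma local_prob_tendsto:
  fixes U :: "nat \<Rightarrow> nat set" and A B :: "nat \<Rightarrow> nat set set"
  assumes cfg: "\<forall>\<^sub>F n in sequentially. facet_config n k (U n) (A n) (B n) \<and>
      card (U n) = s \<and> card (A n) = a \<and> card (B n) = b \<and>
      fdet (nsets (U n) k \<union> A n) (core_matrix (A n) (B n)) = m"
  shows "(\<lambda>n. local_prob n k (A n) (B n) * real n ^ a) \<longlonglongrightarrow> m * exp (- real (k * b))"
proof -
  define c where "c = real (k * b)"
  define K where "K = fact (s choose (k - 1)) + c\<^sup>2"
  define C1 where "C1 = fact b * (real b * real (k + 1))"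
  define C2 where "C2 = 2 * (c + K)\<^sup>2 + K + real s * c"
  define C3 where "C3 = fact ((s choose k) + a) * (real ((s choose k) + a) * real (s + 1))"
  have "(\<lambda>n. (c + K) / real n) \<longlonglongrightarrow> 0" by (rule lim_const_over_n)
  then have "\<forall>\<^sub>F n in sequentially. (c + K) / real n < 1 / 2"
    by (rule order_tendstoD) simp
  with cfg have "\<forall>\<^sub>F n in sequentially. \<exists>d e q.
      local_prob n k (A n) (B n) * real n ^ a * d\<^sup>2 = exp (- c + e) * q \<and>
      \<bar>d - 1\<bar> \<le> C1 / real n \<and> \<bar>e - 0\<bar> \<le> C2 / real n \<and> \<bar>q - m\<bar> \<le> C3 / real n"
  proof eventually_elim
    case (elim n)
    then interpret facet_config n k "U n" "A n" "B n" by simp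
    from elim have cards: "card (U n) = s" "card (A n) = a" "card (B n) = b"
      "fdet (nsets (U n) k \<union> A n) (core_matrix (A n) (B n)) = m" by auto
    have "(real (k * card (B n)) + (fact (card (U n) choose (k - 1)) + (real (k * card (B n)))\<^sup>2)) / real n \<le> 1 / 2"
      using elim(2) by (simp add: cards c_def K_def)
    from local_prob_estimate[OF this, unfolded cards]
    show ?case unfolding c_def K_def C1_def C2_def C3_def by (metis diff_zero)
  qed
  then obtain d e q where *: "\<forall>\<^sub>F n in sequentially.
      local_prob n k (A n) (B n) * real n ^ a * (d n)\<^sup>2 = exp (- c + e n) * q n \<and>
      \<bar>d n - 1\<bar> \<le> C1 / real n \<and> \<bar>e n - 0\<bar> \<le> C2 / real n \<and> \<bar>q n - m\<bar> \<le> C3 / real n"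
    unfolding eventually_sequentially by metis
  have d: "d \<longlonglongrightarrow> 1" by (rule tendsto_of_abs_le_const_div[of _ _ C1]) (use * in \<open>auto elim: eventually_mono\<close>)
  have e: "e \<longlonglongrightarrow> 0" by (rule tendsto_of_abs_le_const_div[of _ _ C2]) (use * in \<open>auto elim: eventually_mono\<close>)
  have q: "q \<longlonglongrightarrow> m" by (rule tendsto_of_abs_le_const_div[of _ _ C3]) (use * in \<open>auto elim: eventually_mono\<close>)
  have "(\<lambda>n. exp (- c + e n) * q n / (d n)\<^sup>2) \<longlonglongrightarrow> exp (- c + 0) * m / 1\<^sup>2"
    by (intro tendsto_intros d e q) simp
  moreover have "\<forall>\<^sub>F n in sequentially. d n > 0" by (rule order_tendstoD(1)[OF d]) simp
  with * have "\<forall>\<^sub>F n in sequentially. exp (- c + e n) * q n / (d n)\<^sup>2 =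
      local_prob n k (A n) (B n) * real n ^ a"
  proof eventually_elim
    case (elim n)
    then have "exp (- c + e n) * q n = local_prob n k (A n) (B n) * real n ^ a * (d n)\<^sup>2" "d n \<noteq> 0"
      by simp_all
    then show ?case by simp
  qed
  ultimately show ?thesis
    by (simp add: c_def mult.commute Lim_transform_eventually)
qed

section \<open>Permutations along the edges of an acyclic graph\<close>

section \<open>Matchings of a forest as a determinant\<close>

text \<open>Each transposition in \<open>p\<close> contributes sign -1 and entry product -1, each
  fixed point 1; the induction strips off one transposition at a time.\<close>

lemma involution_sign_prod:
  fixes D :: "'a \<Rightarrow> 'a \<Rightarrow> real"
  assumes "finite V" "p permutes V" "\<And>x. p (p x) = x"
    and "\<And>x. x \<in> V \<Longrightarrow> p x = x \<Longrightarrow> D x x = 1"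
    and "\<And>x. x \<in> V \<Longrightarrow> p x \<noteq> x \<Longrightarrow> D x (p x) * D (p x) x = -1"
  shows "of_int (sign p) * (\<Prod>x\<in>V. D x (p x)) = 1"
  using assms
proof (induction "card V" arbitrary: V p rule: less_induct)
  case less
  show ?case
  proof (cases "\<exists>x\<in>V. p x \<noteq> x")
    case False
    then have "p x = x" for x using less.prems(2) by (cases "x \<in> V") (auto simp: permutes_not_in)
    then have "p = id" by auto
    then show ?thesis using less.prems(4) by simp
  next
    case True
    then obtain x where x: "x \<in> V" "p x \<noteq> x" by auto
    define y where "y = p x"
    have y: "y \<in> V" "p y = x" "x \<noteq> y"
      using x less.prems(2,3) by (auto simp: y_def permutes_in_image)
    let ?t = "Transposition.transpose x y"
    define q where "q = ?t \<circ> p"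
    have pz: "p z \<noteq> x" "p z \<noteq> y" if "z \<noteq> x" "z \<noteq> y" for z
    proof -
      show "p z \<noteq> x"
      proof
        assume "p z = x"
        then have "p (p z) = y" by (simp add: y_def)
        then show False using less.prems(3)[of z] that by simp
      qed
      show "p z \<noteq> y"
      proof
        assume "p z = y"
        then have "p (p z) = x" using y(2) by simp
        then show False using less.prems(3)[of z] that by simp
      qed
    qed
    have q_other: "q z = p z" if "z \<noteq> x" "z \<noteq> y" for z
    proof -
      have "p z \<noteq> x" "p z \<noteq> y" using pz that by auto
      then show ?thesis by (simp add: q_def transpose_apply_other)
    qed
    have qxy: "q x = x" "q y = y" using y by (simp_all add: q_def y_def[symmetric])
    have qq: "q (q z) = z" for z
    proof (cases "z = x \<or> z = y")
      case False
      then have "p z \<noteq> x" "p z \<noteq> y" using pz by auto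
      then show ?thesis using False q_other less.prems(3) by simp
    qed (use qxy in auto)
    have qV: "q permutes V"
      unfolding q_def by (intro permutes_compose less.prems(2) permutes_swap_id x(1) y(1))
    have q: "q permutes (V - {x, y})"
    proof (rule permutes_superset[OF qV])
      fix z assume "z \<in> V - (V - {x, y})"
      then have "z = x \<or> z = y" by blast
      then show "q z = z" using qxy by blast
    qed
    have fin: "finite (V - {x, y})" using less.prems(1) by simp
    have "card (V - {x, y}) < card V"
      using less.prems(1) x(1) by (intro psubset_card_mono) auto
    then have IH: "of_int (sign q) * (\<Prod>z\<in>V - {x, y}. D z (q z)) = 1"
    proof (rule less.hyps)
      fix z assume "z \<in> V - {x, y}" "q z = z"
      then show "D z z = 1" using less.prems(4)[of z] q_other[of z] by auto
    next
      fix z assume "z \<in> V - {x, y}" "q z \<noteq> z"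
      then show "D z (q z) * D (q z) z = - 1" using less.prems(5)[of z] q_other[of z] by auto
    qed (use fin q qq in auto)
    have "sign q = sign ?t * sign p"
      unfolding q_def using less.prems(1,2)
      by (intro sign_compose permutation_swap_id) (auto intro: permutes_imp_permutation)
    then have sq: "sign q = - sign p" using y(3) by (simp add: sign_swap_id)
    have "(\<Prod>z\<in>V. D z (p z)) = D x y * (D y x * (\<Prod>z\<in>V - {x} - {y}. D z (p z)))"
      using less.prems(1) x(1) y
      by (simp add: prod.remove[of V x] prod.remove[of "V - {x}" y] y_def[symmetric])
    also have "V - {x} - {y} = V - {x, y}" by auto
    also have "(\<Prod>z\<in>V - {x, y}. D z (p z)) = (\<Prod>z\<in>V - {x, y}. D z (q z))"
      by (intro prod.cong) (auto simp: q_other)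
    also have "D x y * (D y x * (\<Prod>z\<in>V - {x, y}. D z (q z))) = - (\<Prod>z\<in>V - {x, y}. D z (q z))"
      using less.prems(5)[OF x] by (simp add: y_def mult.assoc[symmetric])
    finally show ?thesis using IH sq by simp
  qed
qed

text \<open>An orbit of length at least three, listed in order, would be a cycle of the
  graph.\<close>

lemma involution_of_acyclic:
  assumes acyclic: "\<nexists>xs. cycle G xs" and fin: "finite (verts G)" and p: "p permutes (verts G)"
    and adj: "\<And>x. x \<in> verts G \<Longrightarrow> p x \<noteq> x \<Longrightarrow> adj G x (p x)"
  shows "p (p x) = x"
proof (rule ccontr)
  assume ppx: "p (p x) \<noteq> x"
  have inj: "inj p" using p by (rule permutes_inj)
  have px: "p x \<noteq> x" using ppx by auto
  then have xV: "x \<in> verts G" using p by (metis permutes_not_in)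
  have "permutation p" using fin p by (auto intro: permutes_imp_permutation)
  then obtain m0 where m0: "m0 > 0" "(p ^^ m0) x = x" by (rule permutation_self)
  define m where "m = (LEAST m. m > 0 \<and> (p ^^ m) x = x)"
  have m: "m > 0" "(p ^^ m) x = x"
    using LeastI[of "\<lambda>m. m > 0 \<and> (p ^^ m) x = x" m0] m0 by (auto simp: m_def)
  have least: "(p ^^ i) x \<noteq> x" if "0 < i" "i < m" for i
    using not_less_Least[of i "\<lambda>m. m > 0 \<and> (p ^^ m) x = x"] that by (auto simp: m_def)
  have inj_pow: "inj (p ^^ i)" for i using inj by (rule inj_fn)
  have orbit_V: "(p ^^ i) x \<in> verts G" for i
    by (induction i) (use xV p in \<open>auto simp: permutes_in_image\<close>)
  have moved: "p ((p ^^ i) x) \<noteq> (p ^^ i) x" for i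
  proof
    assume "p ((p ^^ i) x) = (p ^^ i) x"
    then have "(p ^^ i) (p x) = (p ^^ i) x" by (simp add: funpow_swap1)
    then show False using inj_pow px by (auto dest: injD)
  qed
  define xs where "xs = map (\<lambda>i. (p ^^ i) x) [0..<m]"
  have "m \<noteq> 1" using m px by auto
  moreover have "m \<noteq> 2" using m ppx by (auto simp: numeral_2_eq_2)
  ultimately have m3: "m \<ge> 3" using m(1) by linarith
  have "distinct xs"
  proof -
    have "(p ^^ i) x \<noteq> (p ^^ j) x" if "i < j" "j < m" for i j
    proof
      assume eq: "(p ^^ i) x = (p ^^ j) x"
      have "(p ^^ j) x = (p ^^ i) ((p ^^ (j - i)) x)"
        using that by (metis comp_apply funpow_add le_add_diff_inverse less_imp_le)
      then have "(p ^^ (j - i)) x = x" using eq inj_pow by (metis injD)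
      then show False using least[of "j - i"] that by auto
    qed
    then have "inj_on (\<lambda>i. (p ^^ i) x) {0..<m}"
      by (intro linorder_inj_onI) auto
    then show ?thesis by (simp add: xs_def distinct_map)
  qed
  moreover have "walk G xs"
    unfolding walk_def
  proof (intro conjI)
    show "xs \<noteq> []" using m by (simp add: xs_def)
    show "set xs \<subseteq> verts G" using orbit_V by (auto simp: xs_def)
    show "successively (adj G) xs"
      unfolding successively_conv_nth
      using adj[OF orbit_V] moved by (auto simp: xs_def)
  qed
  moreover have "adj G (last xs) (hd xs)"
  proof -
    have "last xs = (p ^^ (m - 1)) x" "hd xs = x"
      using m(1) by (simp_all add: xs_def last_map hd_map)
    moreover have "p ((p ^^ (m - 1)) x) = x"
      using m by (metis Suc_diff_1 comp_apply funpow.simps(2))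
    ultimately show ?thesis using adj[OF orbit_V moved, of "m - 1"] by simp
  qed
  ultimately have "cycle G xs" using m3 by (simp add: cycle_def xs_def)
  then show False using acyclic by blast
qed

text \<open>Only permutations that move points along edges and fix no point of \<open>W\<close>
  survive in the Leibniz expansion. Acyclicity makes them involutions, that is matchings covering
  \<open>W\<close>, and the skew sign of the edge entries makes every term \<open>+1\<close>, so
  nothing cancels.\<close>

lemma fdet_eq_card_matchings:
  fixes G :: "'v ugraph" and D :: "'v \<Rightarrow> 'v \<Rightarrow> real"
  assumes fin: "finite (verts G)" and simple: "simple_graph G" and acyclic: "\<nexists>xs. cycle G xs"
    and W: "W \<subseteq> verts G"
    and diag: "\<And>x. x \<in> verts G \<Longrightarrow> D x x = (if x \<in> W then 0 else 1)"
    and edge: "\<And>x y. x \<in> verts G \<Longrightarrow> y \<in> verts G \<Longrightarrow> adj G x y \<Longrightarrow> D x y * D y x = -1"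
    and nonedge: "\<And>x y. x \<in> verts G \<Longrightarrow> y \<in> verts G \<Longrightarrow> x \<noteq> y \<Longrightarrow> \<not> adj G x y \<Longrightarrow> D x y = 0"
  shows "fdet (verts G) D = real (card {M. matching G M \<and> W \<subseteq> \<Union>M})"
proof -
  let ?V = "verts G"
  define good where "good p \<longleftrightarrow> p permutes ?V \<and> (\<forall>x\<in>?V. p x \<noteq> x \<longrightarrow> adj G x (p x)) \<and> (\<forall>x\<in>W. p x \<noteq> x)" for p
  have inv: "p (p x) = x" if "good p" for p x
    using that involution_of_acyclic[OF acyclic fin, of p x] by (auto simp: good_def)
  have irrefl: "\<not> adj G x x" for x
    using simple by (auto simp: simple_graph_def adj_def nsets_def subset_iff)
  have "fdet ?V D = (\<Sum>p\<in>{p. good p}. of_int (sign p) * (\<Prod>x\<in>?V. D x (p x)))"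
    unfolding fdet_def
  proof (rule sum.mono_neutral_right)
    show "\<forall>p\<in>{p. p permutes ?V} - {p. good p}. of_int (sign p) * (\<Prod>x\<in>?V. D x (p x)) = 0"
    proof
      fix p assume "p \<in> {p. p permutes ?V} - {p. good p}"
      then have p: "p permutes ?V" "\<not> good p" by auto
      then consider x where "x \<in> ?V" "p x \<noteq> x" "\<not> adj G x (p x)" | x where "x \<in> W" "p x = x"
        unfolding good_def by blast
      then have "\<exists>x\<in>?V. D x (p x) = 0"
      proof cases
        case 1
        then have "D x (p x) = 0" using permutes_in_image[OF p(1)] by (intro nonedge) auto
        then show ?thesis using 1 by blast
      next
        case 2
        then have "x \<in> ?V" "D x (p x) = 0" using W diag[of x] by auto
        then show ?thesis by blast
      qed
      then have "(\<Prod>x\<in>?V. D x (p x)) = 0" using fin by (auto intro: prod_zero)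
      then show "of_int (sign p) * (\<Prod>x\<in>?V. D x (p x)) = 0" by simp
    qed
  qed (auto simp: good_def finite_permutations fin)
  also have "\<dots> = (\<Sum>p\<in>{p. good p}. 1)"
  proof (rule sum.cong[OF refl])
    fix p assume "p \<in> {p. good p}"
    then have p: "good p" by simp
    then have pV: "p permutes ?V" by (simp add: good_def)
    show "of_int (sign p) * (\<Prod>x\<in>?V. D x (p x)) = 1"
    proof (rule involution_sign_prod[OF fin pV inv[OF p]])
      fix x assume x: "x \<in> ?V" "p x = x"
      then have "x \<notin> W" using p by (auto simp: good_def)
      then show "D x x = 1" using diag x by simp
    next
      fix x assume x: "x \<in> ?V" "p x \<noteq> x"
      then show "D x (p x) * D (p x) x = - 1"
        using p permutes_in_image[OF pV] by (intro edge) (auto simp: good_def)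
    qed
  qed
  also have "\<dots> = real (card {p. good p})" by simp
  also have "card {p. good p} = card {M. matching G M \<and> W \<subseteq> \<Union>M}"
  proof -
    define mt where "mt p = {{x, p x} | x. x \<in> ?V \<and> p x \<noteq> x}" for p :: "'v \<Rightarrow> 'v"
    \<comment> \<open>The involution that exchanges matched vertices and fixes the others.\<close>
    define pm where "pm M x = (if \<exists>y. {x, y} \<in> M then THE y. {x, y} \<in> M else x)" for M and x :: 'v
    have uniq: "y = z" if "matching G M" "{x, y} \<in> M" "{x, z} \<in> M" for M x y z
    proof -
      have "{x, y} = {x, z}"
      proof (rule ccontr)
        assume "{x, y} \<noteq> {x, z}"
        moreover have "pairwise disjnt M" using that(1) by (simp add: matching_def)
        ultimately have "disjnt {x, y} {x, z}" using that(2,3) by (auto dest: pairwiseD)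
        then show False by (simp add: disjnt_def)
      qed
      then show ?thesis by (auto simp: doubleton_eq_iff)
    qed
    have pm: "pm M x = y" if "matching G M" "{x, y} \<in> M" for M x y
      using that uniq[OF that(1)] by (auto simp: pm_def intro!: the_equality)
    have pm': "pm M x = x" if "\<nexists>y. {x, y} \<in> M" for M x using that by (auto simp: pm_def)
    have ne: "x \<noteq> y \<and> x \<in> ?V \<and> y \<in> ?V" if "matching G M" "{x, y} \<in> M" for M x y
    proof -
      have "{x, y} \<in> nsets ?V 2" using that simple unfolding matching_def simple_graph_def by blast
      then show ?thesis by (simp only: doubleton_in_nsets_2) simp
    qed
    have pair: "\<exists>x y. e = {x, y}" if "matching G M" "e \<in> M" for M e
    proof -
      have "e \<in> nsets ?V 2" using that simple unfolding matching_def simple_graph_def by blast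
      then show ?thesis by (elim nsets2_E) auto
    qed
    have cover: "x \<in> \<Union>M \<longleftrightarrow> (\<exists>y. {x, y} \<in> M)" if "matching G M" for M x
      using pair[OF that] by (auto simp: insert_commute) (metis insert_commute insertE singletonD)
    have "bij_betw mt {p. good p} {M. matching G M \<and> W \<subseteq> \<Union>M}"
    proof (rule bij_betw_byWitness[where f' = pm])
      show "\<forall>p\<in>{p. good p}. pm (mt p) = p"
      proof
        fix p assume "p \<in> {p. good p}"
        then have p: "good p" by simp
        show "pm (mt p) = p"
        proof
          fix x
          have mem: "{x, y} \<in> mt p \<longleftrightarrow> y = p x \<and> p x \<noteq> x \<and> x \<in> ?V" for y
          proof
            assume "{x, y} \<in> mt p"
            then obtain z where z: "{x, y} = {z, p z}" "z \<in> ?V" "p z \<noteq> z" by (auto simp: mt_def)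
            then have "x = z \<and> y = p z \<or> x = p z \<and> y = z" by (auto simp: doubleton_eq_iff)
            then show "y = p x \<and> p x \<noteq> x \<and> x \<in> ?V"
              using z p inv[OF p] permutes_in_image[of p ?V] by (auto simp: good_def)
          qed (auto simp: mt_def)
          show "pm (mt p) x = p x"
            using p unfolding pm_def mem by (auto simp: good_def permutes_not_in)
        qed
      qed
      show "\<forall>M\<in>{M. matching G M \<and> W \<subseteq> \<Union>M}. mt (pm M) = M"
      proof
        fix M assume "M \<in> {M. matching G M \<and> W \<subseteq> \<Union>M}"
        then have M: "matching G M" by simp
        show "mt (pm M) = M"
        proof (intro equalityI subsetI)
          fix e assume "e \<in> mt (pm M)"
          then obtain x where x: "e = {x, pm M x}" "pm M x \<noteq> x" by (auto simp: mt_def)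
          then obtain y where "{x, y} \<in> M" using pm' by blast
          then show "e \<in> M" using x pm[OF M] by auto
        next
          fix e assume e: "e \<in> M"
          then obtain x y where xy: "e = {x, y}" using pair[OF M] by blast
          then have "x \<in> ?V" "y \<noteq> x" "pm M x = y" using e ne[OF M] pm[OF M] by auto
          then show "e \<in> mt (pm M)" using xy by (auto simp: mt_def)
        qed
      qed
      show "mt ` {p. good p} \<subseteq> {M. matching G M \<and> W \<subseteq> \<Union>M}"
      proof safe
        fix p assume p: "good p"
        show "matching G (mt p)"
          unfolding matching_def
        proof
          show "mt p \<subseteq> edges G" using p by (auto simp: mt_def good_def adj_def)
          show "pairwise disjnt (mt p)"
            unfolding pairwise_def
          proof (intro ballI impI)
            fix e e' assume "e \<in> mt p" "e' \<in> mt p" "e \<noteq> e'"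
            then obtain x y where "e = {x, p x}" "e' = {y, p y}" "e \<noteq> e'" by (auto simp: mt_def)
            then show "disjnt e e'" using inv[OF p] by (auto simp: disjnt_def) (metis insert_commute)+
          qed
        qed
        fix x assume "x \<in> W"
        then have "{x, p x} \<in> mt p" using p W by (auto simp: good_def mt_def)
        then show "x \<in> \<Union>(mt p)" by blast
      qed
      show "pm ` {M. matching G M \<and> W \<subseteq> \<Union>M} \<subseteq> {p. good p}"
      proof safe
        fix M assume M: "matching G M" "W \<subseteq> \<Union>M"
        have inv: "pm M (pm M x) = x" for x
        proof (cases "\<exists>y. {x, y} \<in> M")
          case True
          then obtain y where "{x, y} \<in> M" by blast
          then show ?thesis using pm[OF M(1)] by (metis insert_commute)
        qed (use pm' in auto)
        have out: "pm M x = x" if "x \<notin> ?V" for x using ne[OF M(1)] that by (intro pm') blast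
        have "pm M permutes ?V"
          unfolding permutes_def using inv out by metis
        moreover have "adj G x (pm M x)" if moved: "pm M x \<noteq> x" for x
        proof -
          have "\<exists>y. {x, y} \<in> M" using pm'[of x M] moved by blast
          then obtain y where y: "{x, y} \<in> M" by blast
          then have "{x, y} \<in> edges G" using M(1) unfolding matching_def by blast
          then show ?thesis using pm[OF M(1) y] by (simp add: adj_def)
        qed
        moreover have "pm M x \<noteq> x" if xW: "x \<in> W" for x
        proof -
          have "x \<in> \<Union>M" using xW M(2) by blast
          then obtain y where y: "{x, y} \<in> M" using cover[OF M(1), of x] by blast
          then show ?thesis using pm[OF M(1) y] ne[OF M(1) y] by auto
        qed
        ultimately show "good (pm M)" by (simp add: good_def)
      qed
    qed
    then show ?thesis by (rule bij_betw_same_card)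
  qed
  finally show ?thesis .
qed

section \<open>Distances and balls through bounded walks\<close>

section \<open>Balls in graphs\<close>

lemma adj_sym: "adj G x y \<Longrightarrow> adj G y x"
  by (simp add: adj_def insert_commute)

text \<open>Distance is an infimum over walks and may be infinite. Bounds by \<open>enat i\<close>
  avoid that case and suit induction on \<open>i\<close>; a walk with \<open>i\<close> edges has
  \<open>i + 1\<close> list entries.\<close>

lemma gdist_le_iff: "gdist G u v \<le> enat i \<longleftrightarrow> (\<exists>xs. walk_betw G u xs v \<and> length xs \<le> Suc i)"
proof
  assume le: "gdist G u v \<le> enat i"
  let ?A = "(\<lambda>xs. enat (length xs - 1)) ` {xs. walk_betw G u xs v}"
  have "?A \<noteq> {}"
  proof
    assume empty: "?A = {}"
    have "gdist G u v = \<infinity>" unfolding gdist_def empty Inf_enat_def by simp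
    with le show False by simp
  qed
  then have "Inf ?A \<in> ?A" unfolding Inf_enat_def by (auto intro: LeastI)
  then obtain xs where "walk_betw G u xs v" "gdist G u v = enat (length xs - 1)"
    unfolding gdist_def by auto
  with le show "\<exists>xs. walk_betw G u xs v \<and> length xs \<le> Suc i" by (intro exI[of _ xs]) auto
next
  assume "\<exists>xs. walk_betw G u xs v \<and> length xs \<le> Suc i"
  then obtain xs where xs: "walk_betw G u xs v" "length xs \<le> Suc i" by blast
  have "gdist G u v \<le> enat (length xs - 1)"
    unfolding gdist_def by (rule INF_lower) (use xs in simp)
  also have "\<dots> \<le> enat i" using xs by simp
  finally show "gdist G u v \<le> enat i" .
qed

lemma gdist_le_imp_verts: "gdist G u v \<le> enat i \<Longrightarrow> u \<in> verts G \<and> v \<in> verts G"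
  unfolding gdist_le_iff walk_betw_def walk_def by (metis hd_in_set last_in_set subsetD)

lemma gdist_le_0_iff: "gdist G u v \<le> enat 0 \<longleftrightarrow> u \<in> verts G \<and> v = u"
proof
  assume "gdist G u v \<le> enat 0"
  then obtain xs where xs: "walk_betw G u xs v" "length xs \<le> Suc 0" unfolding gdist_le_iff by blast
  then obtain x where "xs = [x]" by (cases xs) (auto simp: walk_betw_def walk_def)
  with xs show "u \<in> verts G \<and> v = u" by (auto simp: walk_betw_def walk_def)
next
  assume "u \<in> verts G \<and> v = u"
  then show "gdist G u v \<le> enat 0"
    unfolding gdist_le_iff by (intro exI[of _ "[u]"]) (auto simp: walk_betw_def walk_def)
qed

text \<open>Breadth-first recursion: the last step of a walk is removed or added.\<close>

lemma gdist_le_Suc_iff: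
  "gdist G u v \<le> enat (Suc i) \<longleftrightarrow>
    gdist G u v \<le> enat i \<or> v \<in> verts G \<and> (\<exists>w. gdist G u w \<le> enat i \<and> adj G w v)"
proof
  assume "gdist G u v \<le> enat (Suc i)"
  then obtain xs where xs: "walk_betw G u xs v" "length xs \<le> Suc (Suc i)" unfolding gdist_le_iff by blast
  then have ne: "xs \<noteq> []" by (simp add: walk_betw_def walk_def)
  then obtain ys where ys: "xs = ys @ [v]" using xs(1) by (metis append_butlast_last_id walk_betw_def)
  show "gdist G u v \<le> enat i \<or> v \<in> verts G \<and> (\<exists>w. gdist G u w \<le> enat i \<and> adj G w v)"
  proof (cases "ys = []")
    case True
    then show ?thesis using xs ys unfolding gdist_le_iff by (intro disjI1 exI[of _ xs]) auto
  next
    case False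
    then have "walk_betw G u ys (last ys)" "adj G (last ys) v" "v \<in> verts G"
      using xs ys by (auto simp: walk_betw_def walk_def successively_append_iff)
    moreover have "length ys \<le> Suc i" using xs ys by simp
    ultimately show ?thesis unfolding gdist_le_iff by blast
  qed
next
  assume *: "gdist G u v \<le> enat i \<or> v \<in> verts G \<and> (\<exists>w. gdist G u w \<le> enat i \<and> adj G w v)"
  show "gdist G u v \<le> enat (Suc i)"
  proof (cases "gdist G u v \<le> enat i")
    case True
    then show ?thesis by (rule order_trans) simp
  next
    case False
    then obtain w where w: "v \<in> verts G" "gdist G u w \<le> enat i" "adj G w v" using * by blast
    then obtain xs where xs: "walk_betw G u xs w" "length xs \<le> Suc i" unfolding gdist_le_iff by blast
    then have "walk_betw G u (xs @ [v]) v"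
      using w by (auto simp: walk_betw_def walk_def successively_append_iff)
    then show ?thesis using xs unfolding gdist_le_iff by (intro exI[of _ "xs @ [v]"]) auto
  qed
qed

lemma gdist_adj: "gdist G u w \<le> enat i \<Longrightarrow> adj G w v \<Longrightarrow> v \<in> verts G \<Longrightarrow> gdist G u v \<le> enat (Suc i)"
  using gdist_le_Suc_iff by metis

lemma verts_gball: "verts (gball G (int i) u) = {v. gdist G u v \<le> enat i}"
proof -
  have "(\<exists>d. gdist G u v = enat d \<and> int d \<le> int i) \<longleftrightarrow> gdist G u v \<le> enat i" for v
    by (cases "gdist G u v") auto
  then show ?thesis
    using gdist_le_imp_verts[of G u] by (auto simp: gball_def induced_subgraph_def)
qed

text \<open>The strict bound covers the radius -1 that arises for \<open>i = 0\<close> and then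
  yields the empty set.\<close>

lemma verts_gball_minus_one: "verts (gball G (int i - 1) u) = {v. \<exists>d<i. gdist G u v = enat d}"
proof -
  have "(\<exists>d. gdist G u v = enat d \<and> int d \<le> int i - 1) \<longleftrightarrow> (\<exists>d<i. gdist G u v = enat d)" for v
    by auto
  moreover have "v \<in> verts G" if "gdist G u v = enat d" for v d
    using gdist_le_imp_verts[of G u v d] that by simp
  ultimately show ?thesis by (auto simp: gball_def induced_subgraph_def)
qed

lemma adj_induced: "adj (induced_subgraph G S) x y \<longleftrightarrow> adj G x y \<and> x \<in> S \<and> y \<in> S"
  by (auto simp: adj_def induced_subgraph_def)

lemma adj_gball:
  "x \<in> verts (gball G s u) \<Longrightarrow> y \<in> verts (gball G s u) \<Longrightarrow> adj (gball G s u) x y \<longleftrightarrow> adj G x y"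
  unfolding gball_def adj_induced by (auto simp: induced_subgraph_def)

lemma gball_subgraph:
  "verts (gball G s u) \<subseteq> verts G" "adj (gball G s u) x y \<Longrightarrow> adj G x y"
  unfolding gball_def adj_induced by (auto simp: induced_subgraph_def)

lemma gdist_subgraph_le:
  assumes "verts H \<subseteq> verts G" "\<And>x y. adj H x y \<Longrightarrow> adj G x y"
  shows "gdist H u v \<le> enat i \<Longrightarrow> gdist G u v \<le> enat i"
proof (induction i arbitrary: v)
  case 0
  then show ?case using assms(1) by (auto simp: gdist_le_0_iff)
next
  case (Suc i)
  then show ?case using assms unfolding gdist_le_Suc_iff[of _ _ _ i] by blast
qed

text \<open>A short walk from the centre stays inside the ball, because each of its prefixes is at
  most as long.\<close>

lemma gdist_gball:
  assumes "j \<le> i"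
  shows "gdist (gball G (int i) u) u v \<le> enat j \<longleftrightarrow> gdist G u v \<le> enat j"
proof
  assume "gdist (gball G (int i) u) u v \<le> enat j"
  then show "gdist G u v \<le> enat j"
    by (rule gdist_subgraph_le[OF gball_subgraph(1), rotated]) (rule gball_subgraph(2))
next
  assume "gdist G u v \<le> enat j"
  then show "gdist (gball G (int i) u) u v \<le> enat j"
    using assms
  proof (induction j arbitrary: v)
    case 0
    then have "gdist G u u \<le> enat 0" by (simp add: gdist_le_0_iff)
    then have "gdist G u u \<le> enat i" by (rule order_trans) simp
    then show ?case using 0 by (simp add: gdist_le_0_iff verts_gball)
  next
    case (Suc j)
    have v: "v \<in> verts (gball G (int i) u)"
      using Suc.prems by (auto simp: verts_gball intro: order_trans)
    from Suc.prems(1) consider "gdist G u v \<le> enat j"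
      | w where "gdist G u w \<le> enat j" "adj G w v" unfolding gdist_le_Suc_iff[of _ _ _ j] by blast
    then show ?case
    proof cases
      case 1
      then show ?thesis using Suc.IH[of v] Suc.prems(2) by (simp add: gdist_le_Suc_iff[of _ _ _ j])
    next
      case 2
      have w: "w \<in> verts (gball G (int i) u)"
        using 2(1) Suc.prems(2) by (auto simp: verts_gball intro: order_trans)
      have "gdist (gball G (int i) u) u w \<le> enat j" using 2 Suc.prems(2) by (intro Suc.IH) auto
      moreover have "adj (gball G (int i) u) w v" using adj_gball[OF w v] 2(2) by simp
      ultimately show ?thesis using v by (rule gdist_adj)
    qed
  qed
qed

lemma gdist_gball_eq:
  assumes "d \<le> i"
  shows "gdist (gball G (int i) u) u v = enat d \<longleftrightarrow> gdist G u v = enat d"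
proof -
  have eq: "x = enat d \<longleftrightarrow> x \<le> enat d \<and> (d > 0 \<longrightarrow> \<not> x \<le> enat (d - 1))" for x :: enat
    by (cases x) auto
  have "d - 1 \<le> i" using assms by simp
  then show ?thesis
    unfolding eq[of "gdist (gball G (int i) u) u v"] eq[of "gdist G u v"]
    using gdist_gball[OF assms, of G u v] gdist_gball[of "d - 1" i G u v] by simp
qed

section \<open>Cycles from two walks\<close>

lemma walk_prefix: "walk G (xs @ ys) \<Longrightarrow> xs \<noteq> [] \<Longrightarrow> walk G xs"
  by (auto simp: walk_def successively_append_iff)

lemma successively_cut:
  assumes "successively P ((as @ [y]) @ ((bs @ [y]) @ cs))"
  shows "successively P ((as @ [y]) @ cs)"
  using assms
  unfolding successively_append_iff[of P "as @ [y]"] successively_append_iff[of P "bs @ [y]"]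
  by auto

lemma walk_rev: "walk G xs \<Longrightarrow> walk G (rev xs)"
  by (auto simp: walk_def successively_rev adj_def insert_commute)

text \<open>A walk of minimal length among those avoiding \<open>v\<close> repeats no vertex, since
  cutting out a loop keeps both ends and adds no vertex.\<close>

lemma walk_avoiding_imp_path_avoiding:
  assumes "walk_betw G u xs w" "v \<notin> set xs"
  obtains ys where "walk_betw G u ys w" "v \<notin> set ys" "distinct ys"
proof -
  define P where "P ys \<longleftrightarrow> walk_betw G u ys w \<and> v \<notin> set ys" for ys
  have "P xs" using assms by (simp add: P_def)
  then obtain ys where ys: "P ys" and min: "\<And>zs. P zs \<Longrightarrow> length ys \<le> length zs"
    using exists_least_lemma[of "\<lambda>m. \<exists>ys. P ys \<and> length ys = m"] ex_has_least_nat[of P xs length] by blast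
  have "distinct ys"
  proof (rule ccontr)
    assume "\<not> distinct ys"
    then obtain as y bs cs where d: "ys = as @ [y] @ bs @ [y] @ cs"
      using not_distinct_decomp by blast
    have "successively (adj G) ((as @ [y]) @ ((bs @ [y]) @ cs))"
      using ys by (simp add: P_def walk_betw_def walk_def d)
    then have "successively (adj G) (as @ [y] @ cs)" by (drule_tac successively_cut) simp
    moreover have "hd (as @ [y] @ cs) = hd ys" unfolding d by (cases as) auto
    moreover have "last (as @ [y] @ cs) = last ys" unfolding d by (cases cs) auto
    ultimately have "P (as @ [y] @ cs)"
      using ys unfolding P_def walk_betw_def walk_def d by auto
    from min[OF this] show False by (simp add: d)
  qed
  then show thesis using ys that by (auto simp: P_def)
qed

text \<open>A path from \<open>u\<close> to \<open>w\<close> closes up through their common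
  neighbour \<open>v\<close>; it has at least two vertices because \<open>u\<close> and
  \<open>w\<close> differ.\<close>

lemma cycle_of_two_neighbours:
  assumes "walk_betw G u xs w" "v \<notin> set xs" "u \<noteq> w" "adj G u v" "adj G w v" "v \<in> verts G"
  shows "\<exists>ys. cycle G ys"
proof -
  obtain ys where ys: "walk_betw G u ys w" "v \<notin> set ys" "distinct ys"
    using walk_avoiding_imp_path_avoiding[OF assms(1,2)] .
  have ne: "ys \<noteq> []" using ys by (simp add: walk_betw_def walk_def)
  have "length ys \<noteq> 1"
  proof
    assume "length ys = 1"
    then obtain y where "ys = [y]" by (auto simp: length_Suc_conv)
    then show False using ys(1) assms(3) by (auto simp: walk_betw_def)
  qed
  then have "length ys \<ge> 2" using ne by (cases ys) (auto simp: Suc_le_eq)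
  then have "cycle G (ys @ [v])"
    using ys assms ne
    by (auto simp: cycle_def walk_betw_def walk_def successively_append_iff intro: adj_sym)
  then show ?thesis by blast
qed

section \<open>Levels, parents and constrained vertices of the tree\<close>

section \<open>Semi-\<open>k\<close>-ary trees\<close>

locale semi_tree =
  fixes k r :: nat and T :: "'v ugraph" and rt :: 'v
  assumes k: "k \<ge> 1" and semi: "semi_k_ary_rooted_tree k T rt" and depth: "depth T rt = enat r"
begin

lemma T: "simple_graph T" "connected_graph T" "\<nexists>xs. cycle T xs" "locally_finite_graph T" "rt \<in> verts T"
  using semi by (auto simp: semi_k_ary_rooted_tree_def tree_def)

text \<open>Distance from the root as a natural number, meaningful on \<open>verts T\<close>, where
  finite depth excludes \<open>\<infinity>\<close>.\<close>

definition lev :: "'v \<Rightarrow> nat" where "lev v = the_enat (gdist T rt v)"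

lemma gdist_le_r: "v \<in> verts T \<Longrightarrow> gdist T rt v \<le> enat r"
  unfolding depth[symmetric] depth_def by (rule SUP_upper)

lemma gdist_lev: "v \<in> verts T \<Longrightarrow> gdist T rt v = enat (lev v)"
  using gdist_le_r[of v] by (cases "gdist T rt v") (auto simp: lev_def)

lemma gdist_le_lev: "gdist T rt v \<le> enat i \<longleftrightarrow> v \<in> verts T \<and> lev v \<le> i"
  using gdist_lev[of v] gdist_le_imp_verts[of T rt v i] by auto

lemma lev_le_r: "v \<in> verts T \<Longrightarrow> lev v \<le> r"
  using gdist_le_r[of v] gdist_lev[of v] by simp

lemma lev_0_iff: "v \<in> verts T \<Longrightarrow> lev v = 0 \<longleftrightarrow> v = rt"
  using gdist_le_0_iff[of T rt v] gdist_le_lev[of v 0] T(5) by auto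

lemma lev_rt [simp]: "lev rt = 0" using lev_0_iff T(5) by blast

lemma adj_verts: "adj T u v \<Longrightarrow> u \<in> verts T \<and> v \<in> verts T \<and> u \<noteq> v"
proof -
  assume "adj T u v"
  then have "{u, v} \<in> nsets (verts T) 2" using T(1) unfolding simple_graph_def adj_def by blast
  then show ?thesis by (simp only: doubleton_in_nsets_2) simp
qed

lemma lev_adj_le: "adj T u v \<Longrightarrow> lev v \<le> Suc (lev u)"
  using gdist_adj[of T rt u "lev u" v] adj_verts[of u v] gdist_le_lev[of u "lev u"]
    gdist_le_lev[of v "Suc (lev u)"] by auto

text \<open>A shortest walk to \<open>u\<close> that visited \<open>v\<close> would show that
  \<open>v\<close> has smaller level than \<open>u\<close>.\<close>

lemma walk_to_avoiding:
  assumes "adj T u v" "lev u \<le> lev v"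
  obtains xs where "walk_betw T rt xs u" "v \<notin> set xs"
proof -
  have uv: "u \<in> verts T" "v \<in> verts T" "u \<noteq> v" using adj_verts[OF assms(1)] by auto
  have "gdist T rt u \<le> enat (lev u)" using gdist_le_lev uv by simp
  then obtain xs where xs: "walk_betw T rt xs u" "length xs \<le> Suc (lev u)"
    unfolding gdist_le_iff by blast
  have "v \<notin> set xs"
  proof
    assume "v \<in> set xs"
    then obtain ys zs where d: "xs = ys @ v # zs" by (auto simp: in_set_conv_decomp)
    have "zs \<noteq> []" using xs(1) uv d by (auto simp: walk_betw_def)
    have "walk_betw T rt (ys @ [v]) v"
      using xs(1) walk_prefix[of T "ys @ [v]" zs] unfolding walk_betw_def d
      by (cases ys) auto
    then have "gdist T rt v \<le> enat (length ys)"
      unfolding gdist_le_iff by (intro exI[of _ "ys @ [v]"]) auto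
    then have "lev v \<le> length ys" using gdist_le_lev by simp
    moreover have "length ys < lev u" using xs(2) d \<open>zs \<noteq> []\<close> by (cases zs) auto
    ultimately show False using assms(2) by simp
  qed
  then show thesis using xs that by blast
qed

text \<open>Two such neighbours could be joined through the root by a walk avoiding
  \<open>v\<close>, which closes to a cycle. Allowing equal levels also excludes edges within a
  level, once the parent is taken as the other neighbour.\<close>

lemma unique_lower_neighbour:
  assumes "adj T u v" "adj T w v" "lev u \<le> lev v" "lev w \<le> lev v"
  shows "u = w"
proof (rule ccontr)
  assume "u \<noteq> w"
  obtain xs where xs: "walk_betw T rt xs u" "v \<notin> set xs" using walk_to_avoiding assms by blast
  obtain ys where ys: "walk_betw T rt ys w" "v \<notin> set ys" using walk_to_avoiding assms by blast
  have ne: "xs \<noteq> []" "ys \<noteq> []" using xs ys by (auto simp: walk_betw_def walk_def)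
  define zs where "zs = rev xs @ tl ys"
  have y: "ys = rt # tl ys" using ys ne by (cases ys) (auto simp: walk_betw_def)
  have lx: "last (rev xs) = rt" "hd (rev xs) = u" using xs ne by (auto simp: walk_betw_def last_rev hd_rev)
  have "walk T (rev xs)" using xs walk_rev by (auto simp: walk_betw_def)
  moreover have "walk T (rt # tl ys)" using ys y by (simp add: walk_betw_def)
  ultimately have "walk T zs"
    using lx ne unfolding walk_def zs_def
    by (auto simp: successively_append_iff successively_Cons)
  moreover have "hd zs = u" using lx ne by (simp add: zs_def)
  moreover have "last zs = w"
  proof (cases "tl ys = []")
    case True
    then have "ys = [rt]" using y by simp
    then show ?thesis using ys lx True by (auto simp: zs_def walk_betw_def)
  next
    case False
    then have "last zs = last ys" using y by (metis zs_def last_ConsR last_appendR)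
    then show ?thesis using ys by (simp add: walk_betw_def)
  qed
  ultimately have "walk_betw T u zs w" by (simp add: walk_betw_def)
  moreover have "v \<notin> set zs" using xs ys list.set_sel(2)[OF ne(2)] by (auto simp: zs_def)
  ultimately have "\<exists>ys. cycle T ys"
    using cycle_of_two_neighbours[of T u zs w v] \<open>u \<noteq> w\<close> assms adj_verts[of u v] by blast
  then show False using T(3) by blast
qed

lemma ex_parent:
  assumes "v \<in> verts T" "v \<noteq> rt"
  shows "\<exists>u. adj T u v \<and> Suc (lev u) = lev v"
proof -
  obtain l where l: "lev v = Suc l" using lev_0_iff[OF assms(1)] assms(2) by (cases "lev v") auto
  have "gdist T rt v \<le> enat (Suc l)" "\<not> gdist T rt v \<le> enat l"
    using gdist_le_lev assms(1) l by auto
  then obtain w where w: "gdist T rt w \<le> enat l" "adj T w v" by (auto simp: gdist_le_Suc_iff[of _ _ _ l])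
  then have "lev w \<le> l" using gdist_le_lev by simp
  then show ?thesis using w(2) lev_adj_le[OF w(2)] l by (intro exI[of _ w]) auto
qed

definition par :: "'v \<Rightarrow> 'v" where "par v = (SOME u. adj T u v \<and> Suc (lev u) = lev v)"

lemma par:
  assumes "v \<in> verts T" "v \<noteq> rt"
  shows "adj T (par v) v" "Suc (lev (par v)) = lev v" "par v \<in> verts T"
proof -
  have "adj T (par v) v \<and> Suc (lev (par v)) = lev v"
    unfolding par_def by (rule someI_ex[OF ex_parent[OF assms]])
  then show "adj T (par v) v" "Suc (lev (par v)) = lev v" "par v \<in> verts T"
    using adj_verts by auto
qed

lemma adj_cases:
  assumes "adj T u v"
  shows "v \<noteq> rt \<and> u = par v \<and> lev v = Suc (lev u) \<or> u \<noteq> rt \<and> v = par u \<and> lev u = Suc (lev v)"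
proof -
  have uv: "u \<in> verts T" "v \<in> verts T" "u \<noteq> v" using adj_verts[OF assms] by auto
  have main: "v \<noteq> rt \<and> u = par v \<and> lev v = Suc (lev u)"
    if le: "lev u \<le> lev v" and a: "adj T u v" for u v
  proof -
    have uv: "u \<in> verts T" "v \<in> verts T" "u \<noteq> v" using adj_verts[OF a] by auto
    have "v \<noteq> rt" using le uv lev_0_iff[of u] by auto
    note p = par[OF uv(2) this]
    have "u = par v" using unique_lower_neighbour[OF a p(1) le] p(2) by simp
    then show ?thesis using p \<open>v \<noteq> rt\<close> by auto
  qed
  show ?thesis
  proof (cases "lev u \<le> lev v")
    case True
    then show ?thesis using main assms by blast
  next
    case False
    then show ?thesis using main[of v u] adj_sym[OF assms] by simp
  qed
qed

lemma adj_parity: "adj T u v \<Longrightarrow> odd (lev u) \<longleftrightarrow> even (lev v)"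
  using adj_cases[of u v] by auto

abbreviation "chi \<equiv> children T rt"

lemma chi_iff: "a \<in> verts T \<Longrightarrow> c \<in> chi a \<longleftrightarrow> c \<in> verts T \<and> c \<noteq> rt \<and> par c = a"
proof
  assume a: "a \<in> verts T" and "c \<in> chi a"
  then have c: "c \<in> verts T" "adj T a c" "lev c = Suc (lev a)"
    using gdist_lev[of a] gdist_lev[of c] by (auto simp: children_def neighbours_def eSuc_enat plus_1_eSuc)
  then show "c \<in> verts T \<and> c \<noteq> rt \<and> par c = a" using adj_cases[of a c] by auto
next
  assume a: "a \<in> verts T" and c: "c \<in> verts T \<and> c \<noteq> rt \<and> par c = a"
  then show "c \<in> chi a"
    using par[of c] gdist_lev[of a] gdist_lev[of c]
    by (auto simp: children_def neighbours_def eSuc_enat plus_1_eSuc)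
qed

text \<open>\<open>Odd\<close> is \<open>V_k(T)\<close>, and \<open>Inner\<close> is
  \<open>V_{k-1}\<close> of the ball of radius \<open>r - 1\<close>: the vertices around which the
  ball of radius \<open>r\<close> shows all facets.\<close>

definition "Odd = {v \<in> verts T. odd (lev v)}"
definition "Inner = {v \<in> verts T. even (lev v) \<and> lev v < r}"

lemma odd_verts_eq: "odd_verts T rt = Odd"
  using gdist_lev by (auto simp: odd_verts_def Odd_def)

lemma finite_verts: "finite (verts T)"
proof -
  have "finite {v. gdist T rt v \<le> enat i}" for i
  proof (induction i)
    case 0
    have "{v. gdist T rt v \<le> enat 0} \<subseteq> {rt}" by (auto simp: gdist_le_0_iff)
    then show ?case by (rule finite_subset) simp
  next
    case (Suc i)
    have "{v. gdist T rt v \<le> enat (Suc i)} \<subseteq>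
        {v. gdist T rt v \<le> enat i} \<union> (\<Union>u\<in>{v. gdist T rt v \<le> enat i}. neighbours T u)"
      by (auto simp: gdist_le_Suc_iff[of _ _ _ i] neighbours_def)
    moreover have "finite (neighbours T u)" if "gdist T rt u \<le> enat i" for u
      using T(4) gdist_le_imp_verts[OF that] by (auto simp: locally_finite_graph_def)
    ultimately show ?case using Suc by (auto intro: finite_subset)
  qed
  moreover have "verts T \<subseteq> {v. gdist T rt v \<le> enat r}" using gdist_le_r by auto
  ultimately show ?thesis using finite_subset by blast
qed

lemma card_chi: "a \<in> Odd \<Longrightarrow> finite (chi a) \<and> card (chi a) = k"
  using semi odd_verts_eq by (auto simp: semi_k_ary_rooted_tree_def)

text \<open>An odd vertex has \<open>k \<ge> 1\<close> children and so cannot lie in the last level.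
  Level \<open>r\<close> therefore consists of even vertices.\<close>

lemma Odd_lev_less: "a \<in> Odd \<Longrightarrow> lev a < r"
proof -
  assume a: "a \<in> Odd"
  then have "chi a \<noteq> {}" using card_chi[OF a] k by auto
  then obtain c where "c \<in> chi a" by blast
  then have "c \<in> verts T" "c \<noteq> rt" "par c = a" using chi_iff a by (auto simp: Odd_def)
  then show ?thesis using par(2)[of c] lev_le_r[of c] by auto
qed

lemma Odd_not_rt: "a \<in> Odd \<Longrightarrow> a \<in> verts T \<and> a \<noteq> rt" by (auto simp: Odd_def)

lemma par_Odd: "a \<in> Odd \<Longrightarrow> par a \<in> Inner"
proof -
  assume a: "a \<in> Odd"
  note p = par[of a] Odd_not_rt[OF a] Odd_lev_less[OF a]
  then have eq: "Suc (lev (par a)) = lev a" by simp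
  have "odd (Suc (lev (par a)))" unfolding eq using a by (simp add: Odd_def)
  then have "even (lev (par a))" by simp
  then show ?thesis using p by (simp add: Inner_def)
qed

lemma verts_inner_ball: "verts (gball T (int r - 1) rt) = Odd \<union> Inner"
proof -
  have "gdist T rt v = enat d \<longleftrightarrow> v \<in> verts T \<and> lev v = d" for v d
    using gdist_lev[of v] gdist_le_imp_verts[of T rt v d] by auto
  then show ?thesis
    using Odd_lev_less by (auto simp: verts_gball_minus_one Odd_def Inner_def)
qed

lemma even_verts_inner_ball: "even_verts (gball T (int r - 1) rt) rt = Inner"
proof (cases r)
  \<comment> \<open>For \<open>r = 0\<close> the ball has radius -1 and omits even the root.\<close>
  case 0
  have "Odd = {}" using Odd_lev_less 0 by fastforce
  moreover have "Inner = {}" using 0 unfolding Inner_def by simp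
  ultimately show ?thesis unfolding even_verts_def verts_inner_ball by simp
next
  case (Suc i)
  have eq: "int r - 1 = int i" using Suc by simp
  have vb: "verts (gball T (int i) rt) = {v \<in> verts T. lev v \<le> i}"
    by (auto simp: verts_gball gdist_le_lev)
  have d: "gdist (gball T (int i) rt) rt v = enat (lev v)" if "v \<in> verts T" "lev v \<le> i" for v
    using gdist_gball_eq[OF that(2), of T rt v] gdist_lev[OF that(1)] by simp
  show ?thesis
    unfolding eq even_verts_def vb Inner_def using d Suc by (auto simp: less_Suc_eq_le)
qed

lemma m_star_eq: "m_star T rt r = card {M. matching T M \<and> Odd \<union> Inner \<subseteq> \<Union>M}"
  by (simp add: m_star_def verts_inner_ball)

lemma neighbours_Odd: "a \<in> Odd \<Longrightarrow> {x. adj T a x} = insert (par a) (chi a)"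
  using adj_cases[of a] par[of a] Odd_not_rt[of a] chi_iff[of a] adj_sym[of T] adj_verts[of a]
  by (auto simp: children_def neighbours_def)

lemma card_neighbours_Odd: "a \<in> Odd \<Longrightarrow> finite {x. adj T a x} \<and> card {x. adj T a x} = k + 1"
proof -
  assume a: "a \<in> Odd"
  have "par a \<notin> chi a"
  proof
    assume "par a \<in> chi a"
    then have "par (par a) = a" "par a \<in> verts T" "par a \<noteq> rt" using chi_iff a by (auto simp: Odd_def)
    then show False using par(2)[of "par a"] par(2)[of a] Odd_not_rt[OF a] by auto
  qed
  then show ?thesis using neighbours_Odd[OF a] card_chi[OF a] by simp
qed

end

section \<open>Labelled copies of the tree in the inclusion graph\<close>

section \<open>Counting embeddings\<close>

lemma card_bijections:
  assumes "finite X" "card X = m" "finite Y" "card Y = m"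
  shows "card {\<beta> \<in> X \<rightarrow>\<^sub>E Y. bij_betw \<beta> X Y} = fact m"
proof -
  obtain b where b: "bij_betw b X Y"
    using finite_same_card_bij[OF assms(1,3)] assms(2,4) by auto
  have "bij_betw (\<lambda>p. restrict (b \<circ> p) X) {p. p permutes X} {\<beta> \<in> X \<rightarrow>\<^sub>E Y. bij_betw \<beta> X Y}"
  proof (rule bij_betw_byWitness[where f' = "\<lambda>\<beta>. restrict_id (inv_into X b \<circ> \<beta>) X"])
    show "\<forall>p\<in>{p. p permutes X}. restrict_id (inv_into X b \<circ> restrict (b \<circ> p) X) X = p"
    proof (intro ballI ext)
      fix p x assume "p \<in> {p. p permutes X}"
      then have p: "p permutes X" by simp
      show "restrict_id (inv_into X b \<circ> restrict (b \<circ> p) X) X x = p x"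
        using b permutes_in_image[OF p] permutes_not_in[OF p]
        by (cases "x \<in> X") (auto simp: bij_betw_def)
    qed
    show "\<forall>\<beta>\<in>{\<beta> \<in> X \<rightarrow>\<^sub>E Y. bij_betw \<beta> X Y}. restrict (b \<circ> restrict_id (inv_into X b \<circ> \<beta>) X) X = \<beta>"
    proof (intro ballI ext)
      fix \<beta> x assume "\<beta> \<in> {\<beta> \<in> X \<rightarrow>\<^sub>E Y. bij_betw \<beta> X Y}"
      then have \<beta>: "\<beta> \<in> X \<rightarrow>\<^sub>E Y" by simp
      show "restrict (b \<circ> restrict_id (inv_into X b \<circ> \<beta>) X) X x = \<beta> x"
      proof (cases "x \<in> X")
        case True
        then have "\<beta> x \<in> b ` X" using \<beta> b by (auto simp: bij_betw_def)
        then show ?thesis using True by (simp add: f_inv_into_f)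
      next
        case False
        then show ?thesis using PiE_arb[OF \<beta>] by simp
      qed
    qed
    show "(\<lambda>p. restrict (b \<circ> p) X) ` {p. p permutes X} \<subseteq> {\<beta> \<in> X \<rightarrow>\<^sub>E Y. bij_betw \<beta> X Y}"
    proof (rule image_subsetI)
      fix p assume "p \<in> {p. p permutes X}"
      then have p: "p permutes X" by simp
      have bp: "bij_betw (b \<circ> p) X Y" by (rule bij_betw_trans[OF permutes_imp_bij[OF p] b])
      then have "bij_betw (restrict (b \<circ> p) X) X Y" by (simp cong: bij_betw_cong)
      moreover have "restrict (b \<circ> p) X \<in> X \<rightarrow>\<^sub>E Y" using bp by (auto simp: bij_betw_def)
      ultimately show "restrict (b \<circ> p) X \<in> {\<beta> \<in> X \<rightarrow>\<^sub>E Y. bij_betw \<beta> X Y}" by simp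
    qed
    show "(\<lambda>\<beta>. restrict_id (inv_into X b \<circ> \<beta>) X) ` {\<beta> \<in> X \<rightarrow>\<^sub>E Y. bij_betw \<beta> X Y} \<subseteq> {p. p permutes X}"
    proof (rule image_subsetI)
      fix \<beta> assume "\<beta> \<in> {\<beta> \<in> X \<rightarrow>\<^sub>E Y. bij_betw \<beta> X Y}"
      then have "bij_betw \<beta> X Y" by simp
      from permutes_restrict_id[OF bij_betw_trans[OF this bij_betw_inv_into[OF b]]]
      show "restrict_id (inv_into X b \<circ> \<beta>) X \<in> {p. p permutes X}" by simp
    qed
  qed
  then have "card {p. p permutes X} = card {\<beta> \<in> X \<rightarrow>\<^sub>E Y. bij_betw \<beta> X Y}"
    by (rule bij_betw_same_card)
  then show ?thesis using card_permutations[OF assms(2,1)] by simp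
qed

context semi_tree
begin

text \<open>The vertices covered by the root and by the stars of the odd vertices in
  \<open>Q\<close>; copies are built up by enlarging \<open>Q\<close> one odd vertex at a
  time.\<close>

definition TV :: "'v set \<Rightarrow> 'v set" where "TV Q = insert rt (\<Union>a\<in>Q. insert a (chi a))"

definition closed_part :: "'v set \<Rightarrow> bool" where
  "closed_part Q \<longleftrightarrow> Q \<subseteq> Odd \<and> (\<forall>a\<in>Q. par a \<in> TV Q)"

text \<open>The equivalence in the last clause makes a copy induced in the inclusion graph.
  Extensionality gives each copy a single representing function, so that copies can be
  counted.\<close>

definition Emb :: "nat \<Rightarrow> nat set \<Rightarrow> 'v set \<Rightarrow> ('v \<Rightarrow> nat set) set" where
  "Emb n w Q = {f \<in> extensional (TV Q). f rt = w \<and>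
     (\<forall>x\<in>TV Q. even (lev x) \<longrightarrow> f x \<in> nsets {1..n} k) \<and> (\<forall>a\<in>Q. f a \<in> nsets {1..n} (k + 1)) \<and>
     inj_on f (TV Q) \<and> (\<forall>x\<in>TV Q. \<forall>a\<in>Q. even (lev x) \<longrightarrow> (f x \<subseteq> f a \<longleftrightarrow> adj T x a))}"

lemma chi_dest: "a \<in> Odd \<Longrightarrow> c \<in> chi a \<Longrightarrow> c \<in> verts T \<and> c \<noteq> rt \<and> par c = a \<and> even (lev c) \<and> lev c = Suc (lev a)"
proof -
  assume a: "a \<in> Odd" and "c \<in> chi a"
  then have c: "c \<in> verts T" "c \<noteq> rt" "par c = a" using chi_iff[of a c] by (auto simp: Odd_def)
  have eq: "lev c = Suc (lev a)" using par(2)[OF c(1,2)] c(3) by simp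
  have "even (lev c)" unfolding eq using a by (simp add: Odd_def)
  then show ?thesis using c eq by blast
qed

lemma TV_cases:
  assumes "x \<in> TV Q"
  obtains "x = rt" | "x \<in> Q" | a where "a \<in> Q" "x \<in> chi a"
  using assms unfolding TV_def by blast

lemma TV_even:
  assumes Q: "Q \<subseteq> Odd" and x: "x \<in> TV Q"
  shows "even (lev x) \<longleftrightarrow> x \<notin> Q"
proof -
  have oddQ: "odd (lev y)" if "y \<in> Q" for y using Q that by (auto simp: Odd_def)
  from x show ?thesis
  proof (cases rule: TV_cases)
    case 1
    then show ?thesis using oddQ[of rt] by auto
  next
    case 2
    then show ?thesis using oddQ by simp
  next
    case (3 a)
    then have "even (lev x)" using chi_dest[of a x] Q by blast
    then show ?thesis using oddQ[of x] by auto
  qed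
qed

lemma Q_TV: "Q \<subseteq> TV Q" and rt_TV: "rt \<in> TV Q" and chi_TV: "a \<in> Q \<Longrightarrow> chi a \<subseteq> TV Q"
  by (auto simp: TV_def)

lemma TV_verts:
  assumes Q: "Q \<subseteq> Odd"
  shows "TV Q \<subseteq> verts T"
proof
  fix x assume "x \<in> TV Q"
  then show "x \<in> verts T"
  proof (cases rule: TV_cases)
    case 2
    then show ?thesis using Q by (auto simp: Odd_def)
  next
    case (3 a)
    then show ?thesis using chi_dest[of a x] Q by blast
  qed (use T(5) in simp)
qed

lemma TV_Odd: "TV Odd = verts T"
proof
  show "verts T \<subseteq> TV Odd"
  proof
    fix v assume v: "v \<in> verts T"
    show "v \<in> TV Odd"
    proof (cases "v \<in> Odd \<or> v = rt")
      case False
      then have "even (lev v)" "Suc (lev (par v)) = lev v" "par v \<in> verts T"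
        using v par[of v] by (auto simp: Odd_def)
      then have "par v \<in> Odd" by (auto simp: Odd_def simp flip: even_Suc)
      moreover have "v \<in> chi (par v)" using chi_iff[of "par v" v] par[of v] v False by auto
      ultimately show ?thesis by (auto simp: TV_def)
    qed (auto simp: TV_def)
  qed
qed (rule TV_verts, simp)

lemma closed_part_Odd: "closed_part Odd"
  unfolding closed_part_def TV_Odd using par(3) Odd_not_rt by blast

lemma finite_TV: "Q \<subseteq> Odd \<Longrightarrow> finite (TV Q)"
  using TV_verts finite_verts finite_subset by blast

lemma finite_Emb: "Q \<subseteq> Odd \<Longrightarrow> finite (Emb n w Q)"
proof (rule finite_subset)
  assume Q: "Q \<subseteq> Odd"
  show "Emb n w Q \<subseteq> TV Q \<rightarrow>\<^sub>E Pow {1..n}"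
  proof
    fix f assume f: "f \<in> Emb n w Q"
    have "f x \<subseteq> {1..n}" if "x \<in> TV Q" for x
    proof (cases "x \<in> Q")
      case True
      then show ?thesis using f by (auto simp: Emb_def nsets_def)
    next
      case False
      then have "even (lev x)" using TV_even[OF Q that] by simp
      then show ?thesis using f that by (auto simp: Emb_def nsets_def)
    qed
    then show "f \<in> TV Q \<rightarrow>\<^sub>E Pow {1..n}" using f by (auto simp: PiE_def Emb_def)
  qed
  show "finite (TV Q \<rightarrow>\<^sub>E Pow {1..n})" using finite_TV[OF Q] by (intro finite_PiE) auto
qed

text \<open>A copy uses at most \<open>k + 1\<close> elements of \<open>[n]\<close> per tree vertex.
  The same constant later serves as the size of \<open>U\<close>.\<close>

lemma card_support:
  assumes QO: "Q \<subseteq> Odd" and g: "g \<in> Emb n w Q"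
  shows "finite (\<Union>(g ` TV Q)) \<and> card (\<Union>(g ` TV Q)) \<le> (k + 1) * card (verts T)"
proof
  have gx: "finite (g x) \<and> card (g x) \<le> k + 1" if "x \<in> TV Q" for x
  proof (cases "x \<in> Q")
    case True
    then show ?thesis using g by (auto simp: Emb_def nsets_def)
  next
    case False
    then have "even (lev x)" using TV_even[OF QO that] by simp
    then show ?thesis using g that by (auto simp: Emb_def nsets_def)
  qed
  show "finite (\<Union>(g ` TV Q))" using gx finite_TV[OF QO] by auto
  have "card (\<Union>(g ` TV Q)) \<le> (\<Sum>x\<in>TV Q. card (g x))" by (rule card_UN_le[OF finite_TV[OF QO]])
  also have "\<dots> \<le> (\<Sum>x\<in>TV Q. k + 1)" using gx by (intro sum_mono) auto
  also have "\<dots> = (k + 1) * card (TV Q)" by simp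
  also have "\<dots> \<le> (k + 1) * card (verts T)"
    by (intro mult_le_mono2 card_mono finite_verts TV_verts QO)
  finally show "card (\<Union>(g ` TV Q)) \<le> (k + 1) * card (verts T)" .
qed

lemma adj_Odd_iff: "a \<in> Odd \<Longrightarrow> adj T x a \<longleftrightarrow> x = par a \<or> x \<in> chi a"
  using neighbours_Odd[of a] adj_sym[of T] by blast

context
  fixes n :: nat and w :: "nat set" and Q :: "'v set" and a :: 'v
  assumes Q: "closed_part Q" and a: "a \<in> Odd" "a \<notin> Q" and pa: "par a \<in> TV Q"
begin

lemma QO: "Q \<subseteq> Odd" using Q by (simp add: closed_part_def)

lemma TV_insert: "TV (insert a Q) = TV Q \<union> insert a (chi a)"
  by (auto simp: TV_def)

lemma a_notin_TV: "a \<notin> TV Q"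
  using TV_even[OF QO, of a] a by (auto simp: Odd_def)

lemma chi_disjoint_TV: "chi a \<inter> TV Q = {}"
proof -
  have False if "c \<in> chi a" "c \<in> TV Q" for c
  proof -
    have c: "c \<noteq> rt" "par c = a" "even (lev c)" using chi_dest[OF a(1) that(1)] by auto
    from that(2) c(1) consider "c \<in> Q" | b where "b \<in> Q" "c \<in> chi b"
      by (elim TV_cases) blast+
    then show False
    proof cases
      case 1
      then show False using c(3) QO by (auto simp: Odd_def)
    next
      case 2
      then have "par c = b" using chi_dest[of b c] QO by blast
      then show False using 2 c(2) a(2) by blast
    qed
  qed
  then show ?thesis by blast
qed

lemma a_notin_chi: "a \<notin> chi a"
  using chi_dest[OF a(1), of a] by auto

lemma par_even: "even (lev (par a))" using par_Odd[OF a(1)] by (simp add: Inner_def)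

lemma restrict_Emb:
  assumes "f \<in> Emb n w (insert a Q)"
  shows "restrict f (TV Q) \<in> Emb n w Q"
proof -
  have sub: "TV Q \<subseteq> TV (insert a Q)" by (auto simp: TV_def)
  have "inj_on f (TV Q)" using assms sub by (auto simp: Emb_def intro: inj_on_subset)
  then have "inj_on (restrict f (TV Q)) (TV Q)" by (simp add: inj_on_restrict_eq)
  moreover have "restrict f (TV Q) x = f x" "x \<in> TV (insert a Q)" if "x \<in> TV Q" for x
    using that sub by auto
  moreover have "b \<in> TV Q" if "b \<in> Q" for b using that Q_TV by blast
  ultimately show ?thesis
    using assms rt_TV[of Q] unfolding Emb_def mem_Collect_eq
    by (intro conjI ballI impI restrict_extensional) (simp_all only: insert_iff simp_thms)
qed

context
  fixes g :: "'v \<Rightarrow> nat set"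
  assumes g: "g \<in> Emb n w Q"
begin

definition fiber :: "('v \<Rightarrow> nat set) set" where
  "fiber = {f \<in> Emb n w (insert a Q). restrict f (TV Q) = g}"

definition bijs :: "('v \<Rightarrow> nat) set" where
  "bijs = {\<beta> \<in> chi a \<rightarrow>\<^sub>E g (par a). bij_betw \<beta> (chi a) (g (par a))}"

text \<open>An extension over \<open>a\<close> is coded by the vertex \<open>v\<close> added to the
  parent's face and by a bijection telling which vertex of that face each child omits. No child
  omits \<open>v\<close>, as this would give back the parent.\<close>

definition extend :: "nat \<times> ('v \<Rightarrow> nat) \<Rightarrow> 'v \<Rightarrow> nat set" where
  "extend = (\<lambda>(v, \<beta>) x. if x = a then insert v (g (par a))
      else if x \<in> chi a then insert v (g (par a)) - {\<beta> x} else g x)"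

lemma gp: "g (par a) \<subseteq> {1..n}" "finite (g (par a))" "card (g (par a)) = k"
  using g pa par_even by (auto simp: Emb_def nsets_def)

lemma card_bijs: "card bijs = fact k"
  unfolding bijs_def using card_chi[OF a(1)] gp by (intro card_bijections) auto

lemma finite_bijs: "finite bijs"
proof (rule finite_subset)
  show "bijs \<subseteq> chi a \<rightarrow>\<^sub>E g (par a)" by (auto simp: bijs_def)
  show "finite (chi a \<rightarrow>\<^sub>E g (par a))" using card_chi[OF a(1)] gp by (intro finite_PiE) auto
qed

lemma finite_fiber: "finite fiber"
proof -
  have "insert a Q \<subseteq> Odd" using QO a by auto
  then show ?thesis using finite_Emb by (auto simp: fiber_def)
qed

text \<open>The facet at \<open>a\<close> adds one vertex to the parent's face. The \<open>k\<close>
  children are distinct faces of it other than the parent, so they omit exactly the \<open>k\<close>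
  vertices of the parent's face.\<close>

lemma fiber_subset: "fiber \<subseteq> extend ` ({1..n} \<times> bijs)"
proof
  fix f assume "f \<in> fiber"
  then have f: "f \<in> Emb n w (insert a Q)" and fg: "restrict f (TV Q) = g" by (auto simp: fiber_def)
  let ?Y = "g (par a)"
  have mem: "a \<in> TV (insert a Q)" "par a \<in> TV (insert a Q)" "\<And>c. c \<in> chi a \<Longrightarrow> c \<in> TV (insert a Q)"
    using pa by (auto simp: TV_insert)
  have fp: "f (par a) = ?Y" using fg pa by (metis restrict_apply')
  have sub: "f x \<subseteq> f a \<longleftrightarrow> adj T x a" if "x \<in> TV (insert a Q)" "even (lev x)" for x
    using f that by (auto simp: Emb_def)
  have fa: "f a \<subseteq> {1..n}" "finite (f a)" "card (f a) = k + 1" using f by (auto simp: Emb_def nsets_def)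
  have "?Y \<subseteq> f a" using sub[OF mem(2) par_even] fp par(1)[of a] Odd_not_rt[OF a(1)] by simp
  then have "card (f a - ?Y) = 1" using fa gp by (simp add: card_Diff_subset)
  then obtain v where v0: "f a - ?Y = {v}" by (auto simp: card_1_singleton_iff)
  then have v: "f a = insert v ?Y" "v \<notin> ?Y" "v \<in> {1..n}" using \<open>?Y \<subseteq> f a\<close> fa by auto
  have fc: "\<exists>y. y \<in> ?Y \<and> f c = f a - {y}" if c: "c \<in> chi a" for c
  proof -
    have cl: "even (lev c)" "c \<noteq> par a"
      using chi_dest[OF a(1) c] chi_disjoint_TV pa c by auto
    have fck: "f c \<in> nsets {1..n} k" using f mem(3)[OF c] cl by (auto simp: Emb_def)
    have "f c \<subseteq> f a" using sub[OF mem(3)[OF c] cl(1)] adj_Odd_iff[OF a(1)] c by simp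
    then have "card (f a - f c) = 1" using fa fck by (simp add: card_Diff_subset nsets_def)
    then obtain y where "f a - f c = {y}" by (auto simp: card_1_singleton_iff)
    then have y: "f c = f a - {y}" "y \<in> f a" using \<open>f c \<subseteq> f a\<close> by auto
    have "f c \<noteq> f (par a)"
      using f mem c cl(2) by (auto simp: Emb_def inj_on_def)
    then have "y \<noteq> v" using y v fp by auto
    then show ?thesis using y v by auto
  qed
  define \<beta> where "\<beta> = restrict (\<lambda>c. SOME y. y \<in> ?Y \<and> f c = f a - {y}) (chi a)"
  have \<beta>: "\<beta> c \<in> ?Y" "f c = f a - {\<beta> c}" if "c \<in> chi a" for c
    using someI_ex[OF fc[OF that]] that by (auto simp: \<beta>_def)
  have "inj_on \<beta> (chi a)"
  proof (rule inj_onI)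
    fix c d assume cd: "c \<in> chi a" "d \<in> chi a" "\<beta> c = \<beta> d"
    then have "f c = f d" using \<beta>(2)[OF cd(1)] \<beta>(2)[OF cd(2)] by simp
    moreover have "inj_on f (TV (insert a Q))" using f by (simp add: Emb_def)
    ultimately show "c = d" using mem(3) cd by (auto simp: inj_on_def)
  qed
  moreover have "\<beta> ` chi a \<subseteq> ?Y" using \<beta> by auto
  moreover from calculation have "\<beta> ` chi a = ?Y"
    using card_chi[OF a(1)] gp by (intro card_subset_eq) (simp_all add: card_image)
  ultimately have "bij_betw \<beta> (chi a) ?Y" by (simp add: bij_betw_def)
  moreover have "\<beta> \<in> extensional (chi a)" by (simp add: \<beta>_def)
  then have "\<beta> \<in> chi a \<rightarrow>\<^sub>E ?Y" using \<beta>(1) by (simp add: PiE_iff)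
  ultimately have "\<beta> \<in> bijs" by (simp add: bijs_def)
  moreover have "f = extend (v, \<beta>)"
  proof
    fix x show "f x = extend (v, \<beta>) x"
    proof (cases "x = a \<or> x \<in> chi a")
      case True
      then show ?thesis using v(1) \<beta>(2)[of x] a_notin_chi by (auto simp: extend_def)
    next
      case False
      show ?thesis
      proof (cases "x \<in> TV Q")
        case True
        then show ?thesis using False fg by (auto simp: extend_def)
      next
        case no: False
        then have "f x = undefined" using f False by (auto simp: Emb_def TV_insert extensional_def)
        moreover have "g x = undefined" using g no by (auto simp: Emb_def extensional_def)
        ultimately show ?thesis using False by (simp add: extend_def)
      qed
    qed
  qed
  ultimately show "f \<in> extend ` ({1..n} \<times> bijs)" using v by auto
qed

lemma card_fiber_le: "card fiber \<le> n * fact k"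
proof -
  have "card fiber \<le> card (extend ` ({1..n} \<times> bijs))"
    using fiber_subset finite_bijs by (intro card_mono) auto
  also have "\<dots> \<le> card ({1..n} \<times> bijs)" using finite_bijs by (intro card_image_le) auto
  finally show ?thesis by (simp add: card_bijs card_cartesian_product)
qed

lemma extend_in_fiber:
  assumes v: "v \<in> {1..n} - \<Union>(g ` TV Q)" and \<beta>: "\<beta> \<in> bijs"
  shows "extend (v, \<beta>) \<in> fiber"
proof -
  let ?Y = "g (par a)" and ?f = "extend (v, \<beta>)"
  have old: "?f x = g x" if "x \<in> TV Q" for x
    using that a_notin_TV chi_disjoint_TV by (auto simp: extend_def)
  have fa: "?f a = insert v ?Y" by (simp add: extend_def)
  have new: "?f c = insert v ?Y - {\<beta> c}" "\<beta> c \<in> ?Y" if "c \<in> chi a" for c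
    using that a_notin_chi \<beta> by (auto simp: extend_def bijs_def)
  have vg: "v \<notin> g x" if "x \<in> TV Q" for x using v that by auto
  have vY: "v \<notin> ?Y" using vg pa by auto
  have vn: "v \<in> {1..n}" using v by auto
  have vf: "v \<in> ?f x" if "x \<in> insert a (chi a)" for x
    using that fa new[of x] vY by auto
  have g_even: "g x \<in> nsets {1..n} k" if "x \<in> TV Q" "even (lev x)" for x using g that by (auto simp: Emb_def)
  have "?f rt = w" using old[OF rt_TV] g by (simp add: Emb_def)
  moreover have "?f x \<in> nsets {1..n} k" if x: "x \<in> TV (insert a Q)" "even (lev x)" for x
  proof -
    have "x \<noteq> a" using x(2) a by (auto simp: Odd_def)
    then consider "x \<in> TV Q" | "x \<in> chi a" using x(1) by (auto simp: TV_insert)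
    then show ?thesis
    proof cases
      case 1
      then show ?thesis using old g_even x by simp
    next
      case 2
      have "card (insert v ?Y - {\<beta> x}) = k" using new(2)[OF 2] vY gp by simp
      moreover have "insert v ?Y - {\<beta> x} \<subseteq> {1..n}" using vn gp by auto
      ultimately show ?thesis using new(1)[OF 2] gp by (simp add: nsets_def)
    qed
  qed
  moreover have "?f b \<in> nsets {1..n} (k + 1)" if "b \<in> insert a Q" for b
  proof (cases "b = a")
    case True
    have "card (insert v ?Y) = k + 1" using vY gp by simp
    then show ?thesis using True fa vn gp by (auto simp: nsets_def)
  next
    case False
    then have "b \<in> Q" using that by simp
    then show ?thesis using old Q_TV[of Q] g by (auto simp: Emb_def)
  qed
  moreover have "inj_on ?f (TV (insert a Q))"
    unfolding TV_insert
  proof (subst inj_on_Un, intro conjI)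
    show "inj_on ?f (TV Q)"
      using g old by (auto simp: Emb_def inj_on_def)
    show "inj_on ?f (insert a (chi a))"
    proof (subst inj_on_insert, intro conjI)
      show "inj_on ?f (chi a)"
      proof (rule inj_onI)
        fix c d assume cd: "c \<in> chi a" "d \<in> chi a" "?f c = ?f d"
        then have "insert v ?Y - {\<beta> c} = insert v ?Y - {\<beta> d}" using new by simp
        then have "\<beta> c = \<beta> d" using new(2)[OF cd(1)] new(2)[OF cd(2)] by blast
        then show "c = d" using \<beta> cd by (auto simp: bijs_def bij_betw_def inj_on_def)
      qed
      show "?f a \<notin> ?f ` (chi a - {a})"
      proof
        assume "?f a \<in> ?f ` (chi a - {a})"
        then obtain c where "c \<in> chi a" "?f a = ?f c" by auto
        then show False using new[of c] fa by auto
      qed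
    qed
    show "?f ` (TV Q - insert a (chi a)) \<inter> ?f ` (insert a (chi a) - TV Q) = {}"
    proof -
      have "?f x \<noteq> ?f y" if "x \<in> TV Q" "y \<in> insert a (chi a)" for x y
        using vf[OF that(2)] vg[OF that(1)] old[OF that(1)] by auto
      then show ?thesis by blast
    qed
  qed
  moreover have "?f x \<subseteq> ?f b \<longleftrightarrow> adj T x b"
    if x: "x \<in> TV (insert a Q)" "even (lev x)" and b: "b \<in> insert a Q" for x b
  proof -
    have xa: "x \<noteq> a" using x(2) a by (auto simp: Odd_def)
    have bO: "b \<in> Odd" using b a QO by auto
    show ?thesis
    proof (cases "x \<in> TV Q")
      case xT: True
      show ?thesis
      proof (cases "b = a")
        case True
        have "?f x \<subseteq> ?f b \<longleftrightarrow> g x \<subseteq> ?Y" using True fa old[OF xT] vg[OF xT] by auto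
        also have "\<dots> \<longleftrightarrow> g x = ?Y"
          using g_even[OF xT x(2)] gp card_subset_eq[OF gp(2), of "g x"] by (auto simp: nsets_def)
        also have "\<dots> \<longleftrightarrow> x = par a" using g xT pa by (auto simp: Emb_def inj_on_def)
        also have "\<dots> \<longleftrightarrow> adj T x b" using True adj_Odd_iff[OF a(1)] xT chi_disjoint_TV by auto
        finally show ?thesis .
      next
        case False
        then have "b \<in> Q" using b by simp
        then have "b \<in> TV Q" using Q_TV by blast
        moreover have "g x \<subseteq> g b \<longleftrightarrow> adj T x b"
          using g xT x(2) \<open>b \<in> Q\<close> unfolding Emb_def by blast
        ultimately show ?thesis using old[OF xT] old[of b] by simp
      qed
    next
      case False
      then have xc: "x \<in> chi a" using x xa by (auto simp: TV_insert)
      show ?thesis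
      proof (cases "b = a")
        case True
        then show ?thesis using new(1)[OF xc] fa adj_Odd_iff[OF a(1)] xc by auto
      next
        case bQ: False
        then have "b \<in> Q" using b by simp
        then have "?f b = g b" "v \<notin> g b" using old vg Q_TV[of Q] by auto
        then have "\<not> ?f x \<subseteq> ?f b" using vf[of x] xc by auto
        moreover have "\<not> adj T x b"
        proof
          assume "adj T x b"
          then consider "x = par b" | "x \<in> chi b" using adj_Odd_iff[OF bO] by blast
          then show False
          proof cases
            case 1
            then show False using Q \<open>b \<in> Q\<close> \<open>x \<notin> TV Q\<close> by (auto simp: closed_part_def)
          next
            case 2
            then show False using chi_TV[OF \<open>b \<in> Q\<close>] \<open>x \<notin> TV Q\<close> by auto
          qed
        qed
        ultimately show ?thesis by simp
      qed
    qed
  qed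
  moreover have "?f \<in> extensional (TV (insert a Q))"
    using g by (auto simp: extend_def extensional_def TV_insert Emb_def)
  ultimately have "?f \<in> Emb n w (insert a Q)" unfolding Emb_def by blast
  moreover have "restrict ?f (TV Q) = g"
  proof
    fix x show "restrict ?f (TV Q) x = g x"
      using old[of x] g by (cases "x \<in> TV Q") (auto simp: Emb_def extensional_def)
  qed
  ultimately show ?thesis by (simp add: fiber_def)
qed

lemma inj_on_extend: "inj_on extend (({1..n} - \<Union>(g ` TV Q)) \<times> bijs)"
proof (rule inj_onI, clarify)
  fix v \<beta> v' \<beta>'
  assume v: "v \<in> {1..n}" "v \<notin> \<Union>(g ` TV Q)" "v' \<in> {1..n}" "v' \<notin> \<Union>(g ` TV Q)"
    and \<beta>: "\<beta> \<in> bijs" "\<beta>' \<in> bijs" and eq: "extend (v, \<beta>) = extend (v', \<beta>')"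
  let ?Y = "g (par a)"
  have vY: "v \<notin> ?Y" "v' \<notin> ?Y" using v pa by auto
  have "insert v ?Y = insert v' ?Y" using fun_cong[OF eq, of a] by (simp add: extend_def)
  then have "v = v'" using vY by auto
  moreover have "\<beta> = \<beta>'"
  proof
    fix c show "\<beta> c = \<beta>' c"
    proof (cases "c \<in> chi a")
      case True
      then have Y: "\<beta> c \<in> ?Y" "\<beta>' c \<in> ?Y" using \<beta> by (auto simp: bijs_def)
      have "insert v ?Y - {\<beta> c} = insert v' ?Y - {\<beta>' c}"
      proof -
        have "c \<noteq> a" using True a_notin_chi by auto
        then show ?thesis using fun_cong[OF eq, of c] True by (simp add: extend_def)
      qed
      then show ?thesis using Y \<open>v = v'\<close> by blast
    next
      case False
      then show ?thesis using \<beta> PiE_arb[of \<beta> "chi a" "\<lambda>_. ?Y" c] PiE_arb[of \<beta>' "chi a" "\<lambda>_. ?Y" c]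
        by (simp add: bijs_def)
    qed
  qed
  ultimately show "v = v' \<and> \<beta> = \<beta>'" by simp
qed

lemma card_fiber_ge: "(n - (k + 1) * card (verts T)) * fact k \<le> card fiber"
proof -
  have "n - (k + 1) * card (verts T) \<le> card ({1..n} - \<Union>(g ` TV Q))"
    using card_support[OF QO g] diff_card_le_card_Diff[of "\<Union>(g ` TV Q)" "{1..n}"] by auto
  then have "(n - (k + 1) * card (verts T)) * fact k \<le> card (({1..n} - \<Union>(g ` TV Q)) \<times> bijs)"
    by (simp add: card_bijs card_cartesian_product)
  also have "\<dots> = card (extend ` (({1..n} - \<Union>(g ` TV Q)) \<times> bijs))"
    by (rule card_image[OF inj_on_extend, symmetric])
  also have "\<dots> \<le> card fiber"
    using extend_in_fiber finite_fiber by (intro card_mono) auto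
  finally show ?thesis .
qed

end

lemma card_Emb_insert:
  "card (Emb n w (insert a Q)) \<le> card (Emb n w Q) * (n * fact k)"
  "card (Emb n w Q) * ((n - (k + 1) * card (verts T)) * fact k) \<le> card (Emb n w (insert a Q))"
proof -
  have aQ: "insert a Q \<subseteq> Odd" using QO a by auto
  have "card (Emb n w (insert a Q)) = (\<Sum>f\<in>Emb n w (insert a Q). 1)" by simp
  also have "\<dots> = (\<Sum>g\<in>Emb n w Q. \<Sum>f\<in>{f \<in> Emb n w (insert a Q). restrict f (TV Q) = g}. 1)"
    using finite_Emb[OF aQ] finite_Emb[OF QO] restrict_Emb by (intro sum.group[symmetric]) auto
  also have "\<dots> = (\<Sum>g\<in>Emb n w Q. card (fiber g))"
    by (intro sum.cong refl) (simp add: fiber_def)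
  finally have eq: "card (Emb n w (insert a Q)) = (\<Sum>g\<in>Emb n w Q. card (fiber g))" .
  show "card (Emb n w (insert a Q)) \<le> card (Emb n w Q) * (n * fact k)"
    unfolding eq by (rule order_trans[OF sum_mono[OF card_fiber_le]]) auto
  show "card (Emb n w Q) * ((n - (k + 1) * card (verts T)) * fact k) \<le> card (Emb n w (insert a Q))"
    unfolding eq by (rule order_trans[OF _ sum_mono[OF card_fiber_ge]]) auto
qed

end

text \<open>Odd vertices are removed in order of decreasing level, and each contributes one factor
  to either bound.\<close>

lemma card_Emb:
  assumes "closed_part Q" "w \<in> nsets {1..n} k"
  shows "card (Emb n w Q) \<le> (n * fact k) ^ card Q \<and>
    ((n - (k + 1) * card (verts T)) * fact k) ^ card Q \<le> card (Emb n w Q)"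
  using assms(1)
proof (induction "card Q" arbitrary: Q rule: less_induct)
  case less
  have QO: "Q \<subseteq> Odd" using less.prems by (simp add: closed_part_def)
  have finO: "finite Odd" using finite_verts by (simp add: Odd_def)
  have finQ: "finite Q" using QO finO by (rule finite_subset)
  show ?case
  proof (cases "Q = {}")
    case True
    have "Emb n w Q = {restrict (\<lambda>_. w) {rt}}"
      using assms(2) True by (auto simp: Emb_def TV_def extensional_def fun_eq_iff)
    then show ?thesis using True by simp
  next
    case False
    \<comment> \<open>No member of \<open>Q\<close> lies below a deepest one, so removing it keeps
      the set closed under parents.\<close>
    have "Max (lev ` Q) \<in> lev ` Q" using finQ False by simp
    then obtain a where a: "a \<in> Q" "lev a = Max (lev ` Q)" by auto
    have max: "lev b \<le> lev a" if "b \<in> Q" for b using that a(2) finQ by simp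
    let ?Q = "Q - {a}"
    have closed: "par b \<in> TV ?Q" if b: "b \<in> Q" for b
    proof -
      have bv: "b \<in> verts T" "b \<noteq> rt" using b QO Odd_not_rt by auto
      have "par b \<in> TV Q" using less.prems b by (simp add: closed_part_def)
      then show ?thesis
      proof (cases rule: TV_cases)
        case 1
        then show ?thesis by (simp add: rt_TV)
      next
        case 2
        then show ?thesis using par_Odd[of b] b QO by (auto simp: Inner_def Odd_def)
      next
        case (3 c)
        then have "lev (par b) = Suc (lev c)" using chi_dest QO by blast
        then have "c \<noteq> a" using par(2)[OF bv] max[OF b] by auto
        then show ?thesis using 3 by (auto simp: TV_def)
      qed
    qed
    have cl: "closed_part ?Q" using QO closed by (auto simp: closed_part_def)
    have aO: "a \<in> Odd" "a \<notin> ?Q" "par a \<in> TV ?Q" using a QO closed by auto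
    have ins: "insert a ?Q = Q" using a by auto
    have card: "card Q = Suc (card ?Q)" using finQ a by (metis card_Suc_Diff1)
    have IH: "card (Emb n w ?Q) \<le> (n * fact k) ^ card ?Q \<and>
        ((n - (k + 1) * card (verts T)) * fact k) ^ card ?Q \<le> card (Emb n w ?Q)"
      using card by (intro less.hyps cl) simp
    show ?thesis
    proof
      have "card (Emb n w Q) \<le> card (Emb n w ?Q) * (n * fact k)"
        using card_Emb_insert(1)[OF cl aO, of n w] ins by simp
      also have "\<dots> \<le> (n * fact k) ^ card ?Q * (n * fact k)" using IH by (intro mult_right_mono) auto
      finally show "card (Emb n w Q) \<le> (n * fact k) ^ card Q" by (simp add: card mult.commute)
      have "((n - (k + 1) * card (verts T)) * fact k) ^ card ?Q * ((n - (k + 1) * card (verts T)) * fact k)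
          \<le> card (Emb n w ?Q) * ((n - (k + 1) * card (verts T)) * fact k)"
        using IH by (intro mult_right_mono) auto
      also have "\<dots> \<le> card (Emb n w Q)" using card_Emb_insert(2)[OF cl aO, of n w] ins by simp
      finally show "((n - (k + 1) * card (verts T)) * fact k) ^ card Q \<le> card (Emb n w Q)"
        by (simp add: card mult.commute)
    qed
  qed
qed

lemma card_Emb_asymp:
  assumes "\<And>n. n \<ge> k \<Longrightarrow> w n \<in> nsets {1..n} k"
  shows "(\<lambda>n. real (card (Emb n (w n) Odd)) / real n ^ card Odd) \<longlonglongrightarrow> fact k ^ card Odd"
proof (rule tendsto_sandwich)
  let ?c = "(k + 1) * card (verts T)" and ?a = "card Odd"
  have bounds: "card (Emb n (w n) Odd) \<le> (n * fact k) ^ ?a \<and>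
      ((n - ?c) * fact k) ^ ?a \<le> card (Emb n (w n) Odd)" if "n \<ge> k" for n
    using card_Emb[OF closed_part_Odd assms[OF that]] .
  show "\<forall>\<^sub>F n in sequentially. real (card (Emb n (w n) Odd)) / real n ^ ?a \<le> fact k ^ ?a"
  proof (rule eventually_sequentiallyI)
    fix n assume n: "n \<ge> k"
    have "real (card (Emb n (w n) Odd)) \<le> real ((n * fact k) ^ ?a)"
      using bounds[OF n] by (simp only: of_nat_le_iff)
    also have "\<dots> = fact k ^ ?a * real n ^ ?a" by (simp add: power_mult_distrib)
    finally show "real (card (Emb n (w n) Odd)) / real n ^ ?a \<le> fact k ^ ?a"
      using n k by (simp add: divide_le_eq)
  qed
  show "\<forall>\<^sub>F n in sequentially. (1 - real ?c / real n) ^ ?a * fact k ^ ?a \<le>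
      real (card (Emb n (w n) Odd)) / real n ^ ?a"
  proof (rule eventually_sequentiallyI)
    fix n assume n: "n \<ge> k + ?c"
    then have nk: "n \<ge> k" "n \<ge> ?c" and n0: "real n > 0" using k by auto
    have "(1 - real ?c / real n) ^ ?a * fact k ^ ?a = real (((n - ?c) * fact k) ^ ?a) / real n ^ ?a"
    proof -
      have "1 - real ?c / real n = real (n - ?c) / real n"
        using nk n0 by (simp only: of_nat_diff) (simp add: diff_divide_distrib)
      then show ?thesis by (simp add: power_divide power_mult_distrib)
    qed
    also have "\<dots> \<le> real (card (Emb n (w n) Odd)) / real n ^ ?a"
      using bounds[OF nk(1)] by (intro divide_right_mono) (simp_all only: of_nat_le_iff zero_le_power of_nat_0_le_iff)
    finally show "(1 - real ?c / real n) ^ ?a * fact k ^ ?a \<le> real (card (Emb n (w n) Odd)) / real n ^ ?a" .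
  qed
  have "(\<lambda>n. (1 - real ?c / real n) ^ ?a * fact k ^ ?a) \<longlonglongrightarrow> (1 - 0) ^ ?a * fact k ^ ?a"
    by (intro tendsto_intros lim_const_over_n)
  then show "(\<lambda>n. (1 - real ?c / real n) ^ ?a * fact k ^ ?a) \<longlonglongrightarrow> fact k ^ ?a" by simp
qed simp

end

section \<open>Isomorphisms of balls and local facet events\<close>

section \<open>Balls in hypertree graphs\<close>

lemma rooted_iso_map_cong:
  "(\<And>x. x \<in> verts G \<Longrightarrow> f x = g x) \<Longrightarrow> u \<in> verts G \<Longrightarrow>
    rooted_iso_map G u H w f \<longleftrightarrow> rooted_iso_map G u H w g"
  by (simp add: rooted_iso_map_def cong: bij_betw_cong)

lemma rooted_isomorphic_sym_imp:
  assumes "rooted_isomorphic G u H w" "u \<in> verts G"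
  shows "rooted_isomorphic H w G u"
proof -
  obtain f where f: "bij_betw f (verts G) (verts H)" "f u = w"
    "\<forall>x\<in>verts G. \<forall>y\<in>verts G. adj G x y \<longleftrightarrow> adj H (f x) (f y)"
    using assms(1) by (auto simp: rooted_isomorphic_def rooted_iso_map_def)
  let ?g = "inv_into (verts G) f"
  have g: "bij_betw ?g (verts H) (verts G)" by (rule bij_betw_inv_into[OF f(1)])
  have fg: "f (?g y) = y" "?g y \<in> verts G" if "y \<in> verts H" for y
    using f(1) g that by (auto simp: bij_betw_inv_into_right bij_betw_def inv_into_into)
  have "?g w = u" using f assms(2) by (metis bij_betw_inv_into_left)
  moreover have "adj H x y \<longleftrightarrow> adj G (?g x) (?g y)" if "x \<in> verts H" "y \<in> verts H" for x y
    using f(3) fg that by auto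
  ultimately show ?thesis using g by (auto simp: rooted_isomorphic_def rooted_iso_map_def)
qed

text \<open>Composition with one fixed isomorphism is a bijection from automorphisms to
  isomorphisms. Each ball of the right shape thus has one labelling per automorphism, which is the
  origin of the denominator in the limit.\<close>

lemma card_rooted_iso_maps:
  assumes u: "u \<in> verts G" and w: "w \<in> verts H"
  shows "card {f \<in> extensional (verts G). rooted_iso_map G u H w f} =
    (if rooted_isomorphic H w G u then Coset.order (rooted_Aut G u) else 0)"
proof (cases "rooted_isomorphic H w G u")
  case False
  then have empty: "{f \<in> extensional (verts G). rooted_iso_map G u H w f} = {}"
    using rooted_isomorphic_sym_imp[of G u H w] u by (auto simp: rooted_isomorphic_def)
  show ?thesis unfolding empty using False by simp
next
  case True
  let ?V = "verts G" and ?I = "{f \<in> extensional (verts G). rooted_iso_map G u H w f}"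
  let ?A = "{f \<in> Bij ?V. rooted_iso_map G u G u f}"
  obtain f where f: "bij_betw f ?V (verts H)" "f u = w"
    "\<forall>x\<in>?V. \<forall>y\<in>?V. adj G x y \<longleftrightarrow> adj H (f x) (f y)"
    using rooted_isomorphic_sym_imp[OF True w] by (auto simp: rooted_isomorphic_def rooted_iso_map_def)
  let ?g = "inv_into ?V f"
  have g: "bij_betw ?g (verts H) ?V" by (rule bij_betw_inv_into[OF f(1)])
  have gf: "?g (f x) = x" if "x \<in> ?V" for x by (rule bij_betw_inv_into_left[OF f(1) that])
  have fg: "f (?g y) = y" if "y \<in> verts H" for y by (rule bij_betw_inv_into_right[OF f(1) that])
  have "bij_betw (\<lambda>\<sigma>. restrict (f \<circ> \<sigma>) ?V) ?A ?I"
  proof (rule bij_betw_byWitness[where f' = "\<lambda>h. restrict (?g \<circ> h) ?V"])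
    show "\<forall>\<sigma>\<in>?A. restrict (?g \<circ> restrict (f \<circ> \<sigma>) ?V) ?V = \<sigma>"
    proof (intro ballI ext)
      fix \<sigma> x assume "\<sigma> \<in> ?A"
      then have \<sigma>: "\<sigma> \<in> extensional ?V" "bij_betw \<sigma> ?V ?V" by (auto simp: Bij_def)
      show "restrict (?g \<circ> restrict (f \<circ> \<sigma>) ?V) ?V x = \<sigma> x"
        using \<sigma>(1) gf bij_betwE[OF \<sigma>(2)] by (cases "x \<in> ?V") (auto simp: extensional_def)
    qed
    show "\<forall>h\<in>?I. restrict (f \<circ> restrict (?g \<circ> h) ?V) ?V = h"
    proof (intro ballI ext)
      fix h x assume "h \<in> ?I"
      then have h: "h \<in> extensional ?V" "bij_betw h ?V (verts H)" by (auto simp: rooted_iso_map_def)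
      show "restrict (f \<circ> restrict (?g \<circ> h) ?V) ?V x = h x"
        using h(1) fg bij_betwE[OF h(2)] by (cases "x \<in> ?V") (auto simp: extensional_def)
    qed
    show "(\<lambda>\<sigma>. restrict (f \<circ> \<sigma>) ?V) ` ?A \<subseteq> ?I"
    proof safe
      fix \<sigma> assume "\<sigma> \<in> Bij ?V" "rooted_iso_map G u G u \<sigma>"
      then have \<sigma>: "bij_betw \<sigma> ?V ?V" "\<sigma> u = u" "\<forall>x\<in>?V. \<forall>y\<in>?V. adj G x y \<longleftrightarrow> adj G (\<sigma> x) (\<sigma> y)"
        by (auto simp: rooted_iso_map_def)
      have "adj G x y \<longleftrightarrow> adj H (f (\<sigma> x)) (f (\<sigma> y))" if "x \<in> ?V" "y \<in> ?V" for x y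
      proof -
        have "\<sigma> x \<in> ?V" "\<sigma> y \<in> ?V" using bij_betwE[OF \<sigma>(1)] that by blast+
        then show ?thesis using f(3) \<sigma>(3) that by blast
      qed
      moreover have "bij_betw (f \<circ> \<sigma>) ?V (verts H)" by (rule bij_betw_trans[OF \<sigma>(1) f(1)])
      ultimately have "rooted_iso_map G u H w (f \<circ> \<sigma>)"
        unfolding rooted_iso_map_def using f(2) \<sigma>(2) by simp
      then show "rooted_iso_map G u H w (restrict (f \<circ> \<sigma>) ?V)"
        using rooted_iso_map_cong[of G "restrict (f \<circ> \<sigma>) ?V" "f \<circ> \<sigma>" u H w] u by simp
    qed simp
    show "(\<lambda>h. restrict (?g \<circ> h) ?V) ` ?I \<subseteq> ?A"
    proof safe
      fix h assume "rooted_iso_map G u H w h"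
      then have h: "bij_betw h ?V (verts H)" "h u = w" "\<forall>x\<in>?V. \<forall>y\<in>?V. adj G x y \<longleftrightarrow> adj H (h x) (h y)"
        by (auto simp: rooted_iso_map_def)
      have bij: "bij_betw (?g \<circ> h) ?V ?V" by (rule bij_betw_trans[OF h(1) g])
      have "adj G x y \<longleftrightarrow> adj G (?g (h x)) (?g (h y))" if "x \<in> ?V" "y \<in> ?V" for x y
      proof -
        have "h x \<in> verts H" "h y \<in> verts H" using h(1) that by (auto dest: bij_betwE)
        then have "?g (h x) \<in> ?V" "?g (h y) \<in> ?V" "f (?g (h x)) = h x" "f (?g (h y)) = h y"
          using bij_betwE[OF g] fg by blast+
        then show ?thesis using f(3) h(3) that by metis
      qed
      moreover have "?g (h u) = u" using gf[OF u] f(2) h(2) by simp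
      ultimately have iso: "rooted_iso_map G u G u (?g \<circ> h)"
        unfolding rooted_iso_map_def using bij by simp
      then show "rooted_iso_map G u G u (restrict (?g \<circ> h) ?V)"
        using rooted_iso_map_cong[of G "restrict (?g \<circ> h) ?V" "?g \<circ> h" u G u] u by simp
      show "restrict (?g \<circ> h) ?V \<in> Bij ?V"
        using bij by (simp add: Bij_def cong: bij_betw_cong)
    qed
  qed
  then show ?thesis
    using True bij_betw_same_card by (fastforce simp: order_def rooted_Aut_def)
qed

lemma verts_hypertree_graph:
  "F \<subseteq> nsets {1..n} (k + 1) \<Longrightarrow> verts (hypertree_graph n k F) = nsets {1..n} k \<union> F"
proof -
  assume F: "F \<subseteq> nsets {1..n} (k + 1)"
  have "{X \<in> F. card X = k + 1} = F" using F by (auto simp only: nsets_def)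
  then show ?thesis
    using F unfolding hypertree_graph_def induced_subgraph_def inclusion_graph_def by auto
qed

lemma adj_hypertree_graph:
  assumes F: "F \<subseteq> nsets {1..n} (k + 1)"
  shows "adj (hypertree_graph n k F) x y \<longleftrightarrow>
    x \<in> nsets {1..n} k \<and> y \<in> F \<and> x \<subseteq> y \<or> y \<in> nsets {1..n} k \<and> x \<in> F \<and> y \<subseteq> x"
proof -
  have FF: "{X \<in> F. card X = k + 1} = F" using F by (auto simp only: nsets_def)
  have disj: "X \<notin> F" if "X \<in> nsets {1..n} k" for X using F that by (auto simp: nsets_def)
  have disj': "X \<notin> nsets {1..n} k" if "X \<in> nsets {1..n} (k + 1)" for X using that by (auto simp: nsets_def)
  have "adj (inclusion_graph n k) x y \<longleftrightarrow>
      (\<exists>X Y. {x, y} = {X, Y} \<and> X \<in> nsets {1..n} (k + 1) \<and> Y \<in> nsets {1..n} k \<and> Y \<subset> X)"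
    by (simp add: adj_def inclusion_graph_def)
  also have "\<dots> \<longleftrightarrow> x \<in> nsets {1..n} (k + 1) \<and> y \<in> nsets {1..n} k \<and> y \<subset> x \<or>
      y \<in> nsets {1..n} (k + 1) \<and> x \<in> nsets {1..n} k \<and> x \<subset> y"
    by (auto simp only: doubleton_eq_iff)
  finally show ?thesis
    unfolding hypertree_graph_def adj_induced FF using F disj disj' by blast
qed

context semi_tree
begin

lemma Emb_dest:
  assumes "f \<in> Emb n w Odd"
  shows "x \<in> verts T \<Longrightarrow> even (lev x) \<Longrightarrow> f x \<in> nsets {1..n} k"
    and "a \<in> Odd \<Longrightarrow> f a \<in> nsets {1..n} (k + 1)"
    and "inj_on f (verts T)"
    and "x \<in> verts T \<Longrightarrow> even (lev x) \<Longrightarrow> a \<in> Odd \<Longrightarrow> f x \<subseteq> f a \<longleftrightarrow> adj T x a"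
    and "f rt = w" "f \<in> extensional (verts T)"
  using assms by (auto simp: Emb_def TV_Odd)

text \<open>A facet has \<open>k + 1\<close> faces of size \<open>k\<close>, and an odd vertex has
  \<open>k + 1\<close> neighbours with distinct images below it; counting shows that these images
  exhaust the faces.\<close>

lemma Odd_faces:
  assumes f: "f \<in> Emb n w Odd" and a: "a \<in> Odd" and X: "X \<subseteq> f a" "card X = k"
  obtains x where "adj T a x" "X = f x"
proof -
  let ?N = "{x. adj T a x}"
  have fa: "finite (f a)" "card (f a) = k + 1" using Emb_dest(2)[OF f a] by (auto simp: nsets_def)
  have N: "x \<in> verts T \<and> even (lev x)" if "x \<in> ?N" for x
    using that adj_verts[of a x] adj_parity[of a x] a by (auto simp: Odd_def)
  have "f ` ?N \<subseteq> nsets (f a) k"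
  proof
    fix y assume "y \<in> f ` ?N"
    then obtain x where x: "x \<in> ?N" "y = f x" by blast
    then have "f x \<subseteq> f a" using Emb_dest(4)[OF f _ _ a, of x] N[OF x(1)] adj_sym[of T a x] by simp
    moreover have "f x \<in> nsets {1..n} k" using Emb_dest(1)[OF f] N[OF x(1)] by blast
    ultimately show "y \<in> nsets (f a) k" using x(2) by (simp add: nsets_def)
  qed
  moreover have "card (f ` ?N) = card (nsets (f a) k)"
  proof -
    have "inj_on f ?N" using Emb_dest(3)[OF f] N by (auto intro: inj_on_subset)
    then show ?thesis using card_neighbours_Odd[OF a] fa by (simp add: card_image)
  qed
  moreover have "finite (nsets (f a) k)" using fa by (simp add: finite_imp_finite_nsets)
  ultimately have "f ` ?N = nsets (f a) k" by (simp add: card_subset_eq)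
  moreover have "X \<in> nsets (f a) k" using X fa by (auto simp: nsets_def intro: finite_subset)
  ultimately show thesis using that by (metis (mono_tags, lifting) imageE mem_Collect_eq)
qed

text \<open>Maps that preserve adjacency do not increase the distance to the root; the induction
  goes along parents.\<close>

lemma gdist_image_le:
  assumes "w \<in> verts G" "f rt = w" "\<And>x. x \<in> verts T \<Longrightarrow> f x \<in> verts G"
    and "\<And>x y. adj T x y \<Longrightarrow> adj G (f x) (f y)" and "v \<in> verts T"
  shows "gdist G w (f v) \<le> enat (lev v)"
  using assms(5)
proof (induction "lev v" arbitrary: v)
  case 0
  then have v: "v = rt" using lev_0_iff by simp
  show ?case unfolding v lev_rt gdist_le_0_iff using assms(1,2) by simp
next
  case (Suc l)
  then have v: "v \<noteq> rt" by auto
  note p = par[OF Suc.prems v]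
  have "gdist G w (f (par v)) \<le> enat (lev (par v))" using Suc.hyps(2) p by (intro Suc.hyps(1)) auto
  then have "gdist G w (f v) \<le> enat (Suc (lev (par v)))"
    by (rule gdist_adj) (use assms(3,4) p Suc.prems in auto)
  then show ?case using p by simp
qed

text \<open>A labelled copy fills the ball exactly when no further facet hangs on a
  \<open>k\<close>-set at distance less than \<open>r\<close>; the \<open>k\<close>-faces of its
  facets are all in the copy anyway. The shape of a ball is thereby a condition on the facets over
  the images of \<open>Inner\<close> alone.\<close>

lemma rooted_iso_map_iff:
  assumes F: "F \<subseteq> nsets {1..n} (k + 1)" and w: "w \<in> nsets {1..n} k" and ext: "f \<in> extensional (verts T)"
  defines "G \<equiv> hypertree_graph n k F"
  shows "rooted_iso_map T rt (gball G (int r) w) w f \<longleftrightarrow>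
    f \<in> Emb n w Odd \<and> F \<inter> cofaces n k (f ` Inner) = f ` Odd"
proof -
  let ?S = "nsets {1..n} k"
  have vG: "verts G = ?S \<union> F" unfolding G_def by (rule verts_hypertree_graph[OF F])
  have aG: "adj G x y \<longleftrightarrow> x \<in> ?S \<and> y \<in> F \<and> x \<subseteq> y \<or> y \<in> ?S \<and> x \<in> F \<and> y \<subseteq> x" for x y
    unfolding G_def by (rule adj_hypertree_graph[OF F])
  have disj: "X \<notin> F" if "X \<in> ?S" for X using F that by (auto simp: nsets_def)
  have vb: "verts (gball G (int r) w) = {v. gdist G w v \<le> enat r}" by (rule verts_gball)
  have ball_verts: "x \<in> verts G" if "x \<in> verts (gball G (int r) w)" for x
    using that gball_subgraph(1)[of G "int r" w] by blast
  show ?thesis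
  proof
    assume "rooted_iso_map T rt (gball G (int r) w) w f"
    then have f: "bij_betw f (verts T) (verts (gball G (int r) w))" "f rt = w"
      "\<And>x y. x \<in> verts T \<Longrightarrow> y \<in> verts T \<Longrightarrow> adj T x y \<longleftrightarrow> adj (gball G (int r) w) (f x) (f y)"
      by (auto simp: rooted_iso_map_def)
    have fb: "f x \<in> verts (gball G (int r) w)" if "x \<in> verts T" for x using f(1) that by (auto dest: bij_betwE)
    have adj: "adj T x y \<longleftrightarrow> adj G (f x) (f y)" if "x \<in> verts T" "y \<in> verts T" for x y
      using f(3)[OF that] adj_gball[OF fb[OF that(1)] fb[OF that(2)]] by simp
    \<comment> \<open>The root goes to a \<open>k\<close>-set and the graph is bipartite, so the
      level of a vertex decides the type of its image.\<close>
    have parity: "(even (lev x) \<longrightarrow> f x \<in> ?S) \<and> (odd (lev x) \<longrightarrow> f x \<in> F)" if "x \<in> verts T" for x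
      using that
    proof (induction "lev x" arbitrary: x)
      case 0
      then have "x = rt" using lev_0_iff by simp
      then show ?case using f(2) w by simp
    next
      case (Suc l)
      then have "x \<noteq> rt" by auto
      note p = par[OF Suc.prems this]
      have IH: "(even (lev (par x)) \<longrightarrow> f (par x) \<in> ?S) \<and> (odd (lev (par x)) \<longrightarrow> f (par x) \<in> F)"
        using Suc.hyps p by simp
      have "adj G (f (par x)) (f x)" using adj[OF p(3) Suc.prems] p(1) by simp
      moreover have "lev x = Suc (lev (par x))" using p(2) by simp
      ultimately show ?case using IH disj unfolding aG by (cases "even (lev (par x))") auto
    qed
    have incl: "f x \<subseteq> f a \<longleftrightarrow> adj T x a" if "x \<in> verts T" "even (lev x)" "a \<in> Odd" for x a
    proof -
      have "f x \<in> ?S" "f a \<in> F" "a \<in> verts T" using parity that by (auto simp: Odd_def)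
      then show ?thesis using adj[OF that(1), of a] disj unfolding aG by blast
    qed
    have inj: "inj_on f (verts T)" using f(1) by (simp add: bij_betw_def)
    have FO: "f a \<in> F" if "a \<in> Odd" for a using parity that by (auto simp: Odd_def)
    have emb: "f \<in> Emb n w Odd"
      unfolding Emb_def TV_Odd using ext f(2) parity FO F inj incl by blast
    moreover have "F \<inter> cofaces n k (f ` Inner) = f ` Odd"
    proof (intro equalityI subsetI)
      fix X assume "X \<in> f ` Odd"
      then obtain a where a: "a \<in> Odd" "X = f a" by blast
      have pI: "par a \<in> Inner" by (rule par_Odd[OF a(1)])
      then have "f (par a) \<subseteq> f a"
        using incl[of "par a" a] a par(1)[of a] Odd_not_rt by (auto simp: Inner_def)
      then show "X \<in> F \<inter> cofaces n k (f ` Inner)"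
        using a pI FO F by (auto simp: cofaces_def)
    next
      fix X assume "X \<in> F \<inter> cofaces n k (f ` Inner)"
      then obtain b where b: "b \<in> Inner" "f b \<subseteq> X" "X \<in> F" by (auto simp: cofaces_def)
      have bv: "b \<in> verts T" "even (lev b)" "lev b < r" using b(1) by (auto simp: Inner_def)
      \<comment> \<open>A facet over an inner \<open>k\<close>-set is at distance at most
        \<open>r\<close>; hence it lies in the ball and must be an image.\<close>
      have "gdist G w (f b) \<le> enat (lev b)"
      proof (rule gdist_image_le)
        show "w \<in> verts G" using w vG by blast
        show "f x \<in> verts G" if "x \<in> verts T" for x by (rule ball_verts[OF fb[OF that]])
        show "adj G (f x) (f y)" if "adj T x y" for x y
          using adj[of x y] adj_verts[OF that] that by simp
      qed (rule f(2), rule bv(1))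
      moreover have "adj G (f b) X" unfolding aG using b parity bv by blast
      ultimately have "gdist G w X \<le> enat (Suc (lev b))" by (rule gdist_adj) (use b vG in blast)
      also have "\<dots> \<le> enat r" using bv by simp
      finally have "X \<in> verts (gball G (int r) w)" unfolding vb by simp
      then obtain v where v: "v \<in> verts T" "X = f v" using f(1) by (auto simp: bij_betw_def)
      then have "odd (lev v)" using parity[OF v(1)] disj b(3) by auto
      then show "X \<in> f ` Odd" using v by (auto simp: Odd_def)
    qed
    ultimately show "f \<in> Emb n w Odd \<and> F \<inter> cofaces n k (f ` Inner) = f ` Odd" ..
  next
    assume "f \<in> Emb n w Odd \<and> F \<inter> cofaces n k (f ` Inner) = f ` Odd"
    then have emb: "f \<in> Emb n w Odd" and eq: "F \<inter> cofaces n k (f ` Inner) = f ` Odd" by auto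
    note e = Emb_dest[OF emb]
    have FO: "f a \<in> F" if "a \<in> Odd" for a using eq that by blast
    have parity: "even (lev x) \<longrightarrow> f x \<in> ?S" "odd (lev x) \<longrightarrow> f x \<in> F" if "x \<in> verts T" for x
      using e(1) FO that by (auto simp: Odd_def)
    have adj: "adj T x y \<longleftrightarrow> adj G (f x) (f y)" if xy: "x \<in> verts T" "y \<in> verts T" for x y
    proof -
      consider "even (lev x)" "even (lev y)" | "odd (lev x)" "odd (lev y)"
        | "even (lev x)" "y \<in> Odd" | "x \<in> Odd" "even (lev y)"
        using xy by (auto simp: Odd_def)
      then show ?thesis
      proof cases
        case 1
        then show ?thesis using adj_parity[of x y] parity xy disj unfolding aG by blast
      next
        case 2
        then show ?thesis using adj_parity[of x y] parity xy disj unfolding aG by blast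
      next
        case 3
        then show ?thesis using e(4)[of x y] xy parity FO disj unfolding aG by blast
      next
        case 4
        then show ?thesis using e(4)[of y x] xy parity FO disj adj_sym[of T] unfolding aG by blast
      qed
    qed
    have fG: "f x \<in> verts G" if "x \<in> verts T" for x using parity[OF that] vG by blast
    have wG: "w \<in> verts G" using w vG by blast
    \<comment> \<open>Exploration from the centre never leaves the image: from an even level the
      next vertex is a constrained facet, from an odd level a \<open>k\<close>-face of a facet of
      the copy.\<close>
    have "\<exists>v\<in>verts T. lev v \<le> i \<and> X = f v" if "gdist G w X \<le> enat i" "i \<le> r" for X i
      using that
    proof (induction i arbitrary: X)
      case 0
      then have "X = w" unfolding gdist_le_0_iff by simp
      then show ?case using e(5) T(5) by (intro bexI[of _ rt]) auto
    next
      case (Suc i)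
      from Suc.prems(1) consider "gdist G w X \<le> enat i"
        | w' where "gdist G w w' \<le> enat i" "adj G w' X" unfolding gdist_le_Suc_iff[of _ _ _ i] by blast
      then show ?case
      proof cases
        case 1
        then show ?thesis using Suc.IH[of X] Suc.prems(2) by force
      next
        case 2
        then obtain u where u: "u \<in> verts T" "lev u \<le> i" "w' = f u"
          using Suc.IH[of w'] Suc.prems(2) by auto
        show ?thesis
        proof (cases "even (lev u)")
          case True
          then have "X \<in> F" "f u \<subseteq> X" using 2(2) u parity disj unfolding aG by blast+
          moreover have uI: "u \<in> Inner" using True u Suc.prems(2) by (simp add: Inner_def)
          ultimately have "X \<in> F \<inter> cofaces n k (f ` Inner)" using F by (auto simp: cofaces_def)
          then obtain a where a: "a \<in> Odd" "X = f a" using eq by blast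
          then have "adj T u a" using e(4)[of u a] u True \<open>f u \<subseteq> X\<close> by simp
          then show ?thesis using lev_adj_le[of u a] u a Odd_not_rt[of a] by (intro bexI[of _ a]) auto
        next
          case False
          then have uO: "u \<in> Odd" using u by (simp add: Odd_def)
          then have "X \<in> ?S" "X \<subseteq> f u" using 2(2) u FO disj unfolding aG by blast+
          then obtain x where "adj T u x" "X = f x"
            using Odd_faces[OF emb uO, of X] by (auto simp: nsets_def)
          then show ?thesis using lev_adj_le[of u x] u adj_verts[of u x] by (intro bexI[of _ x]) auto
        qed
      qed
    qed
    moreover have "gdist G w (f v) \<le> enat r" if "v \<in> verts T" for v
    proof -
      have "gdist G w (f v) \<le> enat (lev v)"
      proof (rule gdist_image_le)
        show "adj G (f x) (f y)" if "adj T x y" for x y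
          using adj[of x y] adj_verts[OF that] that by simp
      qed (rule wG, rule e(5), rule fG, assumption, rule that)
      also have "\<dots> \<le> enat r" using lev_le_r[OF that] by simp
      finally show ?thesis .
    qed
    ultimately have im: "verts (gball G (int r) w) = f ` verts T" unfolding vb by blast
    then have bij: "bij_betw f (verts T) (verts (gball G (int r) w))"
      using e(3) by (simp add: bij_betw_def)
    have "adj T x y \<longleftrightarrow> adj (gball G (int r) w) (f x) (f y)" if "x \<in> verts T" "y \<in> verts T" for x y
      using adj[OF that] adj_gball[of "f x" G "int r" w "f y"] im that by simp
    then show "rooted_iso_map T rt (gball G (int r) w) w f"
      using bij e(5) by (simp add: rooted_iso_map_def)
  qed
qed

text \<open>Multiplication by the order of the automorphism group counts labellings; exchanging the
  sums over facet sets and over embeddings then leaves one local event per embedding.\<close>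

lemma measure_times_order_Aut:
  assumes n: "n \<ge> k + 1" and w: "w \<in> nsets {1..n} k"
  shows "measure (hypertree_measure n k) {C \<in> space (hypertree_measure n k).
      rooted_isomorphic (gball (hypertree_graph n k C) (int r) w) w T rt} *
    real (Coset.order (rooted_Aut T rt)) = (\<Sum>f\<in>Emb n w Odd. local_prob n k (f ` Odd) (f ` Inner))"
proof -
  let ?Q = "\<lambda>F. rooted_isomorphic (gball (hypertree_graph n k F) (int r) w) w T rt"
  let ?Fs = "{F. F \<subseteq> nsets {1..n} (k + 1) \<and> card F = (n - 1) choose k}"
  let ?c = "real n ^ ((n - 2) choose k)" and ?o = "Coset.order (rooted_Aut T rt)"
  let ?w = "facet_weight n k"
  have finFs: "finite ?Fs" by (simp add: finite_imp_finite_nsets)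
  have finE: "finite (Emb n w Odd)" by (rule finite_Emb) simp
  have "hypertree_graph n k {X \<in> C. card X = k + 1} = hypertree_graph n k C" for C
    by (simp add: hypertree_graph_def)
  then have "measure (hypertree_measure n k) {C \<in> space (hypertree_measure n k). ?Q C} =
      (\<Sum>F | F \<subseteq> nsets {1..n} (k + 1) \<and> card F = (n - 1) choose k \<and> ?Q F. ?w F) / ?c"
    using measure_hypertree_measure[OF k n, of ?Q] by simp
  also have "(\<Sum>F | F \<subseteq> nsets {1..n} (k + 1) \<and> card F = (n - 1) choose k \<and> ?Q F. ?w F) =
      (\<Sum>F\<in>?Fs. if ?Q F then ?w F else 0)"
    using finFs by (intro sum.mono_neutral_cong_left) auto
  finally have m0: "measure (hypertree_measure n k) {C \<in> space (hypertree_measure n k). ?Q C} =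
      (\<Sum>F\<in>?Fs. if ?Q F then ?w F else 0) / ?c" .
  have m: "measure (hypertree_measure n k) {C \<in> space (hypertree_measure n k). ?Q C} * real ?o =
      (\<Sum>F\<in>?Fs. ?w F * real (if ?Q F then ?o else 0)) / ?c"
    unfolding m0 times_divide_eq_left sum_distrib_right
    by (intro arg_cong2[where f = "(/)"] sum.cong refl) simp
  have card: "(if ?Q F then ?o else 0) =
      card {f \<in> Emb n w Odd. F \<inter> cofaces n k (f ` Inner) = f ` Odd}" if "F \<in> ?Fs" for F
  proof -
    have F: "F \<subseteq> nsets {1..n} (k + 1)" using that by simp
    have wv: "w \<in> verts (gball (hypertree_graph n k F) (int r) w)"
    proof -
      have "w \<in> verts (hypertree_graph n k F)" using verts_hypertree_graph[OF F] w by blast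
      then have "gdist (hypertree_graph n k F) w w \<le> enat 0" unfolding gdist_le_0_iff by simp
      also have "\<dots> \<le> enat r" by simp
      finally show ?thesis by (simp add: verts_gball)
    qed
    have "f \<in> extensional (verts T) \<and> rooted_iso_map T rt (gball (hypertree_graph n k F) (int r) w) w f \<longleftrightarrow>
        f \<in> Emb n w Odd \<and> F \<inter> cofaces n k (f ` Inner) = f ` Odd" for f
      using rooted_iso_map_iff[OF F w, of f] Emb_dest(6)[of f n w] by blast
    then have "{f \<in> extensional (verts T). rooted_iso_map T rt (gball (hypertree_graph n k F) (int r) w) w f} =
        {f \<in> Emb n w Odd. F \<inter> cofaces n k (f ` Inner) = f ` Odd}"
      by (intro Collect_cong)
    then show ?thesis using card_rooted_iso_maps[OF T(5) wv] by simp
  qed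
  have "(\<Sum>F\<in>?Fs. ?w F * real (if ?Q F then ?o else 0)) =
      (\<Sum>F\<in>?Fs. \<Sum>f\<in>Emb n w Odd. if F \<inter> cofaces n k (f ` Inner) = f ` Odd then ?w F else 0)"
  proof (rule sum.cong[OF refl])
    fix F assume "F \<in> ?Fs"
    have "(\<Sum>f\<in>Emb n w Odd. if F \<inter> cofaces n k (f ` Inner) = f ` Odd then ?w F else 0) =
        (\<Sum>f | f \<in> Emb n w Odd \<and> F \<inter> cofaces n k (f ` Inner) = f ` Odd. ?w F)"
      using finE by (intro sum.mono_neutral_cong_right) auto
    then show "?w F * real (if ?Q F then ?o else 0) =
        (\<Sum>f\<in>Emb n w Odd. if F \<inter> cofaces n k (f ` Inner) = f ` Odd then ?w F else 0)"
      unfolding card[OF \<open>F \<in> ?Fs\<close>] by simp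
  qed
  also have "\<dots> = (\<Sum>f\<in>Emb n w Odd. \<Sum>F\<in>?Fs. if F \<inter> cofaces n k (f ` Inner) = f ` Odd then ?w F else 0)"
    by (rule sum.swap)
  also have "\<dots> = (\<Sum>f\<in>Emb n w Odd. \<Sum>F | F \<subseteq> nsets {1..n} (k + 1) \<and> card F = (n - 1) choose k \<and>
      F \<inter> cofaces n k (f ` Inner) = f ` Odd. ?w F)"
    using finFs by (intro sum.cong refl sum.mono_neutral_cong_right) auto
  finally show ?thesis unfolding m by (simp add: local_prob_def sum_divide_distrib)
qed

text \<open>All \<open>k\<close>-faces of facets of the copy belong to the copy, so the other
  \<open>k\<close>-subsets of \<open>U\<close> split off as an identity block. The rest, read
  through the labelling, is a skew-symmetric edge matrix of the tree with diagonal 0 on the vertices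
  to be covered. The value is thus the same for every copy and every \<open>U\<close>.\<close>

lemma fdet_core_matrix:
  assumes f: "f \<in> Emb n w Odd" and U: "\<Union>(f ` verts T) \<subseteq> U" "finite U"
  shows "fdet (nsets U k \<union> f ` Odd) (core_matrix (f ` Odd) (f ` Inner)) = real (m_star T rt r)"
proof -
  let ?A = "f ` Odd" and ?B = "f ` Inner" and ?V = "verts T"
  let ?M = "core_matrix (f ` Odd) (f ` Inner)"
  note e = Emb_dest[OF f]
  define R where "R = nsets U k - f ` ?V"
  have finU: "finite (nsets U k)" using U by (simp add: finite_imp_finite_nsets)
  have fS: "f x \<in> nsets U k" if "x \<in> ?V" "even (lev x)" for x
    using e(1)[OF that] U(1) that by (auto simp: nsets_def)
  have cA: "card (f a) = k + 1" "finite (f a)" if "a \<in> Odd" for a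
    using e(2)[OF that] by (auto simp: nsets_def)
  have cE: "card (f x) = k" "finite (f x)" if "x \<in> ?V" "even (lev x)" for x
    using e(1)[OF that] by (auto simp: nsets_def)
  have AV: "Odd \<subseteq> ?V" "Inner \<subseteq> ?V" by (auto simp: Odd_def Inner_def)
  have OddI: "x \<in> Odd" if "x \<in> ?V" "odd (lev x)" for x using that by (simp add: Odd_def)
  have inA: "f x \<in> ?A \<longleftrightarrow> x \<in> Odd" and inB: "f x \<in> ?B \<longleftrightarrow> x \<in> Inner" if "x \<in> ?V" for x
    using inj_on_image_mem_iff[OF e(3) that] AV by blast+
  have RA: "x \<notin> ?A" if "x \<in> R" for x using that AV by (auto simp: R_def)
  have RB: "x \<notin> ?B" if "x \<in> R" for x using that AV by (auto simp: R_def)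
  have "f ` ?V \<subseteq> nsets U k \<union> ?A"
  proof (rule image_subsetI)
    fix x assume "x \<in> ?V"
    then show "f x \<in> nsets U k \<union> ?A" using fS[of x] OddI[of x] by (cases "even (lev x)") auto
  qed
  then have "nsets U k \<union> ?A = f ` ?V \<union> R" using AV unfolding R_def by blast
  then have "fdet (nsets U k \<union> ?A) ?M = fdet (f ` ?V \<union> R) ?M" by simp
  also have "\<dots> = fdet (f ` ?V) ?M * fdet R ?M"
  proof (rule fdet_block)
    show "finite (f ` ?V)" using finite_verts by simp
    show "finite R" using finU by (simp add: R_def)
    show "f ` ?V \<inter> R = {}" by (auto simp: R_def)
    fix i j assume i: "i \<in> f ` ?V" and j: "j \<in> R"
    have ij: "i \<noteq> j" using i j by (auto simp: R_def)
    show "?M i j = 0"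
    proof (cases "i \<in> ?A")
      case True
      then obtain a where a: "a \<in> Odd" "i = f a" by blast
      have "inc j i = (0::real)"
      proof (rule ccontr)
        assume "inc j i \<noteq> (0::real)"
        then have "j \<subseteq> f a" using a inc_nonzero_subset by blast
        moreover have "card j = k" using j by (simp add: R_def nsets_def)
        ultimately obtain x where x: "adj T a x" "j = f x" using Odd_faces[OF f a(1)] by blast
        then have "x \<in> ?V" using adj_verts by blast
        then show False using x(2) j by (auto simp: R_def)
      qed
      then show ?thesis using True RA[OF j] by (simp add: core_matrix_def)
    next
      case False
      then show ?thesis using ij RA[OF j] by (simp add: core_matrix_def)
    qed
  qed
  also have "fdet R ?M = fdet R (\<lambda>x y. if x = y then 1 else 0)"
    by (rule fdet_cong) (auto simp: core_matrix_def RA RB)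
  also have "\<dots> = 1" using finU by (intro fdet_identity) (simp add: R_def)
  also have "fdet (f ` ?V) ?M = fdet ?V (\<lambda>x y. ?M (f x) (f y))"
    by (rule fdet_reindex[OF finite_verts e(3)])
  also have "\<dots> = real (card {M. matching T M \<and> Odd \<union> Inner \<subseteq> \<Union>M})"
  proof (rule fdet_eq_card_matchings[OF finite_verts T(1,3)])
    show "Odd \<union> Inner \<subseteq> ?V" using AV by simp
    show "?M (f x) (f x) = (if x \<in> Odd \<union> Inner then 0 else 1)" if "x \<in> ?V" for x
      using inA[OF that] inB[OF that] by (simp add: core_matrix_def)
    have mixed: "?M (f x) (f a) * ?M (f a) (f x) = - 1" if "adj T x a" "a \<in> Odd" for x a
    proof -
      have x: "x \<in> ?V" "even (lev x)" using that adj_verts[of x a] adj_parity[of x a] by (auto simp: Odd_def)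
      then have "f x \<subseteq> f a" using e(4)[OF x that(2)] that(1) by simp
      then have "inc (f x) (f a) \<noteq> (0::real)" using cA[OF that(2)] cE[OF x] by (subst inc_nonzero_iff) auto
      then have "inc (f x) (f a) * inc (f x) (f a) = (1::real)" using inc_cases_real[of "f x" "f a"] by auto
      moreover have "f x \<notin> ?A" "f a \<in> ?A" using inA[OF x(1)] x(2) that(2) by (auto simp: Odd_def)
      ultimately show ?thesis by (simp add: core_matrix_def)
    qed
    show "?M (f x) (f y) * ?M (f y) (f x) = - 1" if "x \<in> ?V" "y \<in> ?V" "adj T x y" for x y
    proof (cases "y \<in> Odd")
      case True
      then show ?thesis using mixed that by blast
    next
      case False
      then have "x \<in> Odd" using that adj_parity[of x y] by (auto simp: Odd_def)
      then show ?thesis using mixed[of y x] adj_sym[OF that(3)] by (simp add: mult.commute)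
    qed
    show "?M (f x) (f y) = 0" if xy: "x \<in> ?V" "y \<in> ?V" "x \<noteq> y" "\<not> adj T x y" for x y
    proof -
      have zero: "inc (f x) (f a) = (0::real)" if "x \<in> ?V" "a \<in> Odd" "x \<notin> Odd" "\<not> adj T x a" for x a
      proof (rule ccontr)
        assume "inc (f x) (f a) \<noteq> (0::real)"
        then have "f x \<subseteq> f a" by (rule inc_nonzero_subset)
        then show False using e(4)[of x a] that OddI by auto
      qed
      have "f x \<noteq> f y" using e(3) xy by (auto simp: inj_on_def)
      then show ?thesis
        using inA[OF xy(1)] inA[OF xy(2)] zero[of x y] zero[of y x] xy adj_sym[of T y x]
        by (auto simp: core_matrix_def)
    qed
  qed
  finally show ?thesis by (simp add: m_star_eq)
qed

text \<open>The copy may be a different one for each \<open>n\<close>; the sizes and the core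
  determinant do not see this.\<close>

lemma local_prob_Emb_tendsto:
  assumes "\<forall>\<^sub>F n in sequentially. f n \<in> Emb n (w n) Odd"
  shows "(\<lambda>n. local_prob n k (f n ` Odd) (f n ` Inner) * real n ^ card Odd) \<longlonglongrightarrow>
    real (m_star T rt r) * exp (- real (k * card Inner))"
proof -
  let ?s = "(k + 1) * card (verts T)"
  have "\<forall>\<^sub>F n in sequentially. \<exists>U. facet_config n k U (f n ` Odd) (f n ` Inner) \<and> card U = ?s \<and>
      card (f n ` Odd) = card Odd \<and> card (f n ` Inner) = card Inner \<and>
      fdet (nsets U k \<union> f n ` Odd) (core_matrix (f n ` Odd) (f n ` Inner)) = real (m_star T rt r)"
    using assms eventually_ge_at_top[of "max 2 ?s"]
  proof eventually_elim
    case (elim n)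
    then have f: "f n \<in> Emb n (w n) Odd" and n: "n \<ge> 2" "n \<ge> ?s" by auto
    note e = Emb_dest[OF f]
    let ?P = "\<Union>(f n ` verts T)"
    have P: "finite ?P" "card ?P \<le> ?s" using card_support[OF _ f] by (auto simp: TV_Odd)
    have fsub: "f n x \<subseteq> {1..n} \<and> finite (f n x)" if "x \<in> verts T" for x
      using e(1)[OF that] e(2)[of x] that by (cases "even (lev x)") (auto simp: nsets_def Odd_def)
    then have "?P \<subseteq> {1..n}" by blast
    \<comment> \<open>The support is padded to a size that is the same for all copies, so that they
      share all constants.\<close>
    then obtain U where U: "?P \<subseteq> U" "U \<subseteq> {1..n}" "card U = ?s"
      using exists_subset_between[of ?P ?s "{1..n}"] P n by auto
    have sub: "f n x \<subseteq> U" if "x \<in> verts T" for x using U(1) that by blast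
    have AV: "Odd \<subseteq> verts T" "Inner \<subseteq> verts T" by (auto simp: Odd_def Inner_def)
    have "facet_config n k U (f n ` Odd) (f n ` Inner)"
    proof
      show "k \<ge> 1" "n \<ge> 2" "U \<subseteq> {1..n}" by (rule k, rule n(1), rule U(2))
      show "f n ` Inner \<subseteq> nsets U k"
        using e(1) sub by (auto simp: Inner_def nsets_def)
      show "f n ` Odd \<subseteq> nsets U (k + 1)"
        using e(2) sub AV by (auto simp: nsets_def)
      fix X assume "X \<in> f n ` Odd"
      then obtain a where a: "a \<in> Odd" "X = f n a" by blast
      have pI: "par a \<in> Inner" by (rule par_Odd[OF a(1)])
      then have "f n (par a) \<subseteq> f n a"
        using e(4)[of "par a" a] a(1) par(1)[of a] Odd_not_rt[OF a(1)] by (auto simp: Inner_def)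
      then show "\<exists>Y\<in>f n ` Inner. Y \<subseteq> X" using a pI by blast
    qed
    moreover have "card (f n ` Odd) = card Odd" "card (f n ` Inner) = card Inner"
      using e(3) AV by (auto intro!: card_image intro: inj_on_subset)
    moreover have "finite U" using U(2) by (rule finite_subset) simp
    ultimately show ?case using fdet_core_matrix[OF f U(1)] U(3) by blast
  qed
  then obtain U where "\<forall>\<^sub>F n in sequentially. facet_config n k (U n) (f n ` Odd) (f n ` Inner) \<and> card (U n) = ?s \<and>
      card (f n ` Odd) = card Odd \<and> card (f n ` Inner) = card Inner \<and>
      fdet (nsets (U n) k \<union> f n ` Odd) (core_matrix (f n ` Odd) (f n ` Inner)) = real (m_star T rt r)"
    unfolding eventually_sequentially by metis
  then show ?thesis by (rule local_prob_tendsto)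
qed

section \<open>Summation over all copies\<close>

lemma Emb_nonempty:
  assumes "w \<in> nsets {1..n} k" "n > (k + 1) * card (verts T)"
  shows "Emb n w Odd \<noteq> {}"
proof
  assume "Emb n w Odd = {}"
  moreover have "((n - (k + 1) * card (verts T)) * fact k) ^ card Odd \<le> card (Emb n w Odd)"
    using card_Emb[OF closed_part_Odd assms(1)] by blast
  ultimately show False using assms(2) by simp
qed

text \<open>The number of summands grows, so uniformity is needed: the smallest and the largest
  summand for each \<open>n\<close> form two sequences of copies with the same limit, and the sum
  lies between their multiples by the number of embeddings.\<close>

lemma sum_local_prob_tendsto:
  assumes w: "\<And>n. n \<ge> k \<Longrightarrow> w n \<in> nsets {1..n} k"
  shows "(\<lambda>n. \<Sum>f\<in>Emb n (w n) Odd. local_prob n k (f ` Odd) (f ` Inner)) \<longlonglongrightarrow>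
    fact k ^ card Odd * (real (m_star T rt r) * exp (- real (k * card Inner)))"
proof -
  let ?P = "\<lambda>n f. local_prob n k (f ` Odd) (f ` Inner)" and ?E = "\<lambda>n. Emb n (w n) Odd"
  \<comment> \<open>From this threshold on embeddings exist, so the extremes are attained.\<close>
  let ?N = "max k (Suc ((k + 1) * card (verts T)))"
  define lo where "lo n = arg_min_on (?P n) (?E n)" for n
  define hi where "hi n = arg_min_on (\<lambda>f. - ?P n f) (?E n)" for n
  have fin: "finite (?E n)" for n by (rule finite_Emb) simp
  have ne: "?E n \<noteq> {}" if "n \<ge> ?N" for n
    using Emb_nonempty[OF w] that by auto
  have lo: "lo n \<in> ?E n" "\<And>f. f \<in> ?E n \<Longrightarrow> ?P n (lo n) \<le> ?P n f" if "n \<ge> ?N" for n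
    using arg_min_if_finite(1)[OF fin ne[OF that], of "?P n"]
      arg_min_least[OF fin ne[OF that], of _ "?P n"] by (auto simp: lo_def)
  have hi: "hi n \<in> ?E n" "\<And>f. f \<in> ?E n \<Longrightarrow> ?P n f \<le> ?P n (hi n)" if "n \<ge> ?N" for n
    using arg_min_if_finite(1)[OF fin ne[OF that], of "\<lambda>f. - ?P n f"]
      arg_min_least[OF fin ne[OF that], of _ "\<lambda>f. - ?P n f"] by (auto simp: hi_def)
  have n0: "real n > 0" if "n \<ge> ?N" for n using that by auto
  let ?lim = "real (m_star T rt r) * exp (- real (k * card Inner))"
  have lim_lo: "(\<lambda>n. ?P n (lo n) * real n ^ card Odd) \<longlonglongrightarrow> ?lim"
    by (rule local_prob_Emb_tendsto, rule eventually_sequentiallyI[of ?N]) (rule lo(1))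
  have lim_hi: "(\<lambda>n. ?P n (hi n) * real n ^ card Odd) \<longlonglongrightarrow> ?lim"
    by (rule local_prob_Emb_tendsto, rule eventually_sequentiallyI[of ?N]) (rule hi(1))
  note cnt = card_Emb_asymp[OF w]
  show ?thesis
  proof (rule tendsto_sandwich[OF _ _ tendsto_mult[OF cnt lim_lo] tendsto_mult[OF cnt lim_hi]])
    show "\<forall>\<^sub>F n in sequentially. real (card (?E n)) / real n ^ card Odd *
        (?P n (lo n) * real n ^ card Odd) \<le> (\<Sum>f\<in>?E n. ?P n f)"
    proof (rule eventually_sequentiallyI)
      fix n assume n: "n \<ge> ?N"
      have "real (card (?E n)) / real n ^ card Odd * (?P n (lo n) * real n ^ card Odd) =
          (\<Sum>f\<in>?E n. ?P n (lo n))" using n0[OF n] by simp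
      also have "\<dots> \<le> (\<Sum>f\<in>?E n. ?P n f)" by (intro sum_mono lo(2)[OF n])
      finally show "real (card (?E n)) / real n ^ card Odd *
        (?P n (lo n) * real n ^ card Odd) \<le> (\<Sum>f\<in>?E n. ?P n f)" .
    qed
    show "\<forall>\<^sub>F n in sequentially. (\<Sum>f\<in>?E n. ?P n f) \<le> real (card (?E n)) / real n ^ card Odd *
        (?P n (hi n) * real n ^ card Odd)"
    proof (rule eventually_sequentiallyI)
      fix n assume n: "n \<ge> ?N"
      have "(\<Sum>f\<in>?E n. ?P n f) \<le> (\<Sum>f\<in>?E n. ?P n (hi n))" by (intro sum_mono hi(2)[OF n])
      also have "\<dots> = real (card (?E n)) / real n ^ card Odd * (?P n (hi n) * real n ^ card Odd)"
        using n0[OF n] by simp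
      finally show "(\<Sum>f\<in>?E n. ?P n f) \<le> real (card (?E n)) / real n ^ card Odd *
        (?P n (hi n) * real n ^ card Odd)" .
    qed
  qed
qed

text \<open>The order of an infinite group would be 0; finiteness of the tree and the identity map
  together make the division legitimate.\<close>

lemma order_Aut_pos: "Coset.order (rooted_Aut T rt) > 0"
proof -
  let ?A = "{f \<in> Bij (verts T). rooted_iso_map T rt T rt f}"
  have "?A \<subseteq> verts T \<rightarrow>\<^sub>E verts T" by (auto simp: Bij_def bij_betw_def PiE_def)
  then have "finite ?A" by (rule finite_subset) (simp add: finite_PiE finite_verts)
  moreover have "restrict id (verts T) \<in> ?A"
    using T(5) by (auto simp: Bij_def rooted_iso_map_def bij_betw_def inj_on_def)
  ultimately have "card ?A > 0" by (metis card_gt_0_iff empty_iff)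
  then show ?thesis by (simp add: order_def rooted_Aut_def)
qed

end

section \<open>The limit\<close>

theorem theorem1p5:
  fixes k r :: nat
    and T :: "'v ugraph"
    and rt :: 'v
    and rn :: "nat \<Rightarrow> nat set"
  assumes "k \<ge> 1"
    and "semi_k_ary_rooted_tree k T rt"
    and "depth T rt = enat r"
    and "\<And>n. n \<ge> k \<Longrightarrow> rn n \<in> nsets {1..n} k"
  shows "(\<lambda>n. measure (hypertree_measure n k)
            {C \<in> space (hypertree_measure n k).
               rooted_isomorphic (gball (hypertree_graph n k C) (int r) (rn n)) (rn n) T rt})
         \<longlonglongrightarrow>
         real (m_star T rt r) * fact k ^ card (odd_verts T rt)
           * exp (- (real k * real (card (even_verts (gball T (int r - 1) rt) rt))))
           / real (Coset.order (rooted_Aut T rt))"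
proof -
  interpret semi_tree k r T rt by unfold_locales (fact assms)+
  let ?o = "real (Coset.order (rooted_Aut T rt))"
  let ?S = "\<lambda>n. \<Sum>f\<in>Emb n (rn n) Odd. local_prob n k (f ` Odd) (f ` Inner)"
  have o: "?o \<noteq> 0" using order_Aut_pos by simp
  have "(\<lambda>n. ?S n / ?o) \<longlonglongrightarrow>
      fact k ^ card Odd * (real (m_star T rt r) * exp (- real (k * card Inner))) / ?o"
    by (intro tendsto_divide sum_local_prob_tendsto assms(4) tendsto_const o)
  moreover have "\<forall>\<^sub>F n in sequentially. ?S n / ?o = measure (hypertree_measure n k)
      {C \<in> space (hypertree_measure n k).
        rooted_isomorphic (gball (hypertree_graph n k C) (int r) (rn n)) (rn n) T rt}"
  \<comment> \<open>The formula by labelled copies is available from \<open>n = k + 1\<close> on;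
    the limit ignores the finitely many earlier \<open>n\<close>.\<close>
  proof (rule eventually_sequentiallyI)
    fix n assume n: "n \<ge> k + 1"
    then have "rn n \<in> nsets {1..n} k" by (intro assms(4)) simp
    from measure_times_order_Aut[OF n this] o
    show "?S n / ?o = measure (hypertree_measure n k) {C \<in> space (hypertree_measure n k).
        rooted_isomorphic (gball (hypertree_graph n k C) (int r) (rn n)) (rn n) T rt}"
      by (simp add: nonzero_divide_eq_eq)
  qed
  ultimately show ?thesis
    by (rule Lim_transform_eventually[THEN tendsto_eq_rhs])
      (simp add: odd_verts_eq even_verts_inner_ball)
qed

end
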